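(* Let $m>1$ and $n>1$ be integers and let $R=(r_1,\ldots,r_m)$ and $C=(c_1,\ldots,c_n)$ be vectors of positive integers with $r_1+\cdots+r_m=c_1+\cdots+c_n=N$. Let $\mathcal{P}=\mathcal{P}(R,C)$ be the polytope of $m\times n$ real matrices $X=(x_{ij})$ with $x_{ij}\ge 0$ for all $i,j$, $\sum_{j=1}^n x_{ij}=r_i$ for $i=1,\ldots,m$ and $\sum_{i=1}^m x_{ij}=c_j$ for $j=1,\ldots,n$. Let $$\beta=\beta(R,C)=\max_{X=(x_{ij})\in\mathcal{P}}\prod_{i,j}x_{ij}.$$ Then $$\beta e^{mn}N^{\gamma(m+n)}\ \ge\ \operatorname{vol}(\mathcal{P})\ \ge\ \beta e^{mn}N^{-\gamma(m+n)},$$ where $\gamma>0$ is an absolute constant.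
   Context: The space of $m\times n$ real matrices is identified with $\mathbb{R}^{mn}$ with its standard Euclidean structure; $\mathcal{P}$ has dimension $(m-1)(n-1)$, and $\operatorname{vol}(\mathcal{P})$ is its $(m-1)(n-1)$-dimensional volume with respect to the Euclidean structure on the affine span of $\mathcal{P}$ induced from $\mathbb{R}^{mn}$. *)

theory Defs
  imports "HOL-Analysis.Analysis"
begin

text \<open>
  The dimension of the ambient space is quantified inside the theorem, so $\mathbb{R}^I$, for a
  finite index set $I$, is the set of extensional functions \<open>I \<rightarrow>\<^sub>E UNIV\<close>.  An $m \times n$ matrix is a
  point of $\mathbb{R}^I$ with $I$ the set of pairs $(i,j)$, $i < m$, $j < n$; indices start at $0$.
\<close>

definition affine_span_on :: "'i set \<Rightarrow> ('i \<Rightarrow> real) set \<Rightarrow> ('i \<Rightarrow> real) set" where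
  "affine_span_on I S =
     {(\<lambda>i\<in>I. \<Sum>x\<in>T. w x * x i) | T w. finite T \<and> T \<subseteq> S \<and> sum w T = 1}"

definition flat_point ::
  "'i set \<Rightarrow> nat \<Rightarrow> ('i \<Rightarrow> real) \<Rightarrow> (nat \<Rightarrow> 'i \<Rightarrow> real) \<Rightarrow> (nat \<Rightarrow> real) \<Rightarrow> ('i \<Rightarrow> real)" where
  "flat_point I d p b t = (\<lambda>i\<in>I. p i + (\<Sum>k<d. t k * b k i))"

definition orthonormal_on :: "'i set \<Rightarrow> nat \<Rightarrow> (nat \<Rightarrow> 'i \<Rightarrow> real) \<Rightarrow> bool" where
  "orthonormal_on I d b \<longleftrightarrow>
     (\<forall>k<d. \<forall>l<d. (\<Sum>i\<in>I. b k i * b l i) = (if k = l then 1 else 0))"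

text \<open>
  An origin \<open>p\<close> and orthonormal directions \<open>b 0, \<dots>, b (d - 1)\<close> for the affine span of \<open>S\<close>; then
  \<open>flat_point I d p b\<close> is an isometry of $\mathbb{R}^d$ onto that affine span.  Such a frame exists
  exactly when \<open>S\<close> is nonempty with affine span of dimension \<open>d\<close>.
\<close>

definition affine_frame ::
  "'i set \<Rightarrow> nat \<Rightarrow> ('i \<Rightarrow> real) set \<Rightarrow> ('i \<Rightarrow> real) \<Rightarrow> (nat \<Rightarrow> 'i \<Rightarrow> real) \<Rightarrow> bool" where
  "affine_frame I d S p b \<longleftrightarrow>
     orthonormal_on I d b \<and> flat_point I d p b ` ({..<d} \<rightarrow>\<^sub>E UNIV) = affine_span_on I S"

text \<open>
  The \<open>d\<close>-dimensional volume of \<open>S\<close> with respect to the Euclidean structure on its affine span.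
  Two frames differ by an isometry of $\mathbb{R}^d$, so the choice of the frame is immaterial.
\<close>

definition affine_volume :: "'i set \<Rightarrow> nat \<Rightarrow> ('i \<Rightarrow> real) set \<Rightarrow> real" where
  "affine_volume I d S =
     (let (p, b) = (SOME (p, b). affine_frame I d S p b)
      in measure (Pi\<^sub>M {..<d} (\<lambda>_. lborel))
           {t \<in> {..<d} \<rightarrow>\<^sub>E UNIV. flat_point I d p b t \<in> S})"

definition transportation_polytope ::
  "nat \<Rightarrow> nat \<Rightarrow> (nat \<Rightarrow> nat) \<Rightarrow> (nat \<Rightarrow> nat) \<Rightarrow> (nat \<times> nat \<Rightarrow> real) set" where
  "transportation_polytope m n R C =
     {X \<in> {..<m} \<times> {..<n} \<rightarrow>\<^sub>E UNIV.
        (\<forall>i<m. \<forall>j<n. X (i, j) \<ge> 0) \<and>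
        (\<forall>i<m. (\<Sum>j<n. X (i, j)) = real (R i)) \<and>
        (\<forall>j<n. (\<Sum>i<m. X (i, j)) = real (C j))}"

definition polytope_volume :: "nat \<Rightarrow> nat \<Rightarrow> (nat \<Rightarrow> nat) \<Rightarrow> (nat \<Rightarrow> nat) \<Rightarrow> real" where
  "polytope_volume m n R C =
     affine_volume ({..<m} \<times> {..<n}) ((m - 1) * (n - 1)) (transportation_polytope m n R C)"

definition max_product :: "nat \<Rightarrow> nat \<Rightarrow> (nat \<Rightarrow> nat) \<Rightarrow> (nat \<Rightarrow> nat) \<Rightarrow> real" where
  "max_product m n R C =
     (GREATEST b. b \<in> (\<lambda>X. \<Prod>i<m. \<Prod>j<n. X (i, j)) ` transportation_polytope m n R C)"

end

theory Submission
  imports Defs "HOL-Probability.Distributions"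
begin

text \<open>
  Let \<open>z\<close> maximise the product over $\mathcal{P}$ and let $L$ be the space of matrices with zero margins, so
  that $\mathcal{P}$ is the section of the orthant by $z + L$.  By Fubini, every integral over the orthant is
  an integral over $L^\perp$, a space of dimension only $m + n - 1$, of integrals over sections parallel to
  $\mathcal{P}$.

  For the upper bound, integrate $\exp(-\sum x_{ij} / z_{ij})$, whose integral is $\beta$.  Since \<open>z\<close> is optimal,
  the exponent is at least $-mn$ on $\mathcal{P}$, and convex combinations show that the sections in a
  neighbourhood of size $N^{-O(1)}$ are not much smaller than $\mathcal{P}$.

  For the lower bound, the volume of the section is a log-concave function on $L^\perp$ by the
  Prekopa-Leindler inequality, so it has an exponential majorant $\mathrm{vol}(\mathcal{P}) e^{v(s - s_0)}$.
  Hence the integral of $e^{-v(x)}$ over the orthant, damped by a wide Gaussian, is at most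
  $\mathrm{vol}(\mathcal{P}) e^{-v(z)} N^{O(m + n)}$.  This integral is a product over the entries, in which a
  tangent bound gives at least $e z_{ij} e^{-v_{ij} z_{ij}}$ for every entry, up to a negligible factor.
\<close>

section \<open>The Prekopa-Leindler inequality\<close>

text \<open>Why the damping: after tilting, the exponential majorant is constant on the orthogonal
  complement of L, so its integral is infinite. A Gaussian with \<delta> of order N^(-4) makes it
  finite at the price sqrt(pi / \<delta>) for each of the m + n - 1 directions, while on the
  entries, which are at most N, it costs only a constant factor in total.

  Where e^(mn) comes from: in the upper bound it is exp of the sum of x_ij / z_ij, which the first
  order condition bounds by mn. In the lower bound it is one factor e per entry: the integral of
  exp(-v x) over x >= 0 is 1 / v, and 1 / v >= e z exp(-v z) for every v > 0. The latter works at
  any positive matrix of the polytope; maximality of z is what the upper bound rests on, where it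
  also yields z_ij >= N^(-3), the room for moving the section.

  The volume refers to an arbitrarily chosen frame. That frame is therefore kept and completed to an
  orthonormal basis of the matrix space, and Lebesgue measure is shown to be invariant under the
  change of basis.\<close>

lemma add_leD1_ennreal: "a + b \<le> c \<Longrightarrow> a \<le> (c::ennreal)"
  using order_trans[of a "a + b" c] by (simp add: add_increasing2)

lemma ennreal_le_diff:
  fixes a b c :: ennreal
  assumes "a + b \<le> c" "c \<noteq> \<infinity>"
  shows "b \<le> c - a"
  using assms by (cases a; cases b; cases c) (auto simp: ennreal_minus top_unique simp flip: ennreal_plus)

lemma ennreal_add_le_of_diff:
  fixes a b c :: ennreal
  assumes "a \<le> c" "b \<le> c - a"
  shows "a + b \<le> c"
  using assms by (cases a; cases b; cases c) (auto simp: ennreal_minus top_unique simp flip: ennreal_plus)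

section \<open>The Brunn-Minkowski inequality on the line\<close>

lemma exists_incseq_cofinal:
  fixes A :: "real set"
  assumes "A \<noteq> {}"
  obtains y :: "nat \<Rightarrow> real" where "incseq y" "\<And>a. a \<in> A \<Longrightarrow> \<exists>n. a \<le> y n" "\<And>n. \<exists>x\<in>A. y n \<le> x"
proof (cases "bdd_above A")
  case False
  show ?thesis
  proof (rule that[of real])
    show "\<exists>x\<in>A. real n \<le> x" for n
      using False by (meson bdd_above.I linear)
  qed (auto simp: incseq_def real_arch_simple)
next
  case bdd: True
  show ?thesis
  proof (cases "Sup A \<in> A")
    case True
    show ?thesis
      by (rule that[of "\<lambda>_. Sup A"]) (use True bdd in \<open>auto simp: incseq_def intro: cSup_upper\<close>)
  next
    case False
    show ?thesis
    proof (rule that[of "\<lambda>n. Sup A - inverse (real (Suc n))"])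
      show "incseq (\<lambda>n. Sup A - inverse (real (Suc n)))"
        by (auto simp: incseq_def)
    next
      fix a assume a: "a \<in> A"
      then have "a \<le> Sup A" using bdd by (simp add: cSup_upper)
      with False a have "0 < Sup A - a" by (metis diff_gt_0_iff_gt order_le_less)
      then obtain n where "inverse (real (Suc n)) < Sup A - a"
        using reals_Archimedean by blast
      then show "\<exists>n. a \<le> Sup A - inverse (real (Suc n))" by (intro exI[of _ n]) simp
    next
      fix n
      have "Sup A - inverse (real (Suc n)) < Sup A" by simp
      then obtain x where "x \<in> A" "Sup A - inverse (real (Suc n)) < x"
        using less_cSup_iff[OF assms bdd] by blast
      then show "\<exists>x\<in>A. Sup A - inverse (real (Suc n)) \<le> x" by (auto intro!: bexI[of _ x])
    qed
  qed
qed

text \<open>Continuity from below along a sequence cofinal in \<open>A\<close>. An estimate for the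
  part of a set below one of its own points extends to the whole set, also if the set is unbounded
  or its supremum is not attained.\<close>

lemma emeasure_le_if_lower_parts:
  fixes A :: "real set" and K c :: ennreal
  assumes [measurable]: "A \<in> sets borel" and "A \<noteq> {}"
    and le: "\<And>x. x \<in> A \<Longrightarrow> c * emeasure lborel (A \<inter> {..x}) \<le> K"
  shows "c * emeasure lborel A \<le> K"
proof -
  obtain y :: "nat \<Rightarrow> real" where y: "incseq y" "\<And>a. a \<in> A \<Longrightarrow> \<exists>n. a \<le> y n" "\<And>n. \<exists>x\<in>A. y n \<le> x"
    using exists_incseq_cofinal[OF \<open>A \<noteq> {}\<close>] by metis
  have "(\<Union>n. A \<inter> {..y n}) = A"
    using y(2) by auto
  moreover have "(SUP n. emeasure lborel (A \<inter> {..y n})) = emeasure lborel (\<Union>n. A \<inter> {..y n})"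
    using y(1) by (intro SUP_emeasure_incseq) (auto simp: incseq_def intro: order_trans)
  ultimately have "emeasure lborel A = (SUP n. emeasure lborel (A \<inter> {..y n}))"
    by (simp only:)
  then have *: "c * emeasure lborel A = (SUP n. c * emeasure lborel (A \<inter> {..y n}))"
    by (simp only: SUP_mult_left_ennreal)
  show ?thesis
    unfolding *
  proof (rule SUP_least)
    fix n
    obtain x where x: "x \<in> A" "y n \<le> x" using y(3) by blast
    have "emeasure lborel (A \<inter> {..y n}) \<le> emeasure lborel (A \<inter> {..x})"
      using x by (intro emeasure_mono) auto
    then show "c * emeasure lborel (A \<inter> {..y n}) \<le> K"
      using le[OF x(1)] by (meson mult_left_mono order_trans zero_le)
  qed
qed

lemma emeasure_lborel_affine_vimage:
  fixes S :: "real set"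
  assumes [measurable]: "S \<in> sets borel" and "0 < c"
  shows "emeasure lborel S = ennreal c * emeasure lborel {x. t + c * x \<in> S}"
proof -
  have [measurable]: "{x. t + c * x \<in> S} \<in> sets borel" by measurable
  have "emeasure lborel S = (\<integral>\<^sup>+x. indicator S x \<partial>lborel)" by simp
  also have "\<dots> = ennreal c * (\<integral>\<^sup>+x. indicator S (t + c * x) \<partial>lborel)"
    using assms by (subst nn_integral_real_affine[where c=c and t=t]) auto
  also have "(\<integral>\<^sup>+x. indicator S (t + c * x) \<partial>lborel) = (\<integral>\<^sup>+x. indicator {x. t + c * x \<in> S} x \<partial>lborel)"
    by (intro nn_integral_cong) (auto simp: indicator_def)
  finally show ?thesis by simp
qed

text \<open>For a in A and b in B, a translate of u * A below and a translate of v * B above the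
  point u * a + v * b lie side by side in C. Moving a towards the upper end of A and b towards the
  lower end of B exhausts both sets. A Borel superset C stands for the sumset, which need not be
  Borel.\<close>

lemma brunn_minkowski_real:
  fixes A B C :: "real set"
  assumes [measurable]: "A \<in> sets borel" "B \<in> sets borel" "C \<in> sets borel"
    and ne: "A \<noteq> {}" "B \<noteq> {}" and uv: "0 < u" "0 < v"
    and sub: "\<And>x y. x \<in> A \<Longrightarrow> y \<in> B \<Longrightarrow> u * x + v * y \<in> C"
  shows "ennreal u * emeasure lborel A + ennreal v * emeasure lborel B \<le> emeasure lborel C"
proof -
  have key: "ennreal u * emeasure lborel (A \<inter> {..a}) + ennreal v * emeasure lborel (B \<inter> {b..}) \<le> emeasure lborel C"
    if ab: "a \<in> A" "b \<in> B" for a b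
  proof -
    define p where "p = u * a + v * b"
    \<comment> \<open>Dropping the null set {a} makes the left piece end strictly before
      \<open>p\<close>, so that the two pieces are disjoint.\<close>
    have "emeasure lborel (A \<inter> {..a}) = emeasure lborel (A \<inter> {..<a})"
    proof (rule emeasure_eq_AE)
      have "AE x in lborel. x \<noteq> a" by (rule AE_lborel_singleton)
      then show "AE x in lborel. (x \<in> A \<inter> {..a}) = (x \<in> A \<inter> {..<a})" by eventually_elim auto
    qed auto
    also have "\<dots> \<le> emeasure lborel {x. v * b + u * x \<in> C \<inter> {..<p}}"
      using ab uv sub by (intro emeasure_mono) (auto simp: p_def add.commute)
    finally have 1: "ennreal u * emeasure lborel (A \<inter> {..a}) \<le> emeasure lborel (C \<inter> {..<p})"
      using uv by (simp only: emeasure_lborel_affine_vimage[of "C \<inter> {..<p}" u "v * b"] assms sets.Int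
        borel_open open_lessThan mult_left_mono zero_le)
    have "emeasure lborel (B \<inter> {b..}) \<le> emeasure lborel {x. u * a + v * x \<in> C \<inter> {p..}}"
      using ab uv sub by (intro emeasure_mono) (auto simp: p_def)
    then have 2: "ennreal v * emeasure lborel (B \<inter> {b..}) \<le> emeasure lborel (C \<inter> {p..})"
      using uv by (simp only: emeasure_lborel_affine_vimage[of "C \<inter> {p..}" v "u * a"] assms sets.Int
        borel_closed closed_atLeast mult_left_mono zero_le)
    have "emeasure lborel (C \<inter> {..<p}) + emeasure lborel (C \<inter> {p..}) = emeasure lborel ((C \<inter> {..<p}) \<union> (C \<inter> {p..}))"
      by (intro plus_emeasure) auto
    also have "(C \<inter> {..<p}) \<union> (C \<inter> {p..}) = C" by auto
    finally show ?thesis using add_mono[OF 1 2] by simp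
  qed
  have key2: "ennreal u * emeasure lborel (A \<inter> {..a}) + ennreal v * emeasure lborel B \<le> emeasure lborel C"
    if "a \<in> A" for a
  proof -
    \<comment> \<open>Reflection turns upper parts of \<open>B\<close> into lower parts, so that
      \<open>b\<close> can be moved down by the same continuity argument.\<close>
    have refl: "emeasure lborel S = emeasure lborel {x. - x \<in> S}" if "S \<in> sets borel" for S :: "real set"
    proof -
      have "emeasure lborel S = emeasure (distr lborel borel uminus) S"
        by (simp add: lborel_distr_uminus)
      also have "\<dots> = emeasure lborel {x. - x \<in> S}"
        using that by (subst emeasure_distr) (auto simp: vimage_def)
      finally show ?thesis .
    qed
    let ?L = "ennreal u * emeasure lborel (A \<inter> {..a})" and ?C = "emeasure lborel C"
    obtain b where "b \<in> B" using ne(2) by blast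
    have L: "?L \<le> ?C"
      using key[OF \<open>a \<in> A\<close> \<open>b \<in> B\<close>] by (rule add_leD1_ennreal)
    show ?thesis
    proof (cases "?C = \<infinity>")
      case False
      have [measurable]: "{x. - x \<in> B} \<in> sets borel" by measurable
      have "ennreal v * emeasure lborel {x. - x \<in> B} \<le> ?C - ?L"
      proof (rule emeasure_le_if_lower_parts)
        show "{x. - x \<in> B} \<noteq> {}" using ne(2) by (auto intro: exI[of _ "- _"])
        fix x assume x: "x \<in> {x. - x \<in> B}"
        have "emeasure lborel ({x. - x \<in> B} \<inter> {..x}) = emeasure lborel (B \<inter> {- x..})"
          by (subst (2) refl) (auto intro!: arg_cong[where f = "emeasure lborel"])
        then have "?L + ennreal v * emeasure lborel ({x. - x \<in> B} \<inter> {..x}) \<le> ?C"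
          using key[OF \<open>a \<in> A\<close>, of "- x"] x by simp
        then show "ennreal v * emeasure lborel ({x. - x \<in> B} \<inter> {..x}) \<le> ?C - ?L"
          using False by (intro ennreal_le_diff)
      qed simp
      then have "ennreal v * emeasure lborel B \<le> ?C - ?L" using refl[of B] by simp
      then show ?thesis
        using L by (intro ennreal_add_le_of_diff)
    qed simp
  qed
  let ?R = "ennreal v * emeasure lborel B" and ?C = "emeasure lborel C"
  obtain a where "a \<in> A" using ne(1) by blast
  have R: "?R \<le> ?C"
    using key2[OF \<open>a \<in> A\<close>] by (subst (asm) add.commute) (rule add_leD1_ennreal)
  show ?thesis
  proof (cases "?C = \<infinity>")
    case False
    have "ennreal u * emeasure lborel A \<le> ?C - ?R"
    proof (rule emeasure_le_if_lower_parts)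
      fix x assume "x \<in> A"
      then show "ennreal u * emeasure lborel (A \<inter> {..x}) \<le> ?C - ?R"
        using key2 False by (intro ennreal_le_diff) (simp_all add: add.commute)
    qed (use ne in auto)
    then show ?thesis
      using R by (subst add.commute) (intro ennreal_add_le_of_diff)
  qed simp
qed

section \<open>Integrals over superlevel sets and Prekopa-Leindler on the line\<close>

lemma nn_integral_superlevel:
  fixes f :: "real \<Rightarrow> ennreal" and M :: real
  assumes [measurable]: "f \<in> borel_measurable borel" and M: "0 < M"
  shows "(\<integral>\<^sup>+t. emeasure lborel {x. ennreal (t * M) < f x} * indicator {0<..<1} t \<partial>lborel)
    = (\<integral>\<^sup>+x. min 1 (f x / ennreal M) \<partial>lborel)"
    (is "?L = ?R")
    and "(\<integral>\<^sup>+t. emeasure lborel {x. ennreal (t * M) \<le> f x} * indicator {0<..<1} t \<partial>lborel)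
    = (\<integral>\<^sup>+x. min 1 (f x / ennreal M) \<partial>lborel)"
    (is "?L' = ?R")
proof -
  have slice: "(\<integral>\<^sup>+t. indicator {t. 0 < t \<and> t < 1 \<and> ennreal (t * M) < f x} t \<partial>lborel) = min 1 (f x / ennreal M)"
    "(\<integral>\<^sup>+t. indicator {t. 0 < t \<and> t < 1 \<and> ennreal (t * M) \<le> f x} t \<partial>lborel) = min 1 (f x / ennreal M)" for x
  proof -
    show 1: "(\<integral>\<^sup>+t. indicator {t. 0 < t \<and> t < 1 \<and> ennreal (t * M) < f x} t \<partial>lborel) = min 1 (f x / ennreal M)"
    proof (cases "f x")
      case (real r)
      have "{t. 0 < t \<and> t < 1 \<and> ennreal (t * M) < f x} = {0<..<min 1 (r / M)}"
        using real M by (auto simp: ennreal_less_iff field_simps)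
      then show ?thesis
        using real M by (simp add: divide_ennreal min_def flip: ennreal_1)
    next
      case top
      have "{t. 0 < t \<and> t < 1 \<and> ennreal (t * M) < f x} = {0<..<1::real}"
        using top by auto
      then show ?thesis
        using top M by (simp add: ennreal_top_divide)
    qed
    show "(\<integral>\<^sup>+t. indicator {t. 0 < t \<and> t < 1 \<and> ennreal (t * M) \<le> f x} t \<partial>lborel) = min 1 (f x / ennreal M)"
      unfolding 1[symmetric]
    proof (rule nn_integral_cong_AE)
      \<comment> \<open>For fixed x the strict and the non-strict condition differ at the single
        level t = f x / M.\<close>
      have "AE t in lborel. t \<noteq> enn2real (f x) / M" by (rule AE_lborel_singleton)
      then show "AE t in lborel. indicator {t. 0 < t \<and> t < 1 \<and> ennreal (t * M) \<le> f x} t =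
        (indicator {t. 0 < t \<and> t < 1 \<and> ennreal (t * M) < f x} t :: ennreal)"
      proof eventually_elim
        case (elim t)
        have "ennreal (t * M) \<noteq> f x" if "0 < t"
          using elim M that by (metis enn2real_ennreal less_imp_le mult_pos_pos nonzero_mult_div_cancel_right less_numeral_extra(3))
        then show ?case by (auto simp: indicator_def)
      qed
    qed
  qed
  have "?L = (\<integral>\<^sup>+t. (\<integral>\<^sup>+x. indicator {t. 0 < t \<and> t < 1 \<and> ennreal (t * M) < f x} t \<partial>lborel) \<partial>lborel)"
    by (intro nn_integral_cong)
       (auto simp: indicator_def nn_integral_indicator[symmetric] simp del: nn_integral_indicator intro!: nn_integral_cong)
  also have "\<dots> = ?R"
    by (subst lborel_pair.Fubini') (auto simp: slice)
  finally show "?L = ?R" .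
  have "?L' = (\<integral>\<^sup>+t. (\<integral>\<^sup>+x. indicator {t. 0 < t \<and> t < 1 \<and> ennreal (t * M) \<le> f x} t \<partial>lborel) \<partial>lborel)"
    by (intro nn_integral_cong)
       (auto simp: indicator_def nn_integral_indicator[symmetric] simp del: nn_integral_indicator intro!: nn_integral_cong)
  also have "\<dots> = ?R"
    by (subst lborel_pair.Fubini') (auto simp: slice)
  finally show "?L' = ?R" .
qed

lemma ennreal_le_of_scaled:
  assumes "\<And>\<theta>. 0 < \<theta> \<Longrightarrow> \<theta> < 1 \<Longrightarrow> ennreal (\<theta> * c) \<le> H" "0 \<le> c"
  shows "ennreal c \<le> H"
proof (cases H)
  case (real r)
  have "c \<le> r"
  proof (rule field_le_mult_one_interval)
    fix z :: real assume "0 < z" "z < 1"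
    then show "z * c \<le> r" using assms real by (metis ennreal_le_iff)
  qed
  then show ?thesis using real by (simp add: ennreal_leI)
qed simp

lemma nn_integral_min_approx:
  fixes f :: "real \<Rightarrow> ennreal"
  assumes [measurable]: "f \<in> borel_measurable borel" and "ennreal a \<le> (\<integral>\<^sup>+x. f x \<partial>lborel)"
    and "0 < a" "0 < \<theta>" "\<theta> < 1"
  obtains n :: nat where "ennreal (\<theta> * a) \<le> (\<integral>\<^sup>+x. min (f x) (of_nat n) \<partial>lborel)"
proof -
  have sup: "(SUP n. min c (of_nat n)) = (c::ennreal)" for c
  proof -
    have "(SUP n. min c (of_nat n)) = min c (SUP n. of_nat n)"
      by (simp add: inf_SUP flip: inf_min)
    then show ?thesis by (simp add: ennreal_SUP_of_nat_eq_top)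
  qed
  have "(\<integral>\<^sup>+x. f x \<partial>lborel) = (\<integral>\<^sup>+x. (SUP n. min (f x) (of_nat n)) \<partial>lborel)"
    by (simp add: sup)
  also have "\<dots> = (SUP n. \<integral>\<^sup>+x. min (f x) (of_nat n) \<partial>lborel)"
    by (intro nn_integral_monotone_convergence_SUP) (auto simp: incseq_def le_fun_def intro: min.coboundedI2)
  finally have "ennreal a \<le> (SUP n. \<integral>\<^sup>+x. min (f x) (of_nat n) \<partial>lborel)"
    using assms(2) by simp
  moreover have "ennreal (\<theta> * a) < ennreal a"
    using assms by (simp add: ennreal_less_iff)
  ultimately have "ennreal (\<theta> * a) < (SUP n. \<integral>\<^sup>+x. min (f x) (of_nat n) \<partial>lborel)"
    by (rule order_less_le_trans[rotated])
  then obtain n :: nat where "ennreal (\<theta> * a) < (\<integral>\<^sup>+x. min (f x) (of_nat n) \<partial>lborel)"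
    unfolding less_SUP_iff by blast
  then show ?thesis by (intro that less_imp_le)
qed

text \<open>Scaling both functions to supremum 1 makes their superlevel sets nonempty at every
  height t < 1, so Brunn-Minkowski applies for each t. Integrating over t gives an arithmetic mean
  of the integrals, which dominates the geometric one.\<close>

lemma prekopa_leindler_bounded:
  fixes f g h :: "real \<Rightarrow> ennreal"
  assumes [measurable]: "f \<in> borel_measurable borel" "g \<in> borel_measurable borel" "h \<in> borel_measurable borel"
    and \<mu>: "0 < \<mu>" "\<mu> < 1"
    and bdd: "\<And>x. f x \<le> ennreal K" "\<And>x. g x \<le> ennreal K"
    and conc: "\<And>x y a b. 0 < a \<Longrightarrow> 0 < b \<Longrightarrow> ennreal a \<le> f x \<Longrightarrow> ennreal b \<le> g y \<Longrightarrow>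
      ennreal (a powr (1 - \<mu>) * b powr \<mu>) \<le> h ((1 - \<mu>) * x + \<mu> * y)"
    and ab: "0 < a" "0 < b" "ennreal a \<le> (\<integral>\<^sup>+x. f x \<partial>lborel)" "ennreal b \<le> (\<integral>\<^sup>+x. g x \<partial>lborel)"
  shows "ennreal (a powr (1 - \<mu>) * b powr \<mu>) \<le> (\<integral>\<^sup>+x. h x \<partial>lborel)"
proof -
  have sup_real: "\<exists>M>0. (SUP x. \<phi> x) = ennreal M"
    if "\<And>x. \<phi> x \<le> ennreal K" "0 < c" "ennreal c \<le> (\<integral>\<^sup>+x. \<phi> x \<partial>lborel)" for \<phi> :: "real \<Rightarrow> ennreal" and c
  proof -
    have "(SUP x. \<phi> x) \<le> ennreal K" using that by (intro SUP_least)
    then have "(SUP x. \<phi> x) < top" by (rule order_le_less_trans) simp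
    moreover have "(SUP x. \<phi> x) \<noteq> 0"
    proof
      assume "(SUP x. \<phi> x) = 0"
      then have "\<phi> x = 0" for x by (metis SUP_upper UNIV_I le_zero_eq)
      then show False using that by (simp add: ennreal_eq_0_iff)
    qed
    ultimately show ?thesis
      by (cases "SUP x. \<phi> x") (auto simp: order_le_less intro!: exI)
  qed
  obtain F where F: "0 < F" "(SUP x. f x) = ennreal F" using sup_real[OF bdd(1) ab(1,3)] by blast
  obtain G where G: "0 < G" "(SUP x. g x) = ennreal G" using sup_real[OF bdd(2) ab(2,4)] by blast
  have fF: "f x \<le> ennreal F" and gG: "g x \<le> ennreal G" for x
    using F G by (metis SUP_upper UNIV_I)+
  define H where "H = F powr (1 - \<mu>) * G powr \<mu>"
  have H: "0 < H" using F G by (simp add: H_def)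
  \<comment> \<open>Strict superlevel sets of \<open>f\<close> and \<open>g\<close> are nonempty by
    definition of the supremum, whereas the hypothesis yields a non-strict bound on
    \<open>h\<close>; hence the two kinds of superlevel sets.\<close>
  have bm: "ennreal (1 - \<mu>) * emeasure lborel {x. ennreal (t * F) < f x} + ennreal \<mu> * emeasure lborel {x. ennreal (t * G) < g x}
      \<le> emeasure lborel {x. ennreal (t * H) \<le> h x}" if t: "0 < t" "t < 1" for t
  proof (rule brunn_minkowski_real)
    have "ennreal (t * F) < (SUP x. f x)" unfolding F using t F by (simp add: ennreal_less_iff)
    then show "{x. ennreal (t * F) < f x} \<noteq> {}" by (auto simp: less_SUP_iff)
    have "ennreal (t * G) < (SUP x. g x)" unfolding G using t G by (simp add: ennreal_less_iff)
    then show "{x. ennreal (t * G) < g x} \<noteq> {}" by (auto simp: less_SUP_iff)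
    fix x y assume "x \<in> {x. ennreal (t * F) < f x}" "y \<in> {x. ennreal (t * G) < g x}"
    then have "ennreal ((t * F) powr (1 - \<mu>) * (t * G) powr \<mu>) \<le> h ((1 - \<mu>) * x + \<mu> * y)"
      using t F G by (intro conc) auto
    moreover have "(t * F) powr (1 - \<mu>) * (t * G) powr \<mu> = t * H"
    proof -
      have "(t * F) powr (1 - \<mu>) * (t * G) powr \<mu> = (t powr (1 - \<mu>) * t powr \<mu>) * H"
        using t F G by (simp add: powr_mult H_def)
      also have "t powr (1 - \<mu>) * t powr \<mu> = t" using t by (simp flip: powr_add)
      finally show ?thesis .
    qed
    ultimately show "(1 - \<mu>) * x + \<mu> * y \<in> {x. ennreal (t * H) \<le> h x}" by simp
  qed (use \<mu> in auto)
  let ?f = "\<integral>\<^sup>+x. f x / ennreal F \<partial>lborel" and ?g = "\<integral>\<^sup>+x. g x / ennreal G \<partial>lborel"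
  have le1: "f x / ennreal F \<le> 1" "g x / ennreal G \<le> 1" for x
    using fF[of x] gG[of x] F(1) G(1)
    by (auto intro!: divide_le_posI_ennreal)
  have "ennreal (1 - \<mu>) * ?f + ennreal \<mu> * ?g
     = ennreal (1 - \<mu>) * (\<integral>\<^sup>+t. emeasure lborel {x. ennreal (t * F) < f x} * indicator {0<..<1} t \<partial>lborel)
      + ennreal \<mu> * (\<integral>\<^sup>+t. emeasure lborel {x. ennreal (t * G) < g x} * indicator {0<..<1} t \<partial>lborel)"
    using le1 F G by (simp add: nn_integral_superlevel min_absorb2)
  also have "\<dots> = (\<integral>\<^sup>+t. (ennreal (1 - \<mu>) * emeasure lborel {x. ennreal (t * F) < f x}
      + ennreal \<mu> * emeasure lborel {x. ennreal (t * G) < g x}) * indicator {0<..<1} t \<partial>lborel)"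
    by (simp add: nn_integral_add nn_integral_cmult distrib_right mult.assoc)
  also have "\<dots> \<le> (\<integral>\<^sup>+t. emeasure lborel {x. ennreal (t * H) \<le> h x} * indicator {0<..<1} t \<partial>lborel)"
    by (intro nn_integral_mono) (auto simp: indicator_def bm)
  also have "\<dots> = (\<integral>\<^sup>+x. min 1 (h x / ennreal H) \<partial>lborel)"
    using H by (simp add: nn_integral_superlevel)
  also have "\<dots> \<le> (\<integral>\<^sup>+x. h x / ennreal H \<partial>lborel)"
    by (intro nn_integral_mono) simp
  also have "\<dots> = (\<integral>\<^sup>+x. h x \<partial>lborel) / ennreal H"
    by (simp add: nn_integral_divide)
  finally have 1: "ennreal (1 - \<mu>) * ?f + ennreal \<mu> * ?g \<le> (\<integral>\<^sup>+x. h x \<partial>lborel) / ennreal H" .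
  have fa: "ennreal (a / F) \<le> ?f" "ennreal (b / G) \<le> ?g"
    using ab F G by (auto simp: nn_integral_divide simp flip: divide_ennreal intro!: divide_right_mono_ennreal)
  have "ennreal ((a / F) powr (1 - \<mu>) * (b / G) powr \<mu>) \<le> ennreal ((1 - \<mu>) * (a / F) + \<mu> * (b / G))"
    using \<mu> ab F G by (intro ennreal_leI Youngs_inequality_0) auto
  also have "\<dots> = ennreal (1 - \<mu>) * ennreal (a / F) + ennreal \<mu> * ennreal (b / G)"
    using \<mu> ab F G by (simp add: ennreal_mult[symmetric])
  also have "\<dots> \<le> (\<integral>\<^sup>+x. h x \<partial>lborel) / ennreal H"
    using fa by (intro order_trans[OF _ 1] add_mono mult_left_mono) auto
  finally have "ennreal ((a / F) powr (1 - \<mu>) * (b / G) powr \<mu>) * ennreal H \<le> (\<integral>\<^sup>+x. h x \<partial>lborel) / ennreal H * ennreal H"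
    by (rule mult_right_mono) simp
  also have "\<dots> = (\<integral>\<^sup>+x. h x \<partial>lborel)"
    using H by (simp add: ennreal_divide_times)
  also have "ennreal ((a / F) powr (1 - \<mu>) * (b / G) powr \<mu>) * ennreal H = ennreal (a powr (1 - \<mu>) * b powr \<mu>)"
    using ab F G H by (simp add: H_def powr_divide flip: ennreal_mult)
  finally show ?thesis .
qed

text \<open>Truncating f and g lowers the bounds a and b by a factor \<theta> < 1. The geometric
  mean is homogeneous of degree one, so the conclusion loses the same factor, which may tend to
  1.\<close>

theorem prekopa_leindler_real:
  fixes f g h :: "real \<Rightarrow> ennreal"
  assumes [measurable]: "f \<in> borel_measurable borel" "g \<in> borel_measurable borel" "h \<in> borel_measurable borel"
    and \<mu>: "0 < \<mu>" "\<mu> < 1"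
    and conc: "\<And>x y a b. 0 < a \<Longrightarrow> 0 < b \<Longrightarrow> ennreal a \<le> f x \<Longrightarrow> ennreal b \<le> g y \<Longrightarrow>
      ennreal (a powr (1 - \<mu>) * b powr \<mu>) \<le> h ((1 - \<mu>) * x + \<mu> * y)"
    and ab: "0 < a" "0 < b" "ennreal a \<le> (\<integral>\<^sup>+x. f x \<partial>lborel)" "ennreal b \<le> (\<integral>\<^sup>+x. g x \<partial>lborel)"
  shows "ennreal (a powr (1 - \<mu>) * b powr \<mu>) \<le> (\<integral>\<^sup>+x. h x \<partial>lborel)"
proof (rule ennreal_le_of_scaled)
  fix \<theta> :: real assume \<theta>: "0 < \<theta>" "\<theta> < 1"
  obtain p where p: "ennreal (\<theta> * a) \<le> (\<integral>\<^sup>+x. min (f x) (of_nat p) \<partial>lborel)"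
    using nn_integral_min_approx[OF _ ab(3,1) \<theta>] by auto
  obtain q where q: "ennreal (\<theta> * b) \<le> (\<integral>\<^sup>+x. min (g x) (of_nat q) \<partial>lborel)"
    using nn_integral_min_approx[OF _ ab(4,2) \<theta>] by auto
  have "ennreal ((\<theta> * a) powr (1 - \<mu>) * (\<theta> * b) powr \<mu>) \<le> (\<integral>\<^sup>+x. h x \<partial>lborel)"
  proof (rule prekopa_leindler_bounded[where K = "real (max p q)"])
    show "min (f x) (of_nat p) \<le> ennreal (real (max p q))" for x
      by (rule min.coboundedI2) (simp flip: ennreal_of_nat_eq_real_of_nat)
    show "min (g x) (of_nat q) \<le> ennreal (real (max p q))" for x
      by (rule min.coboundedI2) (simp flip: ennreal_of_nat_eq_real_of_nat)
  qed (use p q \<mu> \<theta> ab in \<open>auto intro: conc\<close>)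
  moreover have "(\<theta> * a) powr (1 - \<mu>) * (\<theta> * b) powr \<mu> = \<theta> * (a powr (1 - \<mu>) * b powr \<mu>)"
  proof -
    have "(\<theta> * a) powr (1 - \<mu>) * (\<theta> * b) powr \<mu> = (\<theta> powr (1 - \<mu>) * \<theta> powr \<mu>) * (a powr (1 - \<mu>) * b powr \<mu>)"
      using \<theta> ab by (simp add: powr_mult)
    also have "\<theta> powr (1 - \<mu>) * \<theta> powr \<mu> = \<theta>" using \<theta> by (simp flip: powr_add)
    finally show ?thesis .
  qed
  ultimately show "ennreal (\<theta> * (a powr (1 - \<mu>) * b powr \<mu>)) \<le> (\<integral>\<^sup>+x. h x \<partial>lborel)" by simp
qed simp

section \<open>Marginals of log-concave functions\<close>

text \<open>Values are tested through positive real lower bounds because they may be infinite. The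
  domain is the space of all real sequences: integrating out a coordinate stays within this type,
  and the result is merely constant in that coordinate.\<close>

definition log_concave :: "((nat \<Rightarrow> real) \<Rightarrow> ennreal) \<Rightarrow> bool" where
  "log_concave f \<longleftrightarrow> (\<forall>x y \<mu> a b. 0 < \<mu> \<longrightarrow> \<mu> < 1 \<longrightarrow> 0 < a \<longrightarrow> 0 < b \<longrightarrow> ennreal a \<le> f x \<longrightarrow> ennreal b \<le> f y \<longrightarrow>
     ennreal (a powr (1 - \<mu>) * b powr \<mu>) \<le> f (\<lambda>i. (1 - \<mu>) * x i + \<mu> * y i))"

lemma log_concaveD:
  "log_concave f \<Longrightarrow> 0 < \<mu> \<Longrightarrow> \<mu> < 1 \<Longrightarrow> 0 < a \<Longrightarrow> 0 < b \<Longrightarrow> ennreal a \<le> f x \<Longrightarrow> ennreal b \<le> f y \<Longrightarrow>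
     ennreal (a powr (1 - \<mu>) * b powr \<mu>) \<le> f (\<lambda>i. (1 - \<mu>) * x i + \<mu> * y i)"
  unfolding log_concave_def by blast

lemma measurable_slice:
  fixes x :: "'i \<Rightarrow> real"
  assumes [measurable]: "f \<in> borel_measurable (PiM UNIV (\<lambda>_. borel))"
  shows "(\<lambda>t. f (x(k := t))) \<in> borel_measurable borel"
proof -
  have "(\<lambda>t. x(k := t)) \<in> measurable borel (PiM UNIV (\<lambda>_. borel))"
    by (rule measurable_PiM_single') auto
  then show ?thesis by (rule measurable_compose) measurable
qed

text \<open>The two exponents differ by \<delta> * \<mu> * (1 - \<mu>) * (s - t)^2.\<close>

lemma gaussian_tilt_log_concave:
  fixes v \<delta> :: real
  assumes "0 \<le> \<delta>" "0 < \<mu>" "\<mu> < 1"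
  shows "exp (- v * s - \<delta> * s\<^sup>2) powr (1 - \<mu>) * exp (- v * t - \<delta> * t\<^sup>2) powr \<mu>
    \<le> exp (- v * ((1 - \<mu>) * s + \<mu> * t) - \<delta> * ((1 - \<mu>) * s + \<mu> * t)\<^sup>2)"
proof -
  have "0 \<le> \<delta> * (\<mu> * (1 - \<mu>) * (s - t)\<^sup>2)"
    using assms by (intro mult_nonneg_nonneg) auto
  also have "\<mu> * (1 - \<mu>) * (s - t)\<^sup>2 = (1 - \<mu>) * s\<^sup>2 + \<mu> * t\<^sup>2 - ((1 - \<mu>) * s + \<mu> * t)\<^sup>2"
    by (simp add: power2_eq_square algebra_simps)
  finally have "(1 - \<mu>) * (- v * s - \<delta> * s\<^sup>2) + \<mu> * (- v * t - \<delta> * t\<^sup>2)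
     \<le> - v * ((1 - \<mu>) * s + \<mu> * t) - \<delta> * ((1 - \<mu>) * s + \<mu> * t)\<^sup>2"
    by (simp add: algebra_simps)
  then show ?thesis by (simp add: powr_def flip: exp_add)
qed

text \<open>Prekopa-Leindler for the slices in direction k through x, y and their convex
  combination. The weight is log-concave too; it is divided out to use the hypothesis on
  \<open>f\<close> and then multiplied back.\<close>

lemma log_concave_marginal:
  assumes lc: "log_concave f" and f [measurable]: "f \<in> borel_measurable (PiM UNIV (\<lambda>_. borel))" and "0 \<le> \<delta>"
  shows "log_concave (\<lambda>x. \<integral>\<^sup>+t. f (x(k := t)) * ennreal (exp (- v * t - \<delta> * t\<^sup>2)) \<partial>lborel)"
  unfolding log_concave_def
proof (intro allI impI)
  fix x y :: "nat \<Rightarrow> real" and \<mu> a b :: real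
  assume \<mu>: "0 < \<mu>" "\<mu> < 1" and ab: "0 < a" "0 < b"
    "ennreal a \<le> (\<integral>\<^sup>+t. f (x(k := t)) * ennreal (exp (- v * t - \<delta> * t\<^sup>2)) \<partial>lborel)"
    "ennreal b \<le> (\<integral>\<^sup>+t. f (y(k := t)) * ennreal (exp (- v * t - \<delta> * t\<^sup>2)) \<partial>lborel)"
  define z where "z = (\<lambda>i. (1 - \<mu>) * x i + \<mu> * y i)"
  define w where "w = (\<lambda>t. exp (- v * t - \<delta> * t\<^sup>2))"
  have wpos: "0 < w t" for t by (simp add: w_def)
  have [measurable]: "w \<in> borel_measurable borel" unfolding w_def by measurable
  note [measurable] = measurable_slice[OF f]
  have *: "0 < p \<Longrightarrow> ennreal p \<le> f X * ennreal (w t) \<Longrightarrow> ennreal (p / w t) \<le> f X" for p X t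
    using wpos[of t] divide_le_posI_ennreal[of "ennreal (w t)" "ennreal p" "f X"]
    by (simp add: mult.commute divide_ennreal less_imp_le)
  have "ennreal (a powr (1 - \<mu>) * b powr \<mu>) \<le> (\<integral>\<^sup>+t. f (z(k := t)) * ennreal (w t) \<partial>lborel)"
  proof (rule prekopa_leindler_real[where f = "\<lambda>t. f (x(k := t)) * ennreal (w t)" and g = "\<lambda>t. f (y(k := t)) * ennreal (w t)"])
    fix s t p q :: real
    assume pq: "0 < p" "0 < q" "ennreal p \<le> f (x(k := s)) * ennreal (w s)" "ennreal q \<le> f (y(k := t)) * ennreal (w t)"
    let ?r = "(1 - \<mu>) * s + \<mu> * t"
    have "p powr (1 - \<mu>) * q powr \<mu> = ((p / w s) powr (1 - \<mu>) * (q / w t) powr \<mu>) * (w s powr (1 - \<mu>) * w t powr \<mu>)"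
      using pq wpos[of s] wpos[of t] by (simp add: powr_divide)
    also have "\<dots> \<le> ((p / w s) powr (1 - \<mu>) * (q / w t) powr \<mu>) * w ?r"
      using gaussian_tilt_log_concave[OF \<open>0 \<le> \<delta>\<close> \<mu>, of v s t] unfolding w_def by (intro mult_left_mono) auto
    finally have 1: "ennreal (p powr (1 - \<mu>) * q powr \<mu>) \<le> ennreal ((p / w s) powr (1 - \<mu>) * (q / w t) powr \<mu>) * ennreal (w ?r)"
      using wpos by (simp flip: ennreal_mult add: ennreal_leI less_imp_le)
    have "ennreal ((p / w s) powr (1 - \<mu>) * (q / w t) powr \<mu>) \<le> f (\<lambda>i. (1 - \<mu>) * (x(k := s)) i + \<mu> * (y(k := t)) i)"
      using pq wpos by (intro log_concaveD[OF lc \<mu>, where x = "x(k := s)" and y = "y(k := t)"] * divide_pos_pos)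
    also have "(\<lambda>i. (1 - \<mu>) * (x(k := s)) i + \<mu> * (y(k := t)) i) = z(k := ?r)"
      by (auto simp: z_def)
    finally have 2: "ennreal ((p / w s) powr (1 - \<mu>) * (q / w t) powr \<mu>) \<le> f (z(k := ?r))" .
    show "ennreal (p powr (1 - \<mu>) * q powr \<mu>) \<le> f (z(k := ?r)) * ennreal (w ?r)"
      using 1 mult_right_mono[OF 2, of "ennreal (w ?r)"] by (rule order_trans) simp
  qed (use \<mu> ab in \<open>auto simp: w_def\<close>)
  then show "ennreal (a powr (1 - \<mu>) * b powr \<mu>)
    \<le> (\<integral>\<^sup>+t. f ((\<lambda>i. (1 - \<mu>) * x i + \<mu> * y i)(k := t)) * ennreal (exp (- v * t - \<delta> * t\<^sup>2)) \<partial>lborel)"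
    by (simp add: z_def w_def)
qed

section \<open>Exponential majorants at an interior point of the support\<close>

definition positive_near :: "(nat \<Rightarrow> real) \<Rightarrow> ((nat \<Rightarrow> real) \<Rightarrow> ennreal) \<Rightarrow> bool" where
  "positive_near s f \<longleftrightarrow> (\<exists>\<epsilon>>0. \<forall>x. (\<forall>i. \<bar>x i - s i\<bar> < \<epsilon>) \<longrightarrow> 0 < f x)"

text \<open>Positivity around \<open>s\<close>, and not only at \<open>s\<close>, is what gives a
  majorant of finite slope there. The same \<epsilon> survives integration because the slice is
  positive on an interval of length 2 * \<epsilon>.\<close>

lemma positive_near_marginal:
  assumes f [measurable]: "f \<in> borel_measurable (PiM UNIV (\<lambda>_. borel))" and pos: "positive_near s f"
  shows "positive_near s (\<lambda>x. \<integral>\<^sup>+t. f (x(k := t)) * ennreal (exp (- v * t - \<delta> * t\<^sup>2)) \<partial>lborel)"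
proof -
  obtain \<epsilon> where \<epsilon>: "0 < \<epsilon>" "\<And>x. (\<forall>i. \<bar>x i - s i\<bar> < \<epsilon>) \<Longrightarrow> 0 < f x"
    using pos unfolding positive_near_def by blast
  note [measurable] = measurable_slice[OF f]
  have "0 < (\<integral>\<^sup>+t. f (x(k := t)) * ennreal (exp (- v * t - \<delta> * t\<^sup>2)) \<partial>lborel)"
    if x: "\<forall>i. \<bar>x i - s i\<bar> < \<epsilon>" for x
  proof (rule ccontr)
    assume "\<not> ?thesis"
    then have "AE t in lborel. f (x(k := t)) * ennreal (exp (- v * t - \<delta> * t\<^sup>2)) = 0"
      by (subst nn_integral_0_iff_AE[symmetric]) auto
    then have "AE t in lborel. t \<notin> {s k - \<epsilon> <..< s k + \<epsilon>}"
    proof eventually_elim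
      case (elim t)
      have "0 < f (x(k := t))" if "t \<in> {s k - \<epsilon> <..< s k + \<epsilon>}"
        using that x by (intro \<epsilon>(2)) auto
      with elim show ?case by fastforce
    qed
    then have "emeasure lborel {s k - \<epsilon> <..< s k + \<epsilon>} = 0"
      by (subst (asm) AE_iff_null_sets[symmetric]) auto
    then show False using \<epsilon>(1) by simp
  qed
  then show ?thesis using \<epsilon>(1) unfolding positive_near_def by blast
qed

text \<open>The logarithm of the slice is concave, so its secant slopes from \<open>s k\<close> to
  the right lie below those to the left. Both families are nonempty since \<open>f\<close> is
  positive near \<open>s\<close>, and any number separating them is the slope of a majorant touching
  at \<open>s k\<close>.\<close>

lemma log_concave_slice_support:
  assumes lc: "log_concave f" and pos: "positive_near s f" and fs: "f s = ennreal A"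
  obtains v where "\<And>t. f (s(k := t)) \<le> ennreal (A * exp (v * (t - s k)))"
proof -
  obtain \<epsilon> where \<epsilon>: "0 < \<epsilon>" "\<And>x. (\<forall>i. \<bar>x i - s i\<bar> < \<epsilon>) \<Longrightarrow> 0 < f x"
    using pos unfolding positive_near_def by blast
  have A: "0 < A"
    using \<epsilon>(2)[of s] \<epsilon>(1) fs by (simp add: ennreal_less_zero_iff)
  \<comment> \<open>Slopes are formed with every positive real lower bound b of the value, which
    covers infinite values as well.\<close>
  define S1 where "S1 = {(ln b - ln A) / (t - s k) | t b. s k < t \<and> 0 < b \<and> ennreal b \<le> f (s(k := t))}"
  define S2 where "S2 = {(ln b - ln A) / (t - s k) | t b. t < s k \<and> 0 < b \<and> ennreal b \<le> f (s(k := t))}"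
  have approx: "\<exists>b>0. ennreal b \<le> c" if "0 < c" for c
    using that by (cases c) (auto intro: exI[of _ 1])
  have "\<exists>b>0. ennreal b \<le> f (s(k := s k + \<epsilon> / 2))" "\<exists>b>0. ennreal b \<le> f (s(k := s k - \<epsilon> / 2))"
    using \<epsilon> by (auto intro!: approx \<epsilon>(2))
  then obtain b1 b2 where b12: "0 < b1" "ennreal b1 \<le> f (s(k := s k + \<epsilon> / 2))" "0 < b2" "ennreal b2 \<le> f (s(k := s k - \<epsilon> / 2))"
    by blast
  have ne: "S1 \<noteq> {}" "S2 \<noteq> {}"
    unfolding S1_def S2_def
    using b12 \<epsilon>(1) by (force intro!: exI[of _ "s k + \<epsilon> / 2"] exI[of _ b1])+
  have le: "p \<le> q" if "p \<in> S1" "q \<in> S2" for p q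
  proof -
    obtain t b where t: "s k < t" "0 < b" "ennreal b \<le> f (s(k := t))" "p = (ln b - ln A) / (t - s k)"
      using \<open>p \<in> S1\<close> unfolding S1_def by blast
    obtain r c where r: "r < s k" "0 < c" "ennreal c \<le> f (s(k := r))" "q = (ln c - ln A) / (r - s k)"
      using \<open>q \<in> S2\<close> unfolding S2_def by blast
    \<comment> \<open>The weight that writes \<open>s k\<close> as a convex combination of r < s k
      and t > s k.\<close>
    define \<mu> where "\<mu> = (s k - r) / (t - r)"
    have \<mu>: "0 < \<mu>" "\<mu> < 1" using t r by (auto simp: \<mu>_def field_simps)
    have "t - r \<noteq> 0" using t r by simp
    then have "\<mu> * (t - r) = s k - r" by (simp add: \<mu>_def)
    then have mix: "(1 - \<mu>) * r + \<mu> * t = s k" by (simp add: algebra_simps)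
    have "ennreal (c powr (1 - \<mu>) * b powr \<mu>) \<le> f (\<lambda>i. (1 - \<mu>) * (s(k := r)) i + \<mu> * (s(k := t)) i)"
      using t r by (intro log_concaveD[OF lc \<mu>, where x = "s(k := r)" and y = "s(k := t)"])
    also have "(\<lambda>i. (1 - \<mu>) * (s(k := r)) i + \<mu> * (s(k := t)) i) = s"
      using mix by (auto simp: fun_eq_iff algebra_simps)
    finally have "c powr (1 - \<mu>) * b powr \<mu> \<le> A"
      using A by (simp add: fs)
    then have "ln (c powr (1 - \<mu>) * b powr \<mu>) \<le> ln A"
      using t r A by (subst ln_le_cancel_iff) auto
    then have "(1 - \<mu>) * ln c + \<mu> * ln b \<le> ln A"
      using t r by (simp add: ln_mult ln_powr)
    then have 1: "\<mu> * (ln b - ln A) \<le> (1 - \<mu>) * (ln A - ln c)"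
      by (simp add: algebra_simps)
    have "(t - r) * (\<mu> * (ln b - ln A)) \<le> (t - r) * ((1 - \<mu>) * (ln A - ln c))"
      using 1 t r by (intro mult_left_mono) auto
    moreover have "(t - r) * \<mu> = s k - r" "(t - r) * (1 - \<mu>) = t - s k"
      using \<open>\<mu> * (t - r) = s k - r\<close> by (auto simp: algebra_simps)
    ultimately have "(s k - r) * (ln b - ln A) \<le> (t - s k) * (ln A - ln c)"
      by (metis mult.assoc)
    moreover have "ln b - ln A = p * (t - s k)" "ln A - ln c = q * (s k - r)"
      using t r by (auto simp: field_simps)
    ultimately have "((s k - r) * (t - s k)) * p \<le> ((s k - r) * (t - s k)) * q"
      by (simp add: mult_ac)
    moreover have "0 < (s k - r) * (t - s k)" using t r by simp
    ultimately show ?thesis by (simp only: mult_le_cancel_left_pos)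
  qed
  define v where "v = Sup S1"
  obtain q where "q \<in> S2" using ne by blast
  then have bdd: "bdd_above S1" using le unfolding bdd_above_def by blast
  have v1: "p \<le> v" if "p \<in> S1" for p
    unfolding v_def using that bdd by (rule cSup_upper)
  have v2: "v \<le> q" if "q \<in> S2" for q
    unfolding v_def using that ne le by (intro cSup_least) auto
  have main: "b \<le> A * exp (v * (t - s k))" if "0 < b" "ennreal b \<le> f (s(k := t))" for b t
  proof -
    have "ln b - ln A \<le> v * (t - s k)"
    proof (cases t "s k" rule: linorder_cases)
      case less
      then have "v \<le> (ln b - ln A) / (t - s k)" using that by (intro v2) (auto simp: S2_def)
      then show ?thesis using less by (simp add: field_simps)
    next
      case equal
      then have "b \<le> A" using that fs A by simp
      then show ?thesis using equal that A by simp
    next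
      case greater
      then have "(ln b - ln A) / (t - s k) \<le> v" using that by (intro v1) (auto simp: S1_def)
      then show ?thesis using greater by (simp add: field_simps)
    qed
    then have "exp (ln b - ln A) \<le> exp (v * (t - s k))" by simp
    then show ?thesis using that A by (simp add: exp_diff field_simps)
  qed
  have "f (s(k := t)) \<le> ennreal (A * exp (v * (t - s k)))" for t
  proof (cases "f (s(k := t))")
    case (real b)
    then show ?thesis using main[of b t] A by (cases "b = 0") (auto intro!: ennreal_leI)
  next
    \<comment> \<open>An infinite value has every real as a lower bound, in particular one above the
      majorant.\<close>
    case top
    have "A * exp (v * (t - s k)) + 1 \<le> A * exp (v * (t - s k))"
      using A top by (intro main) (auto intro!: add_pos_pos)
    then show ?thesis by simp
  qed
  then show ?thesis by (rule that)
qed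

lemma nn_integral_gaussian:
  assumes "0 < \<delta>"
  shows "(\<integral>\<^sup>+t. ennreal (exp (- \<delta> * t\<^sup>2)) \<partial>lborel) = ennreal (sqrt (pi / \<delta>))"
proof -
  define \<sigma> where "\<sigma> = 1 / sqrt (2 * \<delta>)"
  have \<sigma>: "0 < \<sigma>" "2 * \<sigma>\<^sup>2 = 1 / \<delta>" using assms by (auto simp: \<sigma>_def power_divide)
  have "(\<integral>\<^sup>+t. ennreal (normal_density 0 \<sigma> t) \<partial>lborel) = ennreal (\<integral>t. normal_density 0 \<sigma> t \<partial>lborel)"
    using \<sigma> by (intro nn_integral_eq_integral integrable_normal_density) auto
  then have 1: "(\<integral>\<^sup>+t. ennreal (normal_density 0 \<sigma> t) \<partial>lborel) = 1"
    using \<sigma> by (simp add: integral_normal_density)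
  have "exp (- \<delta> * t\<^sup>2) = sqrt (pi / \<delta>) * normal_density 0 \<sigma> t" for t
  proof -
    have "2 * pi * \<sigma>\<^sup>2 = pi / \<delta>" using \<sigma>(2) by (simp add: field_simps)
    moreover have "- t\<^sup>2 / (2 * \<sigma>\<^sup>2) = - \<delta> * t\<^sup>2" using \<sigma>(2) by simp
    ultimately show ?thesis using assms by (simp add: normal_density_def)
  qed
  then have "(\<integral>\<^sup>+t. ennreal (exp (- \<delta> * t\<^sup>2)) \<partial>lborel) = (\<integral>\<^sup>+t. ennreal (sqrt (pi / \<delta>)) * ennreal (normal_density 0 \<sigma> t) \<partial>lborel)"
    using assms by (simp add: ennreal_mult)
  also have "\<dots> = ennreal (sqrt (pi / \<delta>))"
    by (subst nn_integral_cmult) (auto simp: 1)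
  finally show ?thesis .
qed

text \<open>The tilt cancels the growth of the majorant, which leaves a constant times the Gaussian.
  The majorant belongs to the exact value at \<open>s\<close> and is relaxed to \<open>A\<close>
  afterwards.\<close>

lemma gaussian_tilt_exists:
  assumes f [measurable]: "f \<in> borel_measurable (PiM UNIV (\<lambda>_. borel))" and lc: "log_concave f"
    and pos: "positive_near s f" and fs: "f s \<le> ennreal A" and "0 < \<delta>"
  obtains v where "(\<integral>\<^sup>+t. f (s(k := t)) * ennreal (exp (- v * t - \<delta> * t\<^sup>2)) \<partial>lborel)
    \<le> ennreal (A * exp (- v * s k) * sqrt (pi / \<delta>))"
proof -
  obtain B where B: "f s = ennreal B" "0 \<le> B"
    using fs by (cases "f s") (auto simp: top_unique)
  have "0 < f s" using pos by (auto simp: positive_near_def)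
  then have BA: "B \<le> A" "0 < B" using fs B by (auto simp: ennreal_less_zero_iff ennreal_le_iff2)
  obtain v where v: "\<And>t. f (s(k := t)) \<le> ennreal (B * exp (v * (t - s k)))"
    using log_concave_slice_support[OF lc pos B(1)] by blast
  have "(\<integral>\<^sup>+t. f (s(k := t)) * ennreal (exp (- v * t - \<delta> * t\<^sup>2)) \<partial>lborel)
    \<le> (\<integral>\<^sup>+t. ennreal (A * exp (- v * s k)) * ennreal (exp (- \<delta> * t\<^sup>2)) \<partial>lborel)"
  proof (rule nn_integral_mono)
    fix t :: real
    have "f (s(k := t)) * ennreal (exp (- v * t - \<delta> * t\<^sup>2)) \<le> ennreal (B * exp (v * (t - s k))) * ennreal (exp (- v * t - \<delta> * t\<^sup>2))"
      by (intro mult_right_mono v) simp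
    also have "\<dots> = ennreal (B * (exp (v * (t - s k)) * exp (- v * t - \<delta> * t\<^sup>2)))"
      using BA by (simp flip: ennreal_mult add: mult.assoc)
    also have "exp (v * (t - s k)) * exp (- v * t - \<delta> * t\<^sup>2) = exp (- v * s k) * exp (- \<delta> * t\<^sup>2)"
      by (simp add: algebra_simps flip: exp_add)
    also have "ennreal (B * (exp (- v * s k) * exp (- \<delta> * t\<^sup>2))) \<le> ennreal (A * (exp (- v * s k) * exp (- \<delta> * t\<^sup>2)))"
      using BA by (intro ennreal_leI mult_right_mono) auto
    also have "\<dots> = ennreal (A * exp (- v * s k)) * ennreal (exp (- \<delta> * t\<^sup>2))"
      using BA by (simp flip: ennreal_mult add: mult.assoc)
    finally show "f (s(k := t)) * ennreal (exp (- v * t - \<delta> * t\<^sup>2)) \<le> ennreal (A * exp (- v * s k)) * ennreal (exp (- \<delta> * t\<^sup>2))" .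
  qed
  also have "\<dots> = ennreal (A * exp (- v * s k)) * ennreal (sqrt (pi / \<delta>))"
    using nn_integral_gaussian[OF \<open>0 < \<delta>\<close>] by (subst nn_integral_cmult) auto
  also have "\<dots> = ennreal (A * exp (- v * s k) * sqrt (pi / \<delta>))"
    using BA \<open>0 < \<delta>\<close> by (simp add: ennreal_mult)
  finally show ?thesis by (rule that)
qed

section \<open>Integrating out one coordinate after the other\<close>

abbreviation lborel_Pi :: "'i set \<Rightarrow> ('i \<Rightarrow> real) measure" where
  "lborel_Pi I \<equiv> Pi\<^sub>M I (\<lambda>_. lborel)"

interpretation lborel_Pi: product_sigma_finite "\<lambda>_::'i. lborel :: real measure" ..

lemma sigma_finite_lborel_Pi: "finite I \<Longrightarrow> sigma_finite_measure (lborel_Pi I)"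
  by (rule lborel_Pi.sigma_finite)

text \<open>The coordinates below \<open>j\<close> are integrated and the others are read from
  \<open>x\<close>. With zero \<open>v\<close> and \<delta>, and an indicator for \<open>F\<close>,
  this is the volume of the section on which the coordinates from \<open>j\<close> on are
  fixed.\<close>

definition partial_integral ::
  "((nat \<Rightarrow> real) \<Rightarrow> ennreal) \<Rightarrow> (nat \<Rightarrow> real) \<Rightarrow> (nat \<Rightarrow> real) \<Rightarrow> nat \<Rightarrow> (nat \<Rightarrow> real) \<Rightarrow> ennreal" where
  "partial_integral F v \<delta> j x = (\<integral>\<^sup>+y. F (\<lambda>i. if i < j then y i else x i) *
     (\<Prod>k<j. ennreal (exp (- v k * y k - \<delta> k * (y k)\<^sup>2))) \<partial>lborel_Pi {..<j})"

lemma measurable_splice [measurable]: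
  "(\<lambda>(x, y) i :: nat. if i < j then y i else x i)
     \<in> measurable (PiM UNIV (\<lambda>_. borel) \<Otimes>\<^sub>M lborel_Pi {..<j}) (PiM UNIV (\<lambda>_. borel :: real measure))"
proof (rule measurable_PiM_single')
  fix i :: nat
  show "(\<lambda>\<omega>. (case \<omega> of (x, y) \<Rightarrow> \<lambda>i. if i < j then y i else x i) i)
    \<in> borel_measurable (PiM UNIV (\<lambda>_. borel) \<Otimes>\<^sub>M lborel_Pi {..<j})"
    by (cases "i < j") (auto simp: case_prod_beta)
qed auto

lemma measurable_partial_integral:
  assumes [measurable]: "F \<in> borel_measurable (PiM UNIV (\<lambda>_. borel))"
  shows "partial_integral F v \<delta> j \<in> borel_measurable (PiM UNIV (\<lambda>_. borel))"
proof -
  interpret sigma_finite_measure "lborel_Pi {..<j}" by (rule sigma_finite_lborel_Pi) simp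
  have "(\<lambda>z. F ((\<lambda>(x, y) i. if i < j then y i else x i) z)) \<in> borel_measurable (PiM UNIV (\<lambda>_. borel) \<Otimes>\<^sub>M lborel_Pi {..<j})"
    by measurable
  then have [measurable]: "(\<lambda>(x, y). F (\<lambda>i. if i < j then y i else x i)) \<in> borel_measurable (PiM UNIV (\<lambda>_. borel) \<Otimes>\<^sub>M lborel_Pi {..<j})"
    by (simp add: case_prod_beta)
  show ?thesis
    unfolding partial_integral_def[abs_def] by measurable
qed

lemma partial_integral_0: "partial_integral F v \<delta> 0 x = F x"
  by (simp add: partial_integral_def PiM_empty nn_integral_count_space_finite)

lemma partial_integral_cong:
  assumes "\<And>k. k < j \<Longrightarrow> v k = v' k" "\<And>k. k < j \<Longrightarrow> \<delta> k = \<delta>' k"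
  shows "partial_integral F v \<delta> j x = partial_integral F v' \<delta>' j x"
  unfolding partial_integral_def using assms by simp

lemma partial_integral_Suc:
  assumes F [measurable]: "F \<in> borel_measurable (PiM UNIV (\<lambda>_. borel))"
  shows "partial_integral F v \<delta> (Suc j) x =
    (\<integral>\<^sup>+t. partial_integral F v \<delta> j (x(j := t)) * ennreal (exp (- v j * t - \<delta> j * t\<^sup>2)) \<partial>lborel)"
proof -
  let ?w = "\<lambda>k t. ennreal (exp (- v k * t - \<delta> k * t\<^sup>2))"
  have splice: "(\<lambda>y i. if i < k then y i else x i) \<in> measurable (lborel_Pi {..<k}) (PiM UNIV (\<lambda>_. borel))" for x :: "nat \<Rightarrow> real" and k
  proof (rule measurable_PiM_single')
    show "(\<lambda>\<omega>. if i < k then \<omega> i else x i) \<in> borel_measurable (lborel_Pi {..<k})" for i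
      by (cases "i < k") auto
  qed auto
  have [measurable]: "(\<lambda>y. F (\<lambda>i. if i < k then y i else x i)) \<in> borel_measurable (lborel_Pi {..<k})" for x :: "nat \<Rightarrow> real" and k
    by (rule measurable_compose[OF splice F])
  have "partial_integral F v \<delta> (Suc j) x = (\<integral>\<^sup>+y. F (\<lambda>i. if i < Suc j then y i else x i) * (\<Prod>k<Suc j. ?w k (y k)) \<partial>lborel_Pi (insert j {..<j}))"
    by (simp add: partial_integral_def lessThan_Suc)
  also have "\<dots> = (\<integral>\<^sup>+t. (\<integral>\<^sup>+y. F (\<lambda>i. if i < Suc j then (y(j := t)) i else x i) * (\<Prod>k<Suc j. ?w k ((y(j := t)) k)) \<partial>lborel_Pi {..<j}) \<partial>lborel)"
    by (subst lborel_Pi.product_nn_integral_insert_rev) (auto simp flip: lessThan_Suc)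
  also have "\<dots> = (\<integral>\<^sup>+t. partial_integral F v \<delta> j (x(j := t)) * ?w j t \<partial>lborel)"
  proof (rule nn_integral_cong)
    fix t :: real
    have "(\<integral>\<^sup>+y. F (\<lambda>i. if i < Suc j then (y(j := t)) i else x i) * (\<Prod>k<Suc j. ?w k ((y(j := t)) k)) \<partial>lborel_Pi {..<j})
      = (\<integral>\<^sup>+y. F (\<lambda>i. if i < j then y i else (x(j := t)) i) * (\<Prod>k<j. ?w k (y k)) * ?w j t \<partial>lborel_Pi {..<j})"
    proof (rule nn_integral_cong)
      fix y
      have "(\<lambda>i. if i < Suc j then (y(j := t)) i else x i) = (\<lambda>i. if i < j then y i else (x(j := t)) i)"
        by (auto simp: fun_eq_iff less_Suc_eq)
      moreover have "(\<Prod>k<Suc j. ?w k ((y(j := t)) k)) = (\<Prod>k<j. ?w k (y k)) * ?w j t"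
        by (simp add: lessThan_Suc mult.commute)
      ultimately show "F (\<lambda>i. if i < Suc j then (y(j := t)) i else x i) * (\<Prod>k<Suc j. ?w k ((y(j := t)) k))
        = F (\<lambda>i. if i < j then y i else (x(j := t)) i) * (\<Prod>k<j. ?w k (y k)) * ?w j t"
        by (simp only: mult.assoc)
    qed
    also have "\<dots> = partial_integral F v \<delta> j (x(j := t)) * ?w j t"
      unfolding partial_integral_def by (subst nn_integral_multc) auto
    finally show "(\<integral>\<^sup>+y. F (\<lambda>i. if i < Suc j then (y(j := t)) i else x i) * (\<Prod>k<Suc j. ?w k ((y(j := t)) k)) \<partial>lborel_Pi {..<j})
      = partial_integral F v \<delta> j (x(j := t)) * ?w j t" .
  qed
  finally show ?thesis .
qed

lemma partial_integral_log_concave: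
  assumes F: "F \<in> borel_measurable (PiM UNIV (\<lambda>_. borel))" and "log_concave F" "positive_near s F"
    and "\<And>k. 0 \<le> \<delta> k"
  shows "log_concave (partial_integral F v \<delta> j) \<and> positive_near s (partial_integral F v \<delta> j)"
proof (induction j)
  case 0
  have "partial_integral F v \<delta> 0 = F" by (simp add: fun_eq_iff partial_integral_0)
  then show ?case using assms by simp
next
  case (Suc j)
  have "partial_integral F v \<delta> (Suc j) = (\<lambda>x. \<integral>\<^sup>+t. partial_integral F v \<delta> j (x(j := t)) * ennreal (exp (- v j * t - \<delta> j * t\<^sup>2)) \<partial>lborel)"
    by (rule ext) (rule partial_integral_Suc[OF F])
  then show ?case
    using Suc assms(4) measurable_partial_integral[OF F]
    by (simp only: log_concave_marginal positive_near_marginal)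
qed

text \<open>
  Instead of a supergradient in all the coordinates \<open>d, \<dots>, D - 1\<close> at once, the tilt \<open>v\<close> is chosen one
  coordinate at a time, always for the function that is left after integrating the previous coordinates.
\<close>

lemma tilted_integral_bound:
  assumes F: "F \<in> borel_measurable (PiM UNIV (\<lambda>_. borel))" and lc: "log_concave F" and pos: "positive_near s F"
    and "d \<le> D" and \<delta>: "0 < \<delta>"
    and V: "partial_integral F (\<lambda>_. 0) (\<lambda>_. 0) d s \<le> ennreal V"
  shows "\<exists>v. (\<forall>k<d. v k = 0) \<and> partial_integral F v (\<lambda>k. if k < d then 0 else \<delta>) D s
    \<le> ennreal (V * (\<Prod>k\<in>{d..<D}. exp (- v k * s k) * sqrt (pi / \<delta>)))"
  using \<open>d \<le> D\<close>
proof (induction D rule: dec_induct)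
  case base
  have "partial_integral F (\<lambda>_. 0) (\<lambda>k. if k < d then 0 else \<delta>) d s = partial_integral F (\<lambda>_. 0) (\<lambda>_. 0) d s"
    by (rule partial_integral_cong) auto
  then show ?case using V by (intro exI[of _ "\<lambda>_. 0"]) simp
next
  case (step j)
  let ?\<delta> = "\<lambda>k. if k < d then 0 else \<delta>"
  obtain v where v: "\<And>k. k < d \<Longrightarrow> v k = 0"
    "partial_integral F v ?\<delta> j s \<le> ennreal (V * (\<Prod>k\<in>{d..<j}. exp (- v k * s k) * sqrt (pi / \<delta>)))"
    using step.IH by blast
  have nn: "0 \<le> ?\<delta> k" for k using \<delta> by simp
  have "log_concave (partial_integral F v ?\<delta> j)" "positive_near s (partial_integral F v ?\<delta> j)"
    using partial_integral_log_concave[where \<delta> = ?\<delta>, OF F lc pos nn] by blast+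
  then obtain u where u: "(\<integral>\<^sup>+t. partial_integral F v ?\<delta> j (s(j := t)) * ennreal (exp (- u * t - \<delta> * t\<^sup>2)) \<partial>lborel)
    \<le> ennreal (V * (\<Prod>k\<in>{d..<j}. exp (- v k * s k) * sqrt (pi / \<delta>)) * exp (- u * s j) * sqrt (pi / \<delta>))"
    using gaussian_tilt_exists[OF measurable_partial_integral[OF F] _ _ v(2) \<delta>, of j]
    by blast
  \<comment> \<open>The slope at \<open>j\<close> does not enter the integral over the coordinates
    below \<open>j\<close>, so the earlier choices stay valid.\<close>
  have eq: "partial_integral F (v(j := u)) ?\<delta> j x = partial_integral F v ?\<delta> j x" for x
    by (rule partial_integral_cong) auto
  have "partial_integral F (v(j := u)) ?\<delta> (Suc j) s \<le> ennreal (V * (\<Prod>k\<in>{d..<j}. exp (- v k * s k) * sqrt (pi / \<delta>)) * exp (- u * s j) * sqrt (pi / \<delta>))"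
    using u step.hyps by (simp add: partial_integral_Suc[OF F] eq)
  also have "(\<Prod>k\<in>{d..<j}. exp (- v k * s k) * sqrt (pi / \<delta>)) = (\<Prod>k\<in>{d..<j}. exp (- (v(j := u)) k * s k) * sqrt (pi / \<delta>))"
    by (rule prod.cong) auto
  also have "V * (\<Prod>k\<in>{d..<j}. exp (- (v(j := u)) k * s k) * sqrt (pi / \<delta>)) * exp (- u * s j) * sqrt (pi / \<delta>)
    = V * (\<Prod>k\<in>{d..<Suc j}. exp (- (v(j := u)) k * s k) * sqrt (pi / \<delta>))"
    using step.hyps by (subst prod.atLeastLessThan_Suc) (simp_all add: mult.assoc)
  finally show ?case using v(1) step.hyps by (intro exI[of _ "v(j := u)"]) auto
qed

section \<open>Orthogonal substitution\<close>

text \<open>It suffices to compare boxes, which determine the product measure. The cases of interest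
  are translations, the reflection c = -1 and the contraction by 1 - \<epsilon>.\<close>

lemma lborel_Pi_affine:
  assumes "finite I" and c: "c \<noteq> 0"
  shows "lborel_Pi I = density (distr (lborel_Pi I) (lborel_Pi I) (\<lambda>x. \<lambda>i\<in>I. a i + c * x i)) (\<lambda>_. ennreal (\<bar>c\<bar> ^ card I))"
    (is "_ = ?P")
proof (rule lborel_Pi.PiM_eqI[symmetric])
  have T [measurable]: "(\<lambda>x. \<lambda>i\<in>I. a i + c * x i) \<in> measurable (lborel_Pi I) (lborel_Pi I)"
    by measurable
  fix A :: "'a \<Rightarrow> real set" assume A: "\<And>i. i \<in> I \<Longrightarrow> A i \<in> sets lborel"
  have A' [measurable]: "{x. a i + c * x \<in> A i} \<in> sets borel" if "i \<in> I" for i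
  proof -
    have "A i \<in> sets borel" using A[OF that] by simp
    then have "(\<lambda>x. a i + c * x) -` A i \<inter> space borel \<in> sets borel"
      by (rule measurable_sets[rotated]) measurable
    then show ?thesis by (simp add: vimage_def)
  qed
  have PA: "Pi\<^sub>E I A \<in> sets (lborel_Pi I)" using A \<open>finite I\<close> by (intro sets_PiM_I_finite) auto
  have "emeasure ?P (Pi\<^sub>E I A) = ennreal (\<bar>c\<bar> ^ card I) * emeasure (distr (lborel_Pi I) (lborel_Pi I) (\<lambda>x. \<lambda>i\<in>I. a i + c * x i)) (Pi\<^sub>E I A)"
    using PA by (simp add: emeasure_density nn_integral_cmult_indicator)
  also have "emeasure (distr (lborel_Pi I) (lborel_Pi I) (\<lambda>x. \<lambda>i\<in>I. a i + c * x i)) (Pi\<^sub>E I A)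
     = emeasure (lborel_Pi I) ((\<lambda>x. \<lambda>i\<in>I. a i + c * x i) -` Pi\<^sub>E I A \<inter> space (lborel_Pi I))"
    using PA by (intro emeasure_distr T)
  also have "(\<lambda>x. \<lambda>i\<in>I. a i + c * x i) -` Pi\<^sub>E I A \<inter> space (lborel_Pi I) = Pi\<^sub>E I (\<lambda>i. {x. a i + c * x \<in> A i})"
    by (auto simp: space_PiM PiE_iff extensional_def)
  also have "emeasure (lborel_Pi I) \<dots> = (\<Prod>i\<in>I. emeasure lborel {x. a i + c * x \<in> A i})"
    using \<open>finite I\<close> A' by (intro lborel_Pi.emeasure_PiM) auto
  also have "ennreal (\<bar>c\<bar> ^ card I) * \<dots> = (\<Prod>i\<in>I. ennreal \<bar>c\<bar> * emeasure lborel {x. a i + c * x \<in> A i})"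
    by (simp add: prod.distrib ennreal_power)
  also have "\<dots> = (\<Prod>i\<in>I. emeasure lborel (A i))"
  proof (rule prod.cong[OF refl])
    fix i assume i: "i \<in> I"
    have "emeasure lborel (A i) = (\<integral>\<^sup>+x. indicator (A i) x \<partial>lborel)" using A[OF i] by simp
    also have "\<dots> = ennreal \<bar>c\<bar> * (\<integral>\<^sup>+x. indicator (A i) (a i + c * x) \<partial>lborel)"
      using A[OF i] c by (intro nn_integral_real_affine) auto
    also have "(\<integral>\<^sup>+x. indicator (A i) (a i + c * x) \<partial>lborel) = (\<integral>\<^sup>+x. indicator {x. a i + c * x \<in> A i} x \<partial>lborel)"
      by (intro nn_integral_cong) (simp add: indicator_def)
    finally show "ennreal \<bar>c\<bar> * emeasure lborel {x. a i + c * x \<in> A i} = emeasure lborel (A i)"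
      using A'[OF i] by simp
  qed
  finally show "emeasure ?P (Pi\<^sub>E I A) = (\<Prod>i\<in>I. emeasure lborel (A i))" .
qed (use \<open>finite I\<close> in auto)

lemma nn_integral_lborel_Pi_affine:
  assumes "finite I" and c: "c \<noteq> 0" and [measurable]: "f \<in> borel_measurable (lborel_Pi I)"
  shows "(\<integral>\<^sup>+x. f x \<partial>lborel_Pi I) = ennreal (\<bar>c\<bar> ^ card I) * (\<integral>\<^sup>+x. f (\<lambda>i\<in>I. a i + c * x i) \<partial>lborel_Pi I)"
proof -
  have [measurable]: "(\<lambda>x. \<lambda>i\<in>I. a i + c * x i) \<in> measurable (lborel_Pi I) (lborel_Pi I)"
    by measurable
  show ?thesis
    by (subst lborel_Pi_affine[OF assms(1,2), of a])
       (simp add: nn_integral_density nn_integral_distr nn_integral_cmult)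
qed

text \<open>Parseval's identity; it carries linear forms and squared norms between matrix entries
  and basis coordinates.\<close>

lemma sum_products_orthonormal:
  fixes u :: "'k \<Rightarrow> 'i \<Rightarrow> real"
  assumes "finite K"
    and cols: "\<And>k l. k \<in> K \<Longrightarrow> l \<in> K \<Longrightarrow> (\<Sum>i\<in>I. u k i * u l i) = (if k = l then 1 else 0)"
  shows "(\<Sum>i\<in>I. (\<Sum>k\<in>K. x k * u k i) * (\<Sum>k\<in>K. y k * u k i)) = (\<Sum>k\<in>K. x k * y k)"
proof -
  have "(\<Sum>i\<in>I. (\<Sum>k\<in>K. x k * u k i) * (\<Sum>k\<in>K. y k * u k i)) = (\<Sum>i\<in>I. \<Sum>k\<in>K. \<Sum>l\<in>K. x k * y l * (u k i * u l i))"
    by (simp add: sum_product mult_ac)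
  also have "\<dots> = (\<Sum>k\<in>K. \<Sum>l\<in>K. \<Sum>i\<in>I. x k * y l * (u k i * u l i))"
    by (subst sum.swap) (intro sum.cong refl sum.swap)
  also have "\<dots> = (\<Sum>k\<in>K. \<Sum>l\<in>K. x k * y l * (if k = l then 1 else 0))"
    by (intro sum.cong refl) (simp add: cols flip: sum_distrib_left)
  also have "\<dots> = (\<Sum>k\<in>K. x k * y k)"
    using \<open>finite K\<close> by (intro sum.cong refl) (simp add: if_distrib cong: if_cong)
  finally show ?thesis .
qed

lemma nn_integral_lborel_Pi_gaussian:
  assumes "finite I"
  shows "(\<integral>\<^sup>+x. ennreal (exp (- (\<Sum>i\<in>I. (x i)\<^sup>2))) \<partial>lborel_Pi I) = ennreal (sqrt pi ^ card I)"
proof -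
  have "(\<integral>\<^sup>+x. ennreal (exp (- (\<Sum>i\<in>I. (x i)\<^sup>2))) \<partial>lborel_Pi I) = (\<integral>\<^sup>+x. (\<Prod>i\<in>I. ennreal (exp (- (x i)\<^sup>2))) \<partial>lborel_Pi I)"
    using assms by (simp add: prod_ennreal exp_sum flip: sum_negf)
  also have "\<dots> = (\<Prod>i\<in>I. (\<integral>\<^sup>+t. ennreal (exp (- t\<^sup>2)) \<partial>lborel))"
    using assms by (subst lborel_Pi.product_nn_integral_prod) auto
  also have "\<dots> = ennreal (sqrt pi ^ card I)"
    using nn_integral_gaussian[of 1] by (simp add: ennreal_power)
  finally show ?thesis .
qed

text \<open>
  The substituted Lebesgue measure is translation invariant, so it is a multiple of Lebesgue measure; the
  Gaussian, which is invariant under orthogonal maps, shows that the multiple is $1$.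
\<close>

lemma nn_integral_lborel_Pi_orthogonal:
  fixes u :: "'k \<Rightarrow> 'i \<Rightarrow> real"
  assumes fin: "finite K" "finite I"
    and cols: "\<And>k l. k \<in> K \<Longrightarrow> l \<in> K \<Longrightarrow> (\<Sum>i\<in>I. u k i * u l i) = (if k = l then 1 else 0)"
    and rows: "\<And>i j. i \<in> I \<Longrightarrow> j \<in> I \<Longrightarrow> (\<Sum>k\<in>K. u k i * u k j) = (if i = j then 1 else 0)"
    and f [measurable]: "f \<in> borel_measurable (lborel_Pi I)"
  shows "(\<integral>\<^sup>+x. f (\<lambda>i\<in>I. \<Sum>k\<in>K. x k * u k i) \<partial>lborel_Pi K) = (\<integral>\<^sup>+y. f y \<partial>lborel_Pi I)"
proof -
  define T where "T x = (\<lambda>i\<in>I. \<Sum>k\<in>K. x k * u k i)" for x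
  define S where "S y k = (\<Sum>i\<in>I. y i * u k i)" for y k
  define g :: "('i \<Rightarrow> real) \<Rightarrow> ennreal" where "g y = ennreal (exp (- (\<Sum>i\<in>I. (y i)\<^sup>2)))" for y
  have [measurable]: "T \<in> measurable (lborel_Pi K) (lborel_Pi I)" unfolding T_def[abs_def] by measurable
  have [measurable]: "g \<in> borel_measurable (lborel_Pi I)" unfolding g_def[abs_def] by measurable
  interpret K: sigma_finite_measure "lborel_Pi K" by (rule sigma_finite_lborel_Pi) fact
  interpret I: sigma_finite_measure "lborel_Pi I" by (rule sigma_finite_lborel_Pi) fact
  interpret pair_sigma_finite "lborel_Pi K" "lborel_Pi I" ..
  \<comment> \<open>The sum of the squares of all entries of the orthogonal matrix, evaluated in
    both orders.\<close>
  have card: "card K = card I"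
  proof -
    have "real (card K) = (\<Sum>k\<in>K. \<Sum>i\<in>I. u k i * u k i)" using cols by simp
    also have "\<dots> = (\<Sum>i\<in>I. \<Sum>k\<in>K. u k i * u k i)" by (rule sum.swap)
    also have "\<dots> = real (card I)" using rows by simp
    finally show ?thesis by simp
  qed
  have TS: "T (\<lambda>k\<in>K. x k - S y k) = (\<lambda>i\<in>I. T x i - y i)" for x y
  proof -
    have "(\<Sum>k\<in>K. (x k - S y k) * u k i) = (\<Sum>k\<in>K. x k * u k i) - y i" if "i \<in> I" for i
    proof -
      have "(\<Sum>k\<in>K. S y k * u k i) = (\<Sum>k\<in>K. \<Sum>j\<in>I. y j * (u k j * u k i))"
        unfolding S_def sum_distrib_right by (simp add: mult.assoc)
      also have "\<dots> = (\<Sum>j\<in>I. y j * (\<Sum>k\<in>K. u k j * u k i))"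
        by (subst sum.swap) (simp add: sum_distrib_left)
      also have "\<dots> = (\<Sum>j\<in>I. if j = i then y j else 0)"
        using that by (intro sum.cong refl) (simp add: rows)
      also have "\<dots> = y i" using that fin by simp
      finally show ?thesis by (simp add: left_diff_distrib sum_subtractf)
    qed
    then show ?thesis by (auto simp: T_def fun_eq_iff restrict_def intro!: sum.cong)
  qed
  have TS': "(\<lambda>i\<in>I. T (\<lambda>k\<in>K. x k - S y k) i + y i) = T x" for x y
    unfolding TS by (auto simp: T_def restrict_def fun_eq_iff)
  \<comment> \<open>Uniqueness of a translation invariant measure up to a factor. The substitutions
    are y to T x + y, then x to x - S y with the transpose S as the inverse of T, then y to T x - y,
    with the order of integration exchanged in between.\<close>
  have swap: "(\<integral>\<^sup>+x. a (T x) \<partial>lborel_Pi K) * (\<integral>\<^sup>+y. b y \<partial>lborel_Pi I) = (\<integral>\<^sup>+x. b (T x) \<partial>lborel_Pi K) * (\<integral>\<^sup>+y. a y \<partial>lborel_Pi I)"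
    if [measurable]: "a \<in> borel_measurable (lborel_Pi I)" "b \<in> borel_measurable (lborel_Pi I)" for a b :: "('i \<Rightarrow> real) \<Rightarrow> ennreal"
  proof -
    have Tz [measurable]: "(\<lambda>z. T (fst z) i) \<in> borel_measurable (lborel_Pi K \<Otimes>\<^sub>M lborel_Pi I)" if "i \<in> I" for i
      using that unfolding T_def by simp
    have [measurable]: "(\<lambda>z. \<lambda>i\<in>I. T (fst z) i + snd z i) \<in> measurable (lborel_Pi K \<Otimes>\<^sub>M lborel_Pi I) (lborel_Pi I)"
      "(\<lambda>z. \<lambda>i\<in>I. T (fst z) i - snd z i) \<in> measurable (lborel_Pi K \<Otimes>\<^sub>M lborel_Pi I) (lborel_Pi I)"
      using Tz by (auto intro!: measurable_restrict)
    have [measurable]: "(\<lambda>z. b (\<lambda>i\<in>I. T (fst z) i + snd z i)) \<in> borel_measurable (lborel_Pi K \<Otimes>\<^sub>M lborel_Pi I)"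
      "(\<lambda>z. a (\<lambda>i\<in>I. T (fst z) i - snd z i)) \<in> borel_measurable (lborel_Pi K \<Otimes>\<^sub>M lborel_Pi I)"
      by measurable
    have [measurable]: "(\<lambda>y. b (\<lambda>i\<in>I. T x i + y i)) \<in> borel_measurable (lborel_Pi I)"
      "(\<lambda>y. a (\<lambda>i\<in>I. T x i - y i)) \<in> borel_measurable (lborel_Pi I)" for x
      by measurable
    have shift: "(\<integral>\<^sup>+y. b y \<partial>lborel_Pi I) = (\<integral>\<^sup>+y. b (\<lambda>i\<in>I. T x i + y i) \<partial>lborel_Pi I)" for x
      using nn_integral_lborel_Pi_affine[OF fin(2), of 1 b "T x"] by simp
    have refl: "(\<integral>\<^sup>+y. a y \<partial>lborel_Pi I) = (\<integral>\<^sup>+y. a (\<lambda>i\<in>I. T x i - y i) \<partial>lborel_Pi I)" for x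
      using nn_integral_lborel_Pi_affine[OF fin(2), of "-1" a "T x"] by simp
    have "(\<integral>\<^sup>+x. a (T x) \<partial>lborel_Pi K) * (\<integral>\<^sup>+y. b y \<partial>lborel_Pi I) = (\<integral>\<^sup>+x. a (T x) * (\<integral>\<^sup>+y. b y \<partial>lborel_Pi I) \<partial>lborel_Pi K)"
      by (simp add: nn_integral_multc)
    also have "\<dots> = (\<integral>\<^sup>+x. (\<integral>\<^sup>+y. a (T x) * b (\<lambda>i\<in>I. T x i + y i) \<partial>lborel_Pi I) \<partial>lborel_Pi K)"
      by (intro nn_integral_cong) (subst nn_integral_cmult, auto simp: shift[symmetric])
    also have "\<dots> = (\<integral>\<^sup>+y. (\<integral>\<^sup>+x. a (T x) * b (\<lambda>i\<in>I. T x i + y i) \<partial>lborel_Pi K) \<partial>lborel_Pi I)"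
      by (rule Fubini'[symmetric]) (simp add: case_prod_beta)
    also have "\<dots> = (\<integral>\<^sup>+y. (\<integral>\<^sup>+x. a (\<lambda>i\<in>I. T x i - y i) * b (T x) \<partial>lborel_Pi K) \<partial>lborel_Pi I)"
    proof (rule nn_integral_cong)
      fix y assume "y \<in> space (lborel_Pi I)"
      have "(\<lambda>x. T x i) \<in> borel_measurable (lborel_Pi K)" if "i \<in> I" for i
        using that unfolding T_def by simp
      then have [measurable]: "(\<lambda>x. \<lambda>i\<in>I. T x i + y i) \<in> measurable (lborel_Pi K) (lborel_Pi I)"
        by (auto intro!: measurable_restrict)
      have "(\<integral>\<^sup>+x. a (T x) * b (\<lambda>i\<in>I. T x i + y i) \<partial>lborel_Pi K)
        = (\<integral>\<^sup>+x. a (T (\<lambda>k\<in>K. x k - S y k)) * b (\<lambda>i\<in>I. T (\<lambda>k\<in>K. x k - S y k) i + y i) \<partial>lborel_Pi K)"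
        using nn_integral_lborel_Pi_affine[OF fin(1), of 1 "\<lambda>x. a (T x) * b (\<lambda>i\<in>I. T x i + y i)" "\<lambda>k. - S y k"]
        by (simp add: add.commute[of "- _"])
      also have "\<dots> = (\<integral>\<^sup>+x. a (\<lambda>i\<in>I. T x i - y i) * b (T x) \<partial>lborel_Pi K)"
        unfolding TS' unfolding TS ..
      finally show "(\<integral>\<^sup>+x. a (T x) * b (\<lambda>i\<in>I. T x i + y i) \<partial>lborel_Pi K) = (\<integral>\<^sup>+x. a (\<lambda>i\<in>I. T x i - y i) * b (T x) \<partial>lborel_Pi K)" .
    qed
    also have "\<dots> = (\<integral>\<^sup>+x. (\<integral>\<^sup>+y. a (\<lambda>i\<in>I. T x i - y i) * b (T x) \<partial>lborel_Pi I) \<partial>lborel_Pi K)"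
      by (rule Fubini') (simp add: case_prod_beta)
    also have "\<dots> = (\<integral>\<^sup>+x. b (T x) * (\<integral>\<^sup>+y. a y \<partial>lborel_Pi I) \<partial>lborel_Pi K)"
      by (intro nn_integral_cong) (subst nn_integral_multc, auto simp: refl[symmetric] mult.commute)
    also have "\<dots> = (\<integral>\<^sup>+x. b (T x) \<partial>lborel_Pi K) * (\<integral>\<^sup>+y. a y \<partial>lborel_Pi I)"
      by (simp add: nn_integral_multc)
    finally show ?thesis .
  qed
  have gI: "(\<integral>\<^sup>+y. g y \<partial>lborel_Pi I) = ennreal (sqrt pi ^ card I)"
    unfolding g_def by (rule nn_integral_lborel_Pi_gaussian) fact
  have "g (T x) = ennreal (exp (- (\<Sum>k\<in>K. (x k)\<^sup>2)))" for x
    unfolding g_def T_def using sum_products_orthonormal[OF fin(1) cols, of x x] by (simp add: power2_eq_square)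
  then have gK: "(\<integral>\<^sup>+x. g (T x) \<partial>lborel_Pi K) = ennreal (sqrt pi ^ card I)"
    using nn_integral_lborel_Pi_gaussian[OF fin(1)] by (simp add: card)
  have "(\<integral>\<^sup>+x. f (T x) \<partial>lborel_Pi K) * ennreal (sqrt pi ^ card I) = (\<integral>\<^sup>+y. f y \<partial>lborel_Pi I) * ennreal (sqrt pi ^ card I)"
    using swap[of f g] gI gK by (simp add: mult.commute)
  moreover have "ennreal (sqrt pi ^ card I) \<noteq> 0" "ennreal (sqrt pi ^ card I) \<noteq> top"
    by (simp_all add: ennreal_eq_0_iff not_le)
  ultimately have "(\<integral>\<^sup>+x. f (T x) \<partial>lborel_Pi K) = (\<integral>\<^sup>+y. f y \<partial>lborel_Pi I)"
    by (metis mult_divide_eq_ennreal)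
  then show ?thesis by (simp add: T_def)
qed

section \<open>Sections of the orthant\<close>

lemma has_bochner_integral_power_exp:
  "has_bochner_integral lborel (\<lambda>x::real. indicator {0..} x * (x ^ k * exp (- x))) (fact k)"
proof (rule has_bochner_integral_nn_integral)
  have "(\<integral>\<^sup>+x. ennreal (indicator {0..} x * (x ^ k * exp (- x))) \<partial>lborel) = (\<integral>\<^sup>+x. ennreal (x ^ k * exp (- x)) * indicator {0 ..} x \<partial>lborel)"
    by (intro nn_integral_cong) (simp add: indicator_def)
  also have "\<dots> = ennreal (fact k)" by (simp add: nn_intergal_power_times_exp_Ici)
  finally show "(\<integral>\<^sup>+x. ennreal (indicator {0..} x * (x ^ k * exp (- x))) \<partial>lborel) = ennreal (fact k)" .
qed (auto simp: indicator_def)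

text \<open>
  The integrand is minorised by \<open>exp y \<ge> 1 + y\<close> at \<open>exp (1 - x / z)\<close>: the exponential density with mean
  \<open>z\<close>, against which the linear term \<open>w * (x - z)\<close> integrates to zero.
\<close>

lemma nn_integral_gaussian_tilt_ge:
  fixes z w \<delta> :: real
  assumes z: "0 < z"
  shows "ennreal (exp (- w * z) * (exp 1 * z * (1 - 2 * \<delta> * z\<^sup>2)))
    \<le> (\<integral>\<^sup>+x. indicator {0..} x * ennreal (exp (- w * x - \<delta> * x\<^sup>2)) \<partial>lborel)"
proof -
  \<comment> \<open>Rescaling to z = 1: these are the linear and the quadratic term of the exponent
    at x = z.\<close>
  define a b where "a = w * z" and "b = \<delta> * z\<^sup>2"
  \<comment> \<open>The tangent minorant exp (1 - a) * exp (- y) * (a + (1 - a) * y - b * y^2),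
    split into moments. Their values 0!, 1!, 2! make the terms in a cancel and leave 1 - 2 *
    b.\<close>
  define h where "h y = exp (1 - a) * (a * (indicator {0..} y * (y ^ 0 * exp (- y)))
     + (1 - a) * (indicator {0..} y * (y ^ 1 * exp (- y))) - b * (indicator {0..} y * (y ^ 2 * exp (- y))))" for y :: real
  have "has_bochner_integral lborel h (exp (1 - a) * (a * fact 0 + (1 - a) * fact 1 - b * fact 2))"
    unfolding h_def
    by (intro has_bochner_integral_mult_right has_bochner_integral_add has_bochner_integral_diff
        has_bochner_integral_power_exp)
  then have hb: "has_bochner_integral lborel h (exp (1 - a) * (1 - 2 * b))"
    by (simp add: fact_numeral mult.commute[of b 2])
  let ?f = "\<lambda>y. indicator {0..} y * exp (- a * y - b * y\<^sup>2)"
  have "h y \<le> ?f y" for y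
  proof (cases "0 \<le> y")
    case True
    have "h y = exp (1 - a) * exp (- y) * (1 + (- a * y - b * y\<^sup>2 + a + y - 1))"
      using True by (simp add: h_def algebra_simps)
    also have "\<dots> \<le> exp (1 - a) * exp (- y) * exp (- a * y - b * y\<^sup>2 + a + y - 1)"
      by (intro mult_left_mono exp_ge_add_one_self) simp
    also have "\<dots> = exp (- a * y - b * y\<^sup>2)" by (simp flip: exp_add)
    finally show ?thesis using True by simp
  qed (simp add: h_def)
  then have hf: "ennreal (h y) \<le> ennreal (?f y)" for y by (rule ennreal_leI)
  \<comment> \<open>\<open>h\<close> may be negative; \<open>ennreal\<close> cuts the negative
    values off, which can only increase the integral.\<close>
  have "ennreal (exp (1 - a) * (1 - 2 * b)) \<le> (\<integral>\<^sup>+y. ennreal (h y) \<partial>lborel)"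
  proof (cases "\<integral>\<^sup>+y. ennreal (h y) \<partial>lborel")
    case (real r)
    then have "integral\<^sup>L lborel h \<le> r" by (intro integral_real_bounded) simp_all
    then show ?thesis using hb real by (simp add: has_bochner_integral_iff ennreal_leI)
  qed simp
  also have "\<dots> \<le> (\<integral>\<^sup>+y. ennreal (?f y) \<partial>lborel)" by (intro nn_integral_mono hf)
  finally have 1: "ennreal (exp (1 - a) * (1 - 2 * b)) \<le> (\<integral>\<^sup>+y. ennreal (?f y) \<partial>lborel)" .
  have "(\<integral>\<^sup>+x. indicator {0..} x * ennreal (exp (- w * x - \<delta> * x\<^sup>2)) \<partial>lborel)
    = ennreal z * (\<integral>\<^sup>+y. indicator {0..} (z * y) * ennreal (exp (- w * (z * y) - \<delta> * (z * y)\<^sup>2)) \<partial>lborel)"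
    using z by (subst nn_integral_real_affine[where c = z and t = 0]) auto
  also have "(\<integral>\<^sup>+y. indicator {0..} (z * y) * ennreal (exp (- w * (z * y) - \<delta> * (z * y)\<^sup>2)) \<partial>lborel) = (\<integral>\<^sup>+y. ennreal (?f y) \<partial>lborel)"
    using z by (intro nn_integral_cong) (auto simp: indicator_def a_def b_def zero_le_mult_iff power_mult_distrib mult_ac)
  finally have "ennreal z * ennreal (exp (1 - a) * (1 - 2 * b)) \<le> (\<integral>\<^sup>+x. indicator {0..} x * ennreal (exp (- w * x - \<delta> * x\<^sup>2)) \<partial>lborel)"
    using 1 by (simp add: mult_left_mono)
  also have "ennreal z * ennreal (exp (1 - a) * (1 - 2 * b)) = ennreal (exp (- w * z) * (exp 1 * z * (1 - 2 * \<delta> * z\<^sup>2)))"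
    using z by (simp add: ennreal_mult'[symmetric] a_def b_def exp_diff exp_minus field_simps)
  finally show ?thesis .
qed

lemma nn_integral_exp_mean:
  fixes z :: real
  assumes z: "0 < z"
  shows "(\<integral>\<^sup>+x. indicator {0..} x * ennreal (exp (- x / z)) \<partial>lborel) = ennreal z"
proof -
  have "(\<integral>\<^sup>+x. indicator {0..} x * ennreal (exp (- x / z)) \<partial>lborel)
    = ennreal z * (\<integral>\<^sup>+y. indicator {0..} (z * y) * ennreal (exp (- (z * y) / z)) \<partial>lborel)"
    using z by (subst nn_integral_real_affine[where c = z and t = 0]) auto
  also have "(\<integral>\<^sup>+y. indicator {0..} (z * y) * ennreal (exp (- (z * y) / z)) \<partial>lborel)
    = (\<integral>\<^sup>+x. ennreal (x ^ 0 * exp (- x)) * indicator {0 ..} x \<partial>lborel)"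
    using z by (intro nn_integral_cong) (auto simp: indicator_def zero_le_mult_iff)
  also have "\<dots> = 1" by (subst nn_intergal_power_times_exp_Ici) simp
  finally show ?thesis by simp
qed

text \<open>
  The section of the nonnegative orthant of $\mathbb{R}^I$ by the affine space through \<open>z\<close> spanned by the
  first \<open>d\<close> vectors of an orthonormal basis \<open>u\<close>; \<open>coord\<close> are the coordinates of \<open>z\<close> in that basis.
\<close>

locale orthant_section =
  fixes I :: "'i set" and D d :: nat and u :: "nat \<Rightarrow> 'i \<Rightarrow> real" and z :: "'i \<Rightarrow> real"
  assumes finite_I: "finite I" and card_I: "card I = D" and d_le: "d \<le> D"
    and cols: "\<And>k l. k < D \<Longrightarrow> l < D \<Longrightarrow> (\<Sum>i\<in>I. u k i * u l i) = (if k = l then 1 else 0)"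
    and rows: "\<And>i j. i \<in> I \<Longrightarrow> j \<in> I \<Longrightarrow> (\<Sum>k<D. u k i * u k j) = (if i = j then 1 else 0)"
    and z_pos: "\<And>i. i \<in> I \<Longrightarrow> 0 < z i"
begin

definition point :: "(nat \<Rightarrow> real) \<Rightarrow> 'i \<Rightarrow> real" where
  "point x i = (\<Sum>k<D. x k * u k i)"

definition coord :: "nat \<Rightarrow> real" where
  "coord k = (\<Sum>i\<in>I. z i * u k i)"

definition orthant :: "(nat \<Rightarrow> real) \<Rightarrow> ennreal" where
  "orthant x = (if \<forall>i\<in>I. 0 \<le> point x i then 1 else 0)"

definition section_volume :: ennreal where
  "section_volume = partial_integral orthant (\<lambda>_. 0) (\<lambda>_. 0) d coord"

lemma point_coord: "i \<in> I \<Longrightarrow> point coord i = z i"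
proof -
  assume i: "i \<in> I"
  have "point coord i = (\<Sum>k<D. \<Sum>j\<in>I. z j * (u k j * u k i))"
    unfolding point_def coord_def sum_distrib_right by (simp add: mult.assoc)
  also have "\<dots> = (\<Sum>j\<in>I. z j * (\<Sum>k<D. u k j * u k i))"
    by (subst sum.swap) (simp add: sum_distrib_left)
  also have "\<dots> = (\<Sum>j\<in>I. if j = i then z j else 0)"
    using i by (intro sum.cong refl) (simp add: rows)
  also have "\<dots> = z i" using i finite_I by simp
  finally show ?thesis .
qed

lemma point_convex: "point (\<lambda>k. (1 - \<mu>) * x k + \<mu> * y k) i = (1 - \<mu>) * point x i + \<mu> * point y i"
  by (simp add: point_def sum.distrib sum_distrib_left algebra_simps sum_subtractf)

lemma abs_u_le_1: "k < D \<Longrightarrow> i \<in> I \<Longrightarrow> \<bar>u k i\<bar> \<le> 1"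
proof -
  assume "k < D" "i \<in> I"
  then have "(u k i)\<^sup>2 \<le> (\<Sum>i\<in>I. (u k i)\<^sup>2)"
    using finite_I by (intro member_le_sum) auto
  also have "\<dots> = 1" using cols[OF \<open>k < D\<close> \<open>k < D\<close>] by (simp add: power2_eq_square)
  finally show ?thesis by (simp add: abs_square_le_1)
qed

lemma measurable_point [measurable]: "(\<lambda>x. point x i) \<in> borel_measurable (PiM UNIV (\<lambda>_. borel))"
  unfolding point_def by measurable

lemma measurable_orthant [measurable]: "orthant \<in> borel_measurable (PiM UNIV (\<lambda>_. borel))"
proof -
  have "{x \<in> space (PiM UNIV (\<lambda>_. borel)). \<forall>i\<in>I. 0 \<le> point x i} \<in> sets (PiM UNIV (\<lambda>_. borel :: real measure))"
    using finite_I by measurable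
  then show ?thesis unfolding orthant_def[abs_def] by (intro measurable_If) auto
qed

lemma log_concave_orthant: "log_concave orthant"
  unfolding log_concave_def
proof (intro allI impI)
  fix x y :: "nat \<Rightarrow> real" and \<mu> a b :: real
  assume \<mu>: "0 < \<mu>" "\<mu> < 1" and ab: "0 < a" "0 < b" "ennreal a \<le> orthant x" "ennreal b \<le> orthant y"
  have le1: "c \<le> 1" "\<forall>i\<in>I. 0 \<le> point w i" if "0 < c" "ennreal c \<le> orthant w" for c w
    using that by (auto simp: orthant_def ennreal_eq_0_iff split: if_splits simp flip: ennreal_1)
  have "a powr (1 - \<mu>) \<le> 1" "b powr \<mu> \<le> 1"
    using le1[OF ab(1,3)] le1[OF ab(2,4)] ab \<mu> by (auto intro!: powr_le1)
  then have "a powr (1 - \<mu>) * b powr \<mu> \<le> 1" using mult_mono[of "a powr (1 - \<mu>)" 1 "b powr \<mu>" 1] by simp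
  moreover have "\<forall>i\<in>I. 0 \<le> point (\<lambda>k. (1 - \<mu>) * x k + \<mu> * y k) i"
    unfolding point_convex using le1[OF ab(1,3)] le1[OF ab(2,4)] \<mu> by auto
  ultimately show "ennreal (a powr (1 - \<mu>) * b powr \<mu>) \<le> orthant (\<lambda>i. (1 - \<mu>) * x i + \<mu> * y i)"
    by (simp add: orthant_def flip: ennreal_1)
qed

lemma positive_near_orthant: "positive_near coord orthant"
proof -
  \<comment> \<open>A common lower bound of the entries of \<open>z\<close>. As basis entries are at
    most 1 in absolute value, changing each coordinate by less than c / (D + 1) moves an entry by at
    most c; the \<open>+ 1\<close> covers D = 0.\<close>
  obtain c where c: "0 < c" "\<And>i. i \<in> I \<Longrightarrow> c \<le> z i"
  proof (cases "I = {}")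
    case False
    then have "Min (z ` I) \<in> z ` I" using finite_I by (intro Min_in) auto
    with z_pos finite_I show ?thesis by (intro that[of "Min (z ` I)"]) auto
  qed (use that[of 1] in auto)
  have "0 < orthant x" if x: "\<forall>k. \<bar>x k - coord k\<bar> < c / (real D + 1)" for x
  proof -
    have "0 \<le> point x i" if i: "i \<in> I" for i
    proof -
      have "\<bar>point x i - point coord i\<bar> = \<bar>\<Sum>k<D. (x k - coord k) * u k i\<bar>"
        by (simp add: point_def left_diff_distrib sum_subtractf)
      also have "\<dots> \<le> (\<Sum>k<D. \<bar>(x k - coord k) * u k i\<bar>)" by (rule sum_abs)
      also have "\<dots> \<le> (\<Sum>k<D. c / (real D + 1))"
      proof (rule sum_mono)
        fix k assume "k \<in> {..<D}"
        then have "\<bar>x k - coord k\<bar> * \<bar>u k i\<bar> \<le> c / (real D + 1) * 1"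
          using x i c by (intro mult_mono) (auto intro: less_imp_le abs_u_le_1)
        then show "\<bar>(x k - coord k) * u k i\<bar> \<le> c / (real D + 1)" by (simp add: abs_mult)
      qed
      also have "\<dots> \<le> c" using c by (simp add: field_simps)
      also have "\<dots> \<le> z i" using c i by simp
      finally show ?thesis using point_coord[OF i] by linarith
    qed
    then show ?thesis by (simp add: orthant_def)
  qed
  then show ?thesis
    using c unfolding positive_near_def by (intro exI[of _ "c / (real D + 1)"]) auto
qed

text \<open>The slopes \<open>v\<close> in basis coordinates become slopes \<open>w\<close> of the
  single entries, and the tilted integral over the orthant factors over the entries. The value of
  the tilt at \<open>z\<close> occurs on both sides and cancels.\<close>

theorem section_volume_ge:
  assumes V: "section_volume \<le> ennreal V" and \<delta>: "0 < \<delta>" and small: "\<And>i. i \<in> I \<Longrightarrow> 2 * \<delta> * (z i)\<^sup>2 \<le> 1"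
  shows "(\<Prod>i\<in>I. z i) * exp (real D) * (\<Prod>i\<in>I. 1 - 2 * \<delta> * (z i)\<^sup>2) \<le> V * sqrt (pi / \<delta>) ^ (D - d)"
proof -
  let ?\<delta> = "\<lambda>k. if k < d then 0 else \<delta>"
  obtain v where v0: "\<And>k. k < d \<Longrightarrow> v k = 0" and
    v: "partial_integral orthant v ?\<delta> D coord \<le> ennreal (V * (\<Prod>k\<in>{d..<D}. exp (- v k * coord k) * sqrt (pi / \<delta>)))"
    using tilted_integral_bound[OF measurable_orthant log_concave_orthant positive_near_orthant d_le \<delta>, of V] V
    unfolding section_volume_def by blast
  define w where "w i = (\<Sum>k<D. v k * u k i)" for i
  \<comment> \<open>All coordinates are damped, since it is the full squared norm that splits over
    the entries. The partial integral damps only those from \<open>d\<close> on, so \<open>g\<close>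
    is the smaller integrand.\<close>
  define g where "g X = (\<Prod>i\<in>I. indicator {0..} (X i) * ennreal (exp (- w i * X i - \<delta> * (X i)\<^sup>2)))" for X
  have [measurable]: "g \<in> borel_measurable (lborel_Pi I)"
    unfolding g_def[abs_def] by measurable
  have g_le: "g (\<lambda>i\<in>I. \<Sum>k<D. y k * u k i) \<le> orthant (\<lambda>i. if i < D then y i else coord i) *
     (\<Prod>k<D. ennreal (exp (- v k * y k - ?\<delta> k * (y k)\<^sup>2)))" for y
  proof (cases "\<forall>i\<in>I. 0 \<le> point y i")
    case True
    have pt: "point (\<lambda>i. if i < D then y i else coord i) = point y"
      by (auto simp: point_def fun_eq_iff intro!: sum.cong)
    then have orth: "orthant (\<lambda>i. if i < D then y i else coord i) = 1"
      using True by (simp add: orthant_def)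
    have "g (\<lambda>i\<in>I. \<Sum>k<D. y k * u k i) = (\<Prod>i\<in>I. ennreal (exp (- w i * point y i - \<delta> * (point y i)\<^sup>2)))"
      unfolding g_def using True by (intro prod.cong) (auto simp: point_def)
    also have "\<dots> = ennreal (exp (- (\<Sum>i\<in>I. w i * point y i) - \<delta> * (\<Sum>i\<in>I. point y i * point y i)))"
      using finite_I by (simp add: prod_ennreal exp_sum[symmetric] sum_subtractf sum_distrib_left sum_negf power2_eq_square)
    also have "(\<Sum>i\<in>I. w i * point y i) = (\<Sum>k<D. v k * y k)"
      unfolding w_def point_def using cols by (intro sum_products_orthonormal) auto
    also have "(\<Sum>i\<in>I. point y i * point y i) = (\<Sum>k<D. y k * y k)"
      unfolding point_def using cols by (intro sum_products_orthonormal) auto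
    also have "ennreal (exp (- (\<Sum>k<D. v k * y k) - \<delta> * (\<Sum>k<D. y k * y k)))
        \<le> ennreal (exp (\<Sum>k<D. - v k * y k - ?\<delta> k * (y k)\<^sup>2))"
    proof -
      have "- (\<Sum>k<D. v k * y k) - \<delta> * (\<Sum>k<D. y k * y k) = (\<Sum>k<D. - v k * y k - \<delta> * (y k)\<^sup>2)"
        by (simp add: sum_subtractf sum_distrib_left sum_negf power2_eq_square)
      also have "\<dots> \<le> (\<Sum>k<D. - v k * y k - ?\<delta> k * (y k)\<^sup>2)"
        using \<delta> by (intro sum_mono) auto
      finally show ?thesis by (intro ennreal_leI) simp
    qed
    also have "\<dots> = (\<Prod>k<D. ennreal (exp (- v k * y k - ?\<delta> k * (y k)\<^sup>2)))"
      by (simp add: prod_ennreal exp_sum)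
    finally show ?thesis using orth by (simp only: mult_1)
  next
    case False
    then obtain i where "i \<in> I" "point y i < 0" by (auto simp: not_le)
    then have "g (\<lambda>i\<in>I. \<Sum>k<D. y k * u k i) = 0"
      unfolding g_def using finite_I by (intro prod_zero bexI[of _ i]) (auto simp: point_def)
    then show ?thesis by simp
  qed
  have wz: "(\<Sum>i\<in>I. w i * z i) = (\<Sum>k\<in>{d..<D}. v k * coord k)"
  proof -
    have "(\<Sum>i\<in>I. w i * z i) = (\<Sum>i\<in>I. w i * point coord i)" by (simp add: point_coord)
    also have "\<dots> = (\<Sum>k<D. v k * coord k)"
      unfolding w_def point_def using cols by (intro sum_products_orthonormal) auto
    also have "\<dots> = (\<Sum>k\<in>{d..<D}. v k * coord k)"
      using v0 by (intro sum.mono_neutral_right) auto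
    finally show ?thesis .
  qed
  have "(\<Prod>i\<in>I. exp (- w i * z i) * (exp 1 * z i * (1 - 2 * \<delta> * (z i)\<^sup>2)))
     = (\<Prod>i\<in>I. exp (- w i * z i)) * ((\<Prod>i\<in>I. exp 1) * (\<Prod>i\<in>I. z i) * (\<Prod>i\<in>I. 1 - 2 * \<delta> * (z i)\<^sup>2))"
    by (simp add: prod.distrib)
  also have "(\<Prod>i\<in>I. exp (1::real)) = exp (real D)" by (simp add: card_I flip: exp_of_nat_mult)
  also have "(\<Prod>i\<in>I. exp (- w i * z i)) = exp (- (\<Sum>k\<in>{d..<D}. v k * coord k))"
    using finite_I by (simp add: exp_sum[symmetric] wz[symmetric] sum_negf)
  finally have lhs: "(\<Prod>i\<in>I. exp (- w i * z i) * (exp 1 * z i * (1 - 2 * \<delta> * (z i)\<^sup>2)))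
    = exp (- (\<Sum>k\<in>{d..<D}. v k * coord k)) * ((\<Prod>i\<in>I. z i) * exp (real D) * (\<Prod>i\<in>I. 1 - 2 * \<delta> * (z i)\<^sup>2))"
    by (simp add: mult_ac)
  have "ennreal (\<Prod>i\<in>I. exp (- w i * z i) * (exp 1 * z i * (1 - 2 * \<delta> * (z i)\<^sup>2)))
    = (\<Prod>i\<in>I. ennreal (exp (- w i * z i) * (exp 1 * z i * (1 - 2 * \<delta> * (z i)\<^sup>2))))"
    using small z_pos by (intro prod_ennreal[symmetric] mult_nonneg_nonneg) (auto simp: less_imp_le)
  also have "\<dots> \<le> (\<Prod>i\<in>I. (\<integral>\<^sup>+x. indicator {0..} x * ennreal (exp (- w i * x - \<delta> * x\<^sup>2)) \<partial>lborel))"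
    using z_pos by (intro prod_mono_ennreal nn_integral_gaussian_tilt_ge) auto
  also have "\<dots> = (\<integral>\<^sup>+X. g X \<partial>lborel_Pi I)"
    unfolding g_def using finite_I by (subst lborel_Pi.product_nn_integral_prod) auto
  also have "\<dots> = (\<integral>\<^sup>+y. g (\<lambda>i\<in>I. \<Sum>k<D. y k * u k i) \<partial>lborel_Pi {..<D})"
    using finite_I cols rows by (intro nn_integral_lborel_Pi_orthogonal[symmetric]) auto
  also have "\<dots> \<le> partial_integral orthant v ?\<delta> D coord"
    unfolding partial_integral_def by (intro nn_integral_mono g_le)
  also note v
  also have "V * (\<Prod>k\<in>{d..<D}. exp (- v k * coord k) * sqrt (pi / \<delta>))
    = exp (- (\<Sum>k\<in>{d..<D}. v k * coord k)) * (V * sqrt (pi / \<delta>) ^ (D - d))"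
    by (simp add: prod.distrib exp_sum[symmetric] sum_negf)
  finally have fin: "ennreal (exp (- (\<Sum>k\<in>{d..<D}. v k * coord k)) * ((\<Prod>i\<in>I. z i) * exp (real D) * (\<Prod>i\<in>I. 1 - 2 * \<delta> * (z i)\<^sup>2)))
    \<le> ennreal (exp (- (\<Sum>k\<in>{d..<D}. v k * coord k)) * (V * sqrt (pi / \<delta>) ^ (D - d)))"
    unfolding lhs .
  have L0: "0 \<le> (\<Prod>i\<in>I. z i) * exp (real D) * (\<Prod>i\<in>I. 1 - 2 * \<delta> * (z i)\<^sup>2)"
    using small z_pos by (intro mult_nonneg_nonneg prod_nonneg) (auto simp: less_imp_le)
  show ?thesis
  proof (cases "0 \<le> V * sqrt (pi / \<delta>) ^ (D - d)")
    case True
    then show ?thesis using fin L0 by (simp add: ennreal_le_iff)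
  next
    \<comment> \<open>A negative V would force volume zero, but the section contains a neighbourhood
      of \<open>z\<close> and has positive volume.\<close>
    case False
    moreover have "0 \<le> sqrt (pi / \<delta>) ^ (D - d)" using \<delta> by simp
    ultimately have "V < 0" by (metis mult_nonneg_nonneg not_le)
    then have "section_volume = 0" using V by (simp add: ennreal_neg)
    moreover have "0 < section_volume"
      using partial_integral_log_concave[OF measurable_orthant log_concave_orthant positive_near_orthant, of "\<lambda>_. 0" "\<lambda>_. 0" d]
      unfolding section_volume_def positive_near_def by auto
    ultimately show ?thesis by simp
  qed
qed

text \<open>
  The convex combinations of a point of the section through \<open>z\<close> with \<open>z\<close> plus a small vector orthogonal to
  the section stay in the orthant, so that no nearby parallel section is much smaller.
\<close>

theorem section_volume_le:
  assumes opt: "\<And>x. (\<And>k. d \<le> k \<Longrightarrow> x k = coord k) \<Longrightarrow> (\<And>i. i \<in> I \<Longrightarrow> 0 \<le> point x i) \<Longrightarrow> (\<Sum>i\<in>I. point x i / z i) \<le> real D"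
    and \<epsilon>: "0 < \<epsilon>" "\<epsilon> < 1" and \<eta>: "0 < \<eta>" and small: "\<And>i. i \<in> I \<Longrightarrow> real (D - d) * \<eta> \<le> z i"
  shows "section_volume * ennreal ((1 - \<epsilon>) ^ d * (2 * \<epsilon> * \<eta>) ^ (D - d) * exp (- (1 + \<epsilon>) * real D)) \<le> ennreal (\<Prod>i\<in>I. z i)"
proof -
  let ?K = "{..<d}" and ?J = "{d..<D}"
  have KJ: "?K \<inter> ?J = {}" "?K \<union> ?J = {..<D}" using d_le by auto
  define g where "g X = (\<Prod>i\<in>I. indicator {0..} (X i) * ennreal (exp (- X i / z i)))" for X :: "'i \<Rightarrow> real"
  define \<phi> where "\<phi> y = g (\<lambda>i\<in>I. \<Sum>k<D. y k * u k i)" for y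
  have [measurable]: "g \<in> borel_measurable (lborel_Pi I)"
    unfolding g_def[abs_def] by measurable
  have [measurable]: "\<phi> \<in> borel_measurable (lborel_Pi {..<D})"
    unfolding \<phi>_def[abs_def] by measurable
  have \<phi>_eq: "\<phi> y = orthant y * ennreal (exp (- (\<Sum>i\<in>I. point y i / z i)))" for y
  proof (cases "\<forall>i\<in>I. 0 \<le> point y i")
    case True
    then have "\<phi> y = (\<Prod>i\<in>I. ennreal (exp (- point y i / z i)))"
      unfolding \<phi>_def g_def by (intro prod.cong) (auto simp: point_def)
    also have "\<dots> = ennreal (exp (- (\<Sum>i\<in>I. point y i / z i)))"
      using finite_I by (simp add: prod_ennreal exp_sum[symmetric] sum_negf)
    finally show ?thesis using True by (simp add: orthant_def)
  next
    case False
    then obtain i where "i \<in> I" "point y i < 0" by (auto simp: not_le)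
    then have "\<phi> y = 0"
      unfolding \<phi>_def g_def using finite_I by (intro prod_zero bexI[of _ i]) (auto simp: point_def)
    then show ?thesis using False by (simp add: orthant_def)
  qed
  \<comment> \<open>Half-width \<epsilon> * \<eta>: a displacement of size \<eta> enters the convex
    combination with weight \<epsilon>.\<close>
  define box where "box = Pi\<^sub>E ?J (\<lambda>k. {coord k - \<epsilon> * \<eta> .. coord k + \<epsilon> * \<eta>})"
  define c where "c = exp (- (1 + \<epsilon>) * real D)"
  define S where "S t = (\<lambda>k. if k < d then t k else coord k)" for t :: "nat \<Rightarrow> real"
  have key: "orthant (S t) * ennreal c \<le> \<phi> (merge ?K ?J (\<lambda>k\<in>?K. \<epsilon> * coord k + (1 - \<epsilon>) * t k, r))"
    if r: "r \<in> box" for r t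
  proof (cases "\<forall>i\<in>I. 0 \<le> point (S t) i")
    case True
    \<comment> \<open>The displacement of \<open>r\<close> from the section, blown up by 1 /
      \<epsilon>: the new point is 1 - \<epsilon> times the section point plus \<epsilon> times
      \<open>z\<close> moved by \<sigma>. The entries of that move are at most (D - d) * \<eta>,
      hence at most those of \<open>z\<close>.\<close>
    define \<sigma> where "\<sigma> k = (if k \<in> ?J then (r k - coord k) / \<epsilon> else 0)" for k
    define y where "y = merge ?K ?J (\<lambda>k\<in>?K. \<epsilon> * coord k + (1 - \<epsilon>) * t k, r)"
    have y_eq: "y k = (1 - \<epsilon>) * S t k + \<epsilon> * (coord k + \<sigma> k)" if "k < D" for k
      using that \<epsilon> by (auto simp: y_def merge_def S_def \<sigma>_def algebra_simps diff_divide_distrib)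
    have pt: "point y i = (1 - \<epsilon>) * point (S t) i + \<epsilon> * (z i + point \<sigma> i)" if "i \<in> I" for i
    proof -
      have "point y i = (\<Sum>k<D. ((1 - \<epsilon>) * S t k + \<epsilon> * (coord k + \<sigma> k)) * u k i)"
        unfolding point_def by (intro sum.cong refl) (simp add: y_eq)
      also have "\<dots> = (1 - \<epsilon>) * point (S t) i + \<epsilon> * (point coord i + point \<sigma> i)"
        by (simp add: point_def sum.distrib sum_distrib_left algebra_simps sum_subtractf)
      finally show ?thesis using point_coord[OF that] by simp
    qed
    have \<sigma>_small: "\<bar>point \<sigma> i\<bar> \<le> z i" if i: "i \<in> I" for i
    proof -
      have "point \<sigma> i = (\<Sum>k\<in>?J. \<sigma> k * u k i)"
        unfolding point_def by (rule sum.mono_neutral_right) (auto simp: \<sigma>_def)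
      then have "\<bar>point \<sigma> i\<bar> \<le> (\<Sum>k\<in>?J. \<bar>\<sigma> k * u k i\<bar>)" by (simp add: sum_abs)
      also have "\<dots> \<le> (\<Sum>k\<in>?J. \<eta>)"
      proof (rule sum_mono)
        fix k assume k: "k \<in> ?J"
        then have "r k \<in> {coord k - \<epsilon> * \<eta> .. coord k + \<epsilon> * \<eta>}" using r unfolding box_def by (auto dest: PiE_mem)
        then have "\<bar>r k - coord k\<bar> \<le> \<eta> * \<epsilon>" by (auto simp: mult.commute)
        then have "\<bar>\<sigma> k\<bar> \<le> \<eta>" using k \<epsilon> by (simp add: \<sigma>_def pos_divide_le_eq)
        then have "\<bar>\<sigma> k\<bar> * \<bar>u k i\<bar> \<le> \<eta> * 1" using k i \<eta> by (intro mult_mono abs_u_le_1) auto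
        then show "\<bar>\<sigma> k * u k i\<bar> \<le> \<eta>" by (simp add: abs_mult)
      qed
      also have "\<dots> \<le> z i" using small[OF i] by simp
      finally show ?thesis .
    qed
    have nonneg: "\<forall>i\<in>I. 0 \<le> point y i"
    proof
      fix i assume i: "i \<in> I"
      then have "0 \<le> z i + point \<sigma> i" using \<sigma>_small[of i] by (simp add: abs_le_iff)
      then show "0 \<le> point y i"
        unfolding pt[OF i] using True i \<epsilon> add_nonneg_nonneg[OF mult_nonneg_nonneg mult_nonneg_nonneg] by auto
    qed
    \<comment> \<open>The moved \<open>z\<close> is at most 2 * z entrywise. Together with the
      optimality condition the sum over the entries is at most (1 - \<epsilon>) * D + 2 * \<epsilon>
      * D.\<close>
    have "point y i / z i \<le> (1 - \<epsilon>) * (point (S t) i / z i) + 2 * \<epsilon>" if i: "i \<in> I" for i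
    proof -
      have "point y i \<le> (1 - \<epsilon>) * point (S t) i + \<epsilon> * (2 * z i)"
        unfolding pt[OF i] using \<sigma>_small[OF i] \<epsilon> by (intro add_left_mono mult_left_mono) auto
      then have "point y i / z i \<le> ((1 - \<epsilon>) * point (S t) i + \<epsilon> * (2 * z i)) / z i"
        using z_pos[OF i] by (intro divide_right_mono) auto
      also have "\<dots> = (1 - \<epsilon>) * (point (S t) i / z i) + 2 * \<epsilon>"
        using z_pos[OF i] by (simp add: add_divide_distrib)
      finally show ?thesis .
    qed
    then have "(\<Sum>i\<in>I. point y i / z i) \<le> (\<Sum>i\<in>I. (1 - \<epsilon>) * (point (S t) i / z i) + 2 * \<epsilon>)"
      by (rule sum_mono)
    also have "\<dots> = (1 - \<epsilon>) * (\<Sum>i\<in>I. point (S t) i / z i) + 2 * \<epsilon> * real D"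
      by (simp add: sum.distrib sum_distrib_left card_I)
    also have "\<dots> \<le> (1 - \<epsilon>) * real D + 2 * \<epsilon> * real D"
      using \<epsilon> True by (intro add_right_mono mult_left_mono opt) (auto simp: S_def)
    also have "\<dots> = (1 + \<epsilon>) * real D" by (simp add: algebra_simps)
    finally have "c \<le> exp (- (\<Sum>i\<in>I. point y i / z i))" by (simp add: c_def algebra_simps)
    then show ?thesis
      using nonneg True unfolding \<phi>_eq y_def[symmetric] by (simp add: orthant_def ennreal_leI)
  next
    case False
    then have "orthant (S t) = 0" by (simp add: orthant_def)
    then show ?thesis by simp
  qed
  have box_sets [measurable]: "box \<in> sets (lborel_Pi ?J)"
    unfolding box_def by (intro sets_PiM_I_finite) auto
  have slice_meas [measurable]: "(\<lambda>t. \<phi> (merge ?K ?J (t, r))) \<in> borel_measurable (lborel_Pi ?K)"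
    if "r \<in> space (lborel_Pi ?J)" for r
  proof -
    have "(\<lambda>t. merge ?K ?J (t, r)) \<in> measurable (lborel_Pi ?K) (lborel_Pi (?K \<union> ?J))"
      using that by measurable
    then show ?thesis unfolding KJ(2) by (rule measurable_compose) measurable
  qed
  have inner: "section_volume * ennreal ((1 - \<epsilon>) ^ d * c) * indicator box r \<le> (\<integral>\<^sup>+t. \<phi> (merge ?K ?J (t, r)) \<partial>lborel_Pi ?K)"
    if r: "r \<in> space (lborel_Pi ?J)" for r
  proof (cases "r \<in> box")
    case True
    have S: "(\<lambda>t. S t) \<in> measurable (lborel_Pi ?K) (PiM UNIV (\<lambda>_. borel))"
    proof (rule measurable_PiM_single')
      show "(\<lambda>t. S t k) \<in> borel_measurable (lborel_Pi ?K)" for k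
        unfolding S_def by (cases "k < d") auto
    qed auto
    have [measurable]: "(\<lambda>t. orthant (S t)) \<in> borel_measurable (lborel_Pi ?K)"
      by (rule measurable_compose[OF S measurable_orthant])
    have "section_volume = (\<integral>\<^sup>+t. orthant (S t) \<partial>lborel_Pi ?K)"
      by (simp add: section_volume_def partial_integral_def S_def)
    then have "section_volume * ennreal c = (\<integral>\<^sup>+t. orthant (S t) * ennreal c \<partial>lborel_Pi ?K)"
      by (simp add: nn_integral_multc)
    also have "\<dots> \<le> (\<integral>\<^sup>+t. \<phi> (merge ?K ?J (\<lambda>k\<in>?K. \<epsilon> * coord k + (1 - \<epsilon>) * t k, r)) \<partial>lborel_Pi ?K)"
      by (intro nn_integral_mono key True)
    finally have "ennreal ((1 - \<epsilon>) ^ d) * (section_volume * ennreal c)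
      \<le> ennreal ((1 - \<epsilon>) ^ d) * (\<integral>\<^sup>+t. \<phi> (merge ?K ?J (\<lambda>k\<in>?K. \<epsilon> * coord k + (1 - \<epsilon>) * t k, r)) \<partial>lborel_Pi ?K)"
      by (rule mult_left_mono) simp
    \<comment> \<open>Contracting the section towards \<open>z\<close> has Jacobian (1 -
      \<epsilon>)^d.\<close>
    also have "\<dots> = (\<integral>\<^sup>+t. \<phi> (merge ?K ?J (t, r)) \<partial>lborel_Pi ?K)"
      using nn_integral_lborel_Pi_affine[of ?K "1 - \<epsilon>" "\<lambda>t. \<phi> (merge ?K ?J (t, r))" "\<lambda>k. \<epsilon> * coord k"] \<epsilon> slice_meas[OF r]
      by simp
    finally show ?thesis using True \<epsilon> by (simp add: c_def ennreal_mult mult_ac)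
  qed simp
  have "section_volume * ennreal ((1 - \<epsilon>) ^ d * c) * emeasure (lborel_Pi ?J) box
    = (\<integral>\<^sup>+r. section_volume * ennreal ((1 - \<epsilon>) ^ d * c) * indicator box r \<partial>lborel_Pi ?J)"
    by (simp add: nn_integral_cmult_indicator)
  also have "\<dots> \<le> (\<integral>\<^sup>+r. (\<integral>\<^sup>+t. \<phi> (merge ?K ?J (t, r)) \<partial>lborel_Pi ?K) \<partial>lborel_Pi ?J)"
    by (intro nn_integral_mono inner)
  also have "\<dots> = (\<integral>\<^sup>+t. (\<integral>\<^sup>+r. \<phi> (merge ?K ?J (t, r)) \<partial>lborel_Pi ?J) \<partial>lborel_Pi ?K)"
  proof -
    interpret K: sigma_finite_measure "lborel_Pi ?K" by (rule sigma_finite_lborel_Pi) simp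
    interpret J: sigma_finite_measure "lborel_Pi ?J" by (rule sigma_finite_lborel_Pi) simp
    interpret pair_sigma_finite "lborel_Pi ?K" "lborel_Pi ?J" ..
    have "(\<lambda>p. \<phi> (merge ?K ?J p)) \<in> borel_measurable (lborel_Pi ?K \<Otimes>\<^sub>M lborel_Pi ?J)"
      by (rule measurable_compose[OF measurable_merge]) (simp add: KJ)
    then show ?thesis by (intro Fubini') (simp add: case_prod_beta)
  qed
  also have "\<dots> = (\<integral>\<^sup>+y. \<phi> y \<partial>lborel_Pi {..<D})"
    using lborel_Pi.product_nn_integral_fold[OF KJ(1), of \<phi>] by (simp add: KJ)
  also have "\<dots> = (\<integral>\<^sup>+X. g X \<partial>lborel_Pi I)"
    unfolding \<phi>_def using finite_I cols rows by (intro nn_integral_lborel_Pi_orthogonal) auto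
  also have "\<dots> = (\<Prod>i\<in>I. (\<integral>\<^sup>+x. indicator {0..} x * ennreal (exp (- x / z i)) \<partial>lborel))"
    unfolding g_def using finite_I by (subst lborel_Pi.product_nn_integral_prod) auto
  also have "\<dots> = (\<Prod>i\<in>I. ennreal (z i))"
    by (intro prod.cong refl nn_integral_exp_mean z_pos)
  also have "\<dots> = ennreal (\<Prod>i\<in>I. z i)"
    using z_pos by (simp add: prod_ennreal less_imp_le)
  also have "emeasure (lborel_Pi ?J) box = ennreal ((2 * \<epsilon> * \<eta>) ^ (D - d))"
    unfolding box_def using \<epsilon> \<eta> by (subst lborel_Pi.emeasure_PiM) (auto simp: ennreal_power mult_ac)
  finally show ?thesis
    using \<epsilon> \<eta> by (simp add: c_def mult.assoc mult.commute mult.left_commute flip: ennreal_mult)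
qed

end

section \<open>An orthonormal basis adapted to the margins\<close>

text \<open>The Helmert matrix: row 0 is constant, row k contrasts entry k with the entries before
  it. It is an explicit orthogonal matrix whose rows other than 0 sum to zero.\<close>

definition helmert :: "nat \<Rightarrow> nat \<Rightarrow> nat \<Rightarrow> real" where
  "helmert m k i = (if k = 0 then 1 / sqrt (real m)
     else if i < k then 1 / sqrt (real k * (real k + 1))
     else if i = k then - real k / sqrt (real k * (real k + 1)) else 0)"

text \<open>Rows from 1 on do not depend on the first parameter, so a higher dimension only appends
  a row, and 1 / (K * (K + 1)) = 1 / K - 1 / (K + 1) telescopes. The deficit 1 / (m + 1) is the
  share of the constant row.\<close>

lemma helmert_rows_aux:
  "i < Suc m \<Longrightarrow> j < Suc m \<Longrightarrow>
    (\<Sum>k\<in>{1..<Suc m}. helmert m' k i * helmert m' k j) = (if i = j then 1 else 0) - 1 / real (Suc m)"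
proof (induction m arbitrary: i j)
  case (Suc m)
  define K where "K = real (Suc m)"
  have K: "0 < K" "real (Suc (Suc m)) = K + 1" by (simp_all add: K_def)
  have sq: "sqrt (K * (K + 1)) * sqrt (K * (K + 1)) = K * (K + 1)" using K by simp
  have split: "(\<Sum>k\<in>{1..<Suc (Suc m)}. helmert m' k i * helmert m' k j)
    = (\<Sum>k\<in>{1..<Suc m}. helmert m' k i * helmert m' k j) + helmert m' (Suc m) i * helmert m' (Suc m) j"
    by (subst sum.atLeastLessThan_Suc) simp_all
  have zero: "(\<Sum>k\<in>{1..<Suc m}. helmert m' k a * helmert m' k b) = 0" if "a = Suc m \<or> b = Suc m" for a b
    using that by (intro sum.neutral) (auto simp: helmert_def)
  have row: "helmert m' (Suc m) a = (if a \<le> m then 1 else - K) / sqrt (K * (K + 1))" if "a < Suc (Suc m)" for a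
    using that by (auto simp: helmert_def K_def)
  have new: "helmert m' (Suc m) i * helmert m' (Suc m) j = (if i \<le> m then 1 else - K) * (if j \<le> m then 1 else - K) / (K * (K + 1))"
    unfolding row[OF Suc.prems(1)] row[OF Suc.prems(2)] times_divide_times_eq sq ..
  have nz: "K \<noteq> 0" "K + 1 \<noteq> 0" using K(1) by simp_all
  have frac: "1 / (K * (K + 1)) = 1 / K - 1 / (K + 1)"
    using nz by (simp add: divide_simps)
  have "K * K / (K * (K + 1)) = K / (K + 1)" using nz by simp
  also have "\<dots> = 1 - 1 / (K + 1)" using nz by (simp add: divide_simps)
  finally have frac': "K / (K * (K + 1)) = 1 / (K + 1)" "K * K / (K * (K + 1)) = 1 - 1 / (K + 1)"
    using nz by simp_all
  consider "i < Suc m" "j < Suc m" | "i = Suc m" "j < Suc m" | "i < Suc m" "j = Suc m" | "i = Suc m" "j = Suc m"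
    using Suc.prems by (auto simp: less_Suc_eq)
  then show ?case
  proof cases
    case 1
    then show ?thesis unfolding split new K(2) Suc.IH[OF 1] K_def[symmetric] using frac frac' by simp
  next
    case 2
    then have "i \<noteq> j" "\<not> i \<le> m" "j \<le> m" by auto
    then show ?thesis unfolding split new K(2) zero[OF disjI1[OF 2(1)]] using frac frac' by simp
  next
    case 3
    then have "i \<noteq> j" "i \<le> m" "\<not> j \<le> m" by auto
    then show ?thesis unfolding split new K(2) zero[OF disjI2[OF 3(2)]] using frac frac' by simp
  next
    case 4
    then have "i = j" "\<not> i \<le> m" "\<not> j \<le> m" by auto
    then show ?thesis unfolding split new K(2) zero[OF disjI1[OF 4(1)]] using frac frac' by simp
  qed
qed simp

lemma helmert_rows:
  assumes "i < m" "j < m"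
  shows "(\<Sum>k<m. helmert m k i * helmert m k j) = (if i = j then 1 else 0)"
proof -
  obtain m' where m: "m = Suc m'" using assms by (cases m) auto
  have "(\<Sum>k<m. helmert m k i * helmert m k j) = helmert m 0 i * helmert m 0 j + (\<Sum>k\<in>{1..<m}. helmert m k i * helmert m k j)"
    unfolding m by (subst lessThan_atLeast0, subst sum.atLeast_Suc_lessThan) simp_all
  also have "\<dots> = (if i = j then 1 else 0)"
    using helmert_rows_aux[of i m' j m] assms m by (simp add: helmert_def)
  finally show ?thesis .
qed

lemma helmert_sum:
  assumes "0 < k" "k < m"
  shows "(\<Sum>i<m. helmert m k i) = 0"
proof -
  have "(\<Sum>i<m. helmert m k i) = (\<Sum>i<Suc k. helmert m k i)"
    using assms by (intro sum.mono_neutral_right) (auto simp: helmert_def)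
  also have "\<dots> = (\<Sum>i<k. 1 / sqrt (real k * (real k + 1))) - real k / sqrt (real k * (real k + 1))"
    using assms by (simp add: helmert_def)
  finally show ?thesis by simp
qed

lemma helmert_cols_less:
  assumes "k < l" "l < m"
  shows "(\<Sum>i<m. helmert m k i * helmert m l i) = 0"
proof (cases "k = 0")
  case True
  then have "(\<Sum>i<m. helmert m k i * helmert m l i) = 1 / sqrt (real m) * (\<Sum>i<m. helmert m l i)"
    by (simp add: helmert_def sum_distrib_left)
  then show ?thesis using helmert_sum[of l m] assms by simp
next
  case False
  have "(\<Sum>i<m. helmert m k i * helmert m l i) = (\<Sum>i<m. helmert m k i * (1 / sqrt (real l * (real l + 1))))"
    using assms False by (intro sum.cong) (auto simp: helmert_def)
  also have "\<dots> = 0" using helmert_sum[of k m] assms False by (simp flip: sum_distrib_right sum_divide_distrib)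
  finally show ?thesis .
qed

lemma helmert_cols:
  assumes "k < m" "l < m"
  shows "(\<Sum>i<m. helmert m k i * helmert m l i) = (if k = l then 1 else 0)"
proof (cases k l rule: linorder_cases)
  case equal
  show ?thesis
  proof (cases "k = 0")
    case True
    then show ?thesis using equal assms by (simp add: helmert_def)
  next
    case False
    have sq: "sqrt (real k * (real k + 1)) * sqrt (real k * (real k + 1)) = real k * (real k + 1)" by simp
    have "(\<Sum>i<m. helmert m k i * helmert m k i) = (\<Sum>i<Suc k. helmert m k i * helmert m k i)"
      using assms False by (intro sum.mono_neutral_right) (auto simp: helmert_def)
    also have "\<dots> = real k / (real k * (real k + 1)) + real k * real k / (real k * (real k + 1))"
      using False sq by (simp add: helmert_def del: real_sqrt_mult)
    also have "\<dots> = (real k + real k * real k) / (real k * (real k + 1))"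
      by (rule add_divide_distrib[symmetric])
    also have "real k + real k * real k = real k * (real k + 1)"
      by (simp add: distrib_left)
    also have "\<dots> / (real k * (real k + 1)) = 1" using False by simp
    finally show ?thesis using equal by simp
  qed
qed (use helmert_cols_less[of k l m] helmert_cols_less[of l k m] assms in \<open>simp_all add: mult.commute\<close>)

text \<open>The tensor product of two Helmert matrices. The (m - 1) * (n - 1) indices with both
  components positive give a basis of the zero-margin matrices; the other basis matrices depend on
  the row or on the column only.\<close>

definition helmert2 :: "nat \<Rightarrow> nat \<Rightarrow> nat \<times> nat \<Rightarrow> nat \<times> nat \<Rightarrow> real" where
  "helmert2 m n p x = helmert m (fst p) (fst x) * helmert n (snd p) (snd x)"

lemma helmert2_rows:
  assumes "x \<in> {..<m} \<times> {..<n}" "y \<in> {..<m} \<times> {..<n}"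
  shows "(\<Sum>p\<in>{..<m} \<times> {..<n}. helmert2 m n p x * helmert2 m n p y) = (if x = y then 1 else 0)"
proof -
  have "(\<Sum>p\<in>{..<m} \<times> {..<n}. helmert2 m n p x * helmert2 m n p y)
    = (\<Sum>k<m. helmert m k (fst x) * helmert m k (fst y)) * (\<Sum>l<n. helmert n l (snd x) * helmert n l (snd y))"
    by (simp add: helmert2_def sum_product sum.cartesian_product case_prod_beta mult_ac)
  then show ?thesis using assms by (auto simp: helmert_rows prod_eq_iff)
qed

lemma helmert2_cols:
  assumes "p \<in> {..<m} \<times> {..<n}" "q \<in> {..<m} \<times> {..<n}"
  shows "(\<Sum>x\<in>{..<m} \<times> {..<n}. helmert2 m n p x * helmert2 m n q x) = (if p = q then 1 else 0)"
proof -
  have "(\<Sum>x\<in>{..<m} \<times> {..<n}. helmert2 m n p x * helmert2 m n q x)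
    = (\<Sum>i<m. helmert m (fst p) i * helmert m (fst q) i) * (\<Sum>j<n. helmert n (snd p) j * helmert n (snd q) j)"
    by (simp add: helmert2_def sum_product sum.cartesian_product case_prod_beta mult_ac)
  then show ?thesis using assms by (auto simp: helmert_cols prod_eq_iff)
qed

section \<open>Matrices with zero margins\<close>

definition zero_margins :: "nat \<Rightarrow> nat \<Rightarrow> (nat \<times> nat \<Rightarrow> real) \<Rightarrow> bool" where
  "zero_margins m n X \<longleftrightarrow> (\<forall>i<m. (\<Sum>j<n. X (i, j)) = 0) \<and> (\<forall>j<n. (\<Sum>i<m. X (i, j)) = 0)"

lemma zero_margins_helmert2:
  assumes "k \<in> {1..<m}" "l \<in> {1..<n}"
  shows "zero_margins m n (helmert2 m n (k, l))"
  using assms helmert_sum[of k m] helmert_sum[of l n]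
  by (auto simp: zero_margins_def helmert2_def simp flip: sum_distrib_left sum_distrib_right)

text \<open>If one index component is 0, the basis matrix is constant in the corresponding variable,
  and the inner product collapses to margins of X.\<close>

lemma zero_margins_orthogonal:
  assumes X: "zero_margins m n X" and p: "p \<in> {..<m} \<times> {..<n} - {1..<m} \<times> {1..<n}"
  shows "(\<Sum>x\<in>{..<m} \<times> {..<n}. X x * helmert2 m n p x) = 0"
proof -
  obtain k l where kl: "p = (k, l)" "k = 0 \<or> l = 0" using p by (cases p) auto
  from kl(2) show ?thesis
  proof
    assume "k = 0"
    then have "(\<Sum>x\<in>{..<m} \<times> {..<n}. X x * helmert2 m n p x) = (\<Sum>j<n. \<Sum>i<m. X (i, j) * (1 / sqrt (real m) * helmert n l j))"
      by (subst sum.swap) (simp add: kl helmert2_def helmert_def sum.cartesian_product case_prod_beta)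
    also have "\<dots> = 0" using X by (simp add: zero_margins_def flip: sum_distrib_right sum_divide_distrib)
    finally show ?thesis .
  next
    assume "l = 0"
    then have "(\<Sum>x\<in>{..<m} \<times> {..<n}. X x * helmert2 m n p x) = (\<Sum>i<m. \<Sum>j<n. X (i, j) * (helmert m k i * (1 / sqrt (real n))))"
      by (simp add: kl helmert2_def helmert_def sum.cartesian_product case_prod_beta)
    also have "\<dots> = 0" using X by (simp add: zero_margins_def flip: sum_distrib_right sum_divide_distrib)
    finally show ?thesis .
  qed
qed

lemma helmert2_expansion:
  assumes x: "x \<in> {..<m} \<times> {..<n}"
  shows "X x = (\<Sum>p\<in>{..<m} \<times> {..<n}. (\<Sum>y\<in>{..<m} \<times> {..<n}. X y * helmert2 m n p y) * helmert2 m n p x)"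
proof -
  have "(\<Sum>p\<in>{..<m} \<times> {..<n}. (\<Sum>y\<in>{..<m} \<times> {..<n}. X y * helmert2 m n p y) * helmert2 m n p x)
    = (\<Sum>y\<in>{..<m} \<times> {..<n}. X y * (\<Sum>p\<in>{..<m} \<times> {..<n}. helmert2 m n p y * helmert2 m n p x))"
    unfolding sum_distrib_right by (subst sum.swap) (simp add: sum_distrib_left mult.assoc)
  also have "\<dots> = (\<Sum>y\<in>{..<m} \<times> {..<n}. if y = x then X y else 0)"
    using x by (intro sum.cong refl) (simp add: helmert2_rows)
  also have "\<dots> = X x" using x by simp
  finally show ?thesis ..
qed

lemma zero_margins_expansion:
  assumes x: "x \<in> {..<m} \<times> {..<n}" and X: "zero_margins m n X"
  shows "X x = (\<Sum>p\<in>{1..<m} \<times> {1..<n}. (\<Sum>y\<in>{..<m} \<times> {..<n}. X y * helmert2 m n p y) * helmert2 m n p x)"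
  by (subst helmert2_expansion[OF x, of X]) (rule sum.mono_neutral_right, auto simp: zero_margins_orthogonal[OF X])

section \<open>Transportation polytopes\<close>

text \<open>Contracting by 1 - 1 / D in up to D dimensions costs only a constant: for x = 1 / D <= 1
  / 2, 1 / (1 - x) <= exp (x / (1 - x)) <= exp (2 * x).\<close>

lemma exp_neg_2_le_power:
  assumes "2 \<le> D"
  shows "exp (- 2) \<le> (1 - 1 / real D) ^ D"
proof -
  define x where "x = 1 / real D"
  have x: "0 < x" "x \<le> 1 / 2" using assms by (auto simp: x_def field_simps)
  have "1 / (1 - x) = 1 + x / (1 - x)" using x by (simp add: field_simps)
  also have "\<dots> \<le> exp (x / (1 - x))" by (rule exp_ge_add_one_self)
  also have "\<dots> \<le> exp (2 * x)" using x by (simp add: field_simps)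
  finally have "exp (- (2 * x)) \<le> 1 - x" using x by (simp add: exp_minus field_simps)
  then have "exp (- (2 * x)) ^ D \<le> (1 - x) ^ D" by (rule power_mono) simp
  moreover have "exp (- (2 * x)) ^ D = exp (- 2)" using assms by (simp add: x_def flip: exp_of_nat_mult)
  ultimately show ?thesis by (simp add: x_def)
qed

locale transportation =
  fixes m n :: nat and R C :: "nat \<Rightarrow> nat" and N :: nat
  assumes mn: "1 < m" "1 < n"
    and R_pos: "\<And>i. i < m \<Longrightarrow> 0 < R i" and C_pos: "\<And>j. j < n \<Longrightarrow> 0 < C j"
    and R_sum: "(\<Sum>i<m. R i) = N" and C_sum: "(\<Sum>j<n. C j) = N"
begin

abbreviation "Idx \<equiv> {..<m} \<times> {..<n}"
abbreviation "Pol \<equiv> transportation_polytope m n R C"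
abbreviation "dimP \<equiv> (m - 1) * (n - 1)"

definition margins :: "(nat \<times> nat \<Rightarrow> real) \<Rightarrow> bool" where
  "margins X \<longleftrightarrow> (\<forall>i<m. (\<Sum>j<n. X (i, j)) = real (R i)) \<and> (\<forall>j<n. (\<Sum>i<m. X (i, j)) = real (C j))"

text \<open>The independence table, an interior point of the polytope: positive integer margins make
  every entry at least 1 / N. The affine span, the positivity of the maximum and the lower bound on
  the maximiser's entries are all derived from it.\<close>

definition indep :: "nat \<times> nat \<Rightarrow> real" where
  "indep = (\<lambda>(i, j)\<in>Idx. real (R i) * real (C j) / real N)"

lemma m_le_N: "m \<le> N" and n_le_N: "n \<le> N"
proof -
  have "(\<Sum>i<m. 1) \<le> (\<Sum>i<m. R i)" using R_pos by (intro sum_mono) (auto simp: Suc_le_eq)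
  then show "m \<le> N" using R_sum by simp
  have "(\<Sum>j<n. 1) \<le> (\<Sum>j<n. C j)" using C_pos by (intro sum_mono) (auto simp: Suc_le_eq)
  then show "n \<le> N" using C_sum by simp
qed

lemma N_ge_2: "2 \<le> N" using m_le_N mn by simp

lemma Pol_iff: "X \<in> Pol \<longleftrightarrow> X \<in> Idx \<rightarrow>\<^sub>E UNIV \<and> (\<forall>x\<in>Idx. 0 \<le> X x) \<and> margins X"
  by (auto simp: transportation_polytope_def margins_def)

lemma indep_margins: "margins indep"
proof -
  have "(\<Sum>i<m. real (R i)) = real N" "(\<Sum>j<n. real (C j)) = real N"
    using R_sum C_sum by (simp_all flip: of_nat_sum)
  then show ?thesis
    using N_ge_2
    by (auto simp: margins_def indep_def simp flip: sum_divide_distrib sum_distrib_left sum_distrib_right)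
qed

lemma indep_ge: "x \<in> Idx \<Longrightarrow> 1 / real N \<le> indep x"
proof -
  assume x: "x \<in> Idx"
  obtain i j where ij: "x = (i, j)" "i < m" "j < n" using x by auto
  have "1 * 1 \<le> real (R i) * real (C j)"
    using R_pos[OF ij(2)] C_pos[OF ij(3)] by (intro mult_mono) auto
  then have "1 / real N \<le> real (R i) * real (C j) / real N" by (intro divide_right_mono) auto
  then show ?thesis using ij by (simp add: indep_def)
qed

lemma indep_mem: "indep \<in> Pol"
  using indep_margins indep_ge N_ge_2
  by (auto simp: Pol_iff indep_def PiE_iff extensional_def case_prod_beta)

text \<open>A matrix with the right margins enters the polytope when it is contracted far enough
  towards \<open>indep\<close>; undoing the contraction is an affine combination of two points of
  the polytope.\<close>

lemma affine_span_Pol: "affine_span_on Idx Pol = {X \<in> Idx \<rightarrow>\<^sub>E UNIV. margins X}"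
proof (intro equalityI subsetI)
  fix X assume "X \<in> affine_span_on Idx Pol"
  then obtain T w where T: "X = (\<lambda>i\<in>Idx. \<Sum>x\<in>T. w x * x i)" "finite T" "T \<subseteq> Pol" "sum w T = 1"
    unfolding affine_span_on_def by blast
  have "margins X"
    unfolding margins_def
  proof (intro conjI allI impI)
    fix i assume i: "i < m"
    have "(\<Sum>j<n. X (i, j)) = (\<Sum>x\<in>T. w x * (\<Sum>j<n. x (i, j)))"
      using i by (subst sum_distrib_left, subst sum.swap) (simp add: T(1))
    also have "\<dots> = (\<Sum>x\<in>T. w x * real (R i))"
      using T(3) i by (intro sum.cong refl) (auto simp: Pol_iff margins_def)
    finally show "(\<Sum>j<n. X (i, j)) = real (R i)" using T(4) by (simp flip: sum_distrib_right)
  next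
    fix j assume j: "j < n"
    have "(\<Sum>i<m. X (i, j)) = (\<Sum>x\<in>T. w x * (\<Sum>i<m. x (i, j)))"
      using j by (subst sum_distrib_left, subst sum.swap) (simp add: T(1))
    also have "\<dots> = (\<Sum>x\<in>T. w x * real (C j))"
      using T(3) j by (intro sum.cong refl) (auto simp: Pol_iff margins_def)
    finally show "(\<Sum>i<m. X (i, j)) = real (C j)" using T(4) by (simp flip: sum_distrib_right)
  qed
  then show "X \<in> {X \<in> Idx \<rightarrow>\<^sub>E UNIV. margins X}" by (simp add: T(1))
next
  fix X assume X: "X \<in> {X \<in> Idx \<rightarrow>\<^sub>E UNIV. margins X}"
  define B where "B = (\<Sum>x\<in>Idx. \<bar>X x - indep x\<bar>)"
  \<comment> \<open>\<open>B\<close> bounds every entry of X - indep, so with this factor no entry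
    moves by more than 1 / N, the lower bound on \<open>indep\<close>.\<close>
  define \<tau> where "\<tau> = 1 / (real N * (B + 1))"
  have B: "0 \<le> B" by (simp add: B_def sum_nonneg)
  then have \<tau>: "0 < \<tau>" using N_ge_2 by (simp add: \<tau>_def)
  define Y where "Y = (\<lambda>x\<in>Idx. (1 - \<tau>) * indep x + \<tau> * X x)"
  have Y: "Y \<in> Pol"
    unfolding Pol_iff
  proof (intro conjI ballI)
    fix x assume x: "x \<in> Idx"
    have "\<bar>X x - indep x\<bar> \<le> B" unfolding B_def using x by (intro member_le_sum) auto
    then have "\<tau> * \<bar>X x - indep x\<bar> \<le> \<tau> * (B + 1)" using \<tau> by (intro mult_left_mono) auto
    also have "\<dots> = 1 / real N" using B by (simp add: \<tau>_def)
    also have "\<dots> \<le> indep x" using x by (rule indep_ge)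
    finally have "\<bar>\<tau> * (X x - indep x)\<bar> \<le> indep x" using \<tau> by (simp add: abs_mult)
    then show "0 \<le> Y x" using x by (simp add: Y_def algebra_simps abs_le_iff)
  next
    show "margins Y"
      using X indep_margins
      by (auto simp: margins_def Y_def sum.distrib simp flip: sum_distrib_left) (simp_all add: algebra_simps)
  qed (simp add: Y_def)
  show "X \<in> affine_span_on Idx Pol"
  proof (cases "Y = indep")
    \<comment> \<open>The two points coincide, so the pair of weights degenerates; X is then
      \<open>indep\<close> itself.\<close>
    case True
    have "X x = indep x" if "x \<in> Idx" for x
    proof -
      have "Y x = indep x" using True by simp
      then show ?thesis using that \<tau> by (simp add: Y_def algebra_simps)
    qed
    then have "X = indep"
      using X by (intro ext) (auto simp: indep_def PiE_iff extensional_def case_prod_beta restrict_def)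
    then have "X = (\<lambda>i\<in>Idx. \<Sum>x\<in>{indep}. 1 * x i)" using X by (auto simp: PiE_iff extensional_def restrict_def)
    then show ?thesis
      unfolding affine_span_on_def using indep_mem by (intro CollectI exI[of _ "{indep}"] exI[of _ "\<lambda>_. 1"]) auto
  next
    case False
    define w where "w Z = (if Z = Y then 1 / \<tau> else 1 - 1 / \<tau>)" for Z :: "nat \<times> nat \<Rightarrow> real"
    have "X = (\<lambda>i\<in>Idx. \<Sum>x\<in>{Y, indep}. w x * x i)"
    proof
      fix x
      show "X x = (\<lambda>i\<in>Idx. \<Sum>x\<in>{Y, indep}. w x * x i) x"
      proof (cases "x \<in> Idx")
        case True
        have "1 / \<tau> * Y x + (1 - 1 / \<tau>) * indep x = X x"
          using True \<tau> by (simp add: Y_def field_simps)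
        then show ?thesis using True False by (simp add: w_def)
      next
        case False
        have "X x = undefined" by (rule PiE_arb[OF _ False]) (use X in auto)
        then show ?thesis by (simp only: restrict_apply False if_False)
      qed
    qed
    moreover have "sum w {Y, indep} = 1" using False by (simp add: w_def)
    ultimately show ?thesis
      unfolding affine_span_on_def using indep_mem Y by (intro CollectI exI[of _ "{Y, indep}"] exI[of _ w]) auto
  qed
qed

section \<open>Orthonormal frames of the affine span\<close>

lemma margins_diff: "margins X \<Longrightarrow> margins Y \<Longrightarrow> zero_margins m n (\<lambda>x. X x - Y x)"
  by (simp add: margins_def zero_margins_def sum_subtractf)

lemma margins_add: "margins X \<Longrightarrow> zero_margins m n Y \<Longrightarrow> margins (\<lambda>x. X x + Y x)"
  by (simp add: margins_def zero_margins_def sum.distrib)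

lemma zero_margins_sum:
  "(\<And>k. k \<in> A \<Longrightarrow> zero_margins m n (f k)) \<Longrightarrow> zero_margins m n (\<lambda>x. \<Sum>k\<in>A. c k * f k x)"
  unfolding zero_margins_def
  by (intro conjI allI impI; subst sum.swap) (auto simp flip: sum_distrib_left)

lemma margins_cong: "(\<And>x. x \<in> Idx \<Longrightarrow> X x = Y x) \<Longrightarrow> margins X = margins Y"
  by (simp add: margins_def)

lemma zero_margins_cong: "(\<And>x. x \<in> Idx \<Longrightarrow> X x = Y x) \<Longrightarrow> zero_margins m n X = zero_margins m n Y"
  by (simp add: zero_margins_def)

text \<open>This makes the choice by \<open>SOME\<close> in the volume a genuine frame. The witness
  has origin \<open>indep\<close> and the Helmert products with both indices positive as
  directions.\<close>

lemma affine_frame_exists: "\<exists>p b. affine_frame Idx dimP Pol p b"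
proof -
  have "card ({1..<m} \<times> {1..<n}) = dimP" by simp
  then obtain e where e: "bij_betw e {..<dimP} ({1..<m} \<times> {1..<n})"
    using ex_bij_betw_nat_finite[of "{1..<m} \<times> {1..<n}"] by (auto simp: lessThan_atLeast0)
  define b where "b k = helmert2 m n (e k)" for k
  have e_mem: "e k \<in> {1..<m} \<times> {1..<n}" if "k < dimP" for k
    using e that by (auto simp: bij_betw_def)
  have b_zero: "zero_margins m n (b k)" if "k < dimP" for k
    using e_mem[OF that] unfolding b_def by (cases "e k") (auto intro: zero_margins_helmert2)
  have "orthonormal_on Idx dimP b"
    unfolding orthonormal_on_def
  proof (intro allI impI)
    fix k l assume kl: "k < dimP" "l < dimP"
    then have "e k = e l \<longleftrightarrow> k = l" using e by (auto simp: bij_betw_def inj_on_def)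
    then show "(\<Sum>i\<in>Idx. b k i * b l i) = (if k = l then 1 else 0)"
      unfolding b_def using e_mem[OF kl(1)] e_mem[OF kl(2)] by (subst helmert2_cols) auto
  qed
  moreover have "flat_point Idx dimP indep b ` ({..<dimP} \<rightarrow>\<^sub>E UNIV) = {X \<in> Idx \<rightarrow>\<^sub>E UNIV. margins X}"
  proof (intro equalityI subsetI)
    fix X assume "X \<in> flat_point Idx dimP indep b ` ({..<dimP} \<rightarrow>\<^sub>E UNIV)"
    then obtain t where X: "X = flat_point Idx dimP indep b t" by blast
    have "margins (\<lambda>x. indep x + (\<Sum>k<dimP. t k * b k x))"
      by (intro margins_add indep_margins zero_margins_sum b_zero) simp
    also have "margins (\<lambda>x. indep x + (\<Sum>k<dimP. t k * b k x)) = margins X"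
      unfolding X by (rule margins_cong) (simp add: flat_point_def)
    finally show "X \<in> {X \<in> Idx \<rightarrow>\<^sub>E UNIV. margins X}" by (simp add: X flat_point_def)
  next
    fix X assume X: "X \<in> {X \<in> Idx \<rightarrow>\<^sub>E UNIV. margins X}"
    define Z where "Z x = X x - indep x" for x
    have Z: "zero_margins m n Z" unfolding Z_def using X indep_margins by (intro margins_diff) auto
    define t where "t = (\<lambda>k\<in>{..<dimP}. \<Sum>y\<in>Idx. Z y * b k y)"
    have "X = flat_point Idx dimP indep b t"
    proof
      fix x
      show "X x = flat_point Idx dimP indep b t x"
      proof (cases "x \<in> Idx")
        case True
        have "Z x = (\<Sum>p\<in>{1..<m} \<times> {1..<n}. (\<Sum>y\<in>Idx. Z y * helmert2 m n p y) * helmert2 m n p x)"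
          by (rule zero_margins_expansion[OF True Z])
        also have "\<dots> = (\<Sum>k<dimP. t k * b k x)"
          by (subst sum.reindex_bij_betw[OF e, symmetric]) (simp add: t_def b_def)
        finally show ?thesis using True by (simp add: flat_point_def Z_def)
      next
        case False
        have "X x = undefined" by (rule PiE_arb[OF _ False]) (use X in auto)
        then show ?thesis by (simp only: flat_point_def restrict_apply False if_False)
      qed
    qed
    then show "X \<in> flat_point Idx dimP indep b ` ({..<dimP} \<rightarrow>\<^sub>E UNIV)" by (auto simp: t_def)
  qed
  ultimately show ?thesis unfolding affine_frame_def affine_span_Pol by blast
qed

text \<open>Any frame is completed by the Helmert products with a zero index, which are orthogonal
  to all zero-margin matrices. A translation then matches frame coordinates with coordinates on the
  section through \<open>z\<close>.\<close>

lemma frame_section: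
  assumes frame: "affine_frame Idx dimP Pol p b" and z: "z \<in> Pol" and z_pos: "\<And>x. x \<in> Idx \<Longrightarrow> 0 < z x"
  obtains u where "orthant_section Idx (m * n) dimP u z"
    and "\<And>k. k < dimP \<Longrightarrow> zero_margins m n (u k)"
    and "emeasure (lborel_Pi {..<dimP}) {t \<in> {..<dimP} \<rightarrow>\<^sub>E UNIV. flat_point Idx dimP p b t \<in> Pol}
      = orthant_section.section_volume Idx (m * n) dimP u z"
proof -
  let ?P0 = "Idx - {1..<m} \<times> {1..<n}"
  have orth: "(\<Sum>i\<in>Idx. b k i * b l i) = (if k = l then 1 else 0)" if "k < dimP" "l < dimP" for k l
    using frame that by (auto simp: affine_frame_def orthonormal_on_def)
  have img: "flat_point Idx dimP p b ` ({..<dimP} \<rightarrow>\<^sub>E UNIV) = {X \<in> Idx \<rightarrow>\<^sub>E UNIV. margins X}"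
    using frame by (simp add: affine_frame_def affine_span_Pol)
  have flat_margins: "margins (flat_point Idx dimP p b t)" if "t \<in> {..<dimP} \<rightarrow>\<^sub>E UNIV" for t
    using that img by blast
  have p_margins: "margins p"
  proof -
    have "margins (flat_point Idx dimP p b (\<lambda>k\<in>{..<dimP}. 0))" by (rule flat_margins) simp
    also have "margins (flat_point Idx dimP p b (\<lambda>k\<in>{..<dimP}. 0)) = margins p"
      by (rule margins_cong) (simp add: flat_point_def)
    finally show ?thesis .
  qed
  have b_zero: "zero_margins m n (b k)" if k: "k < dimP" for k
  proof -
    \<comment> \<open>The frame points with coordinates a unit vector and zero both have the margins
      of the polytope; their difference is \<open>b k\<close>.\<close>
    have "margins (flat_point Idx dimP p b (\<lambda>l\<in>{..<dimP}. if l = k then 1 else 0))" by (rule flat_margins) simp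
    then have "zero_margins m n (\<lambda>x. flat_point Idx dimP p b (\<lambda>l\<in>{..<dimP}. if l = k then 1 else 0) x - p x)"
      using p_margins by (rule margins_diff)
    also have "zero_margins m n (\<lambda>x. flat_point Idx dimP p b (\<lambda>l\<in>{..<dimP}. if l = k then 1 else 0) x - p x) = zero_margins m n (b k)"
      using k by (intro zero_margins_cong) (simp add: flat_point_def if_distrib[of "\<lambda>c. c * _"] cong: if_cong)
    finally show ?thesis .
  qed
  have dimP_le: "dimP \<le> m * n" by (intro mult_le_mono) auto
  have "card ?P0 = m * n - dimP"
    by (subst card_Diff_subset) auto
  then obtain e where e: "bij_betw e {dimP..<m * n} ?P0"
    using finite_same_card_bij[of "{dimP..<m * n}" ?P0] by auto
  define u where "u k = (if k < dimP then b k else helmert2 m n (e k))" for k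
  have e_mem: "e k \<in> ?P0" if "dimP \<le> k" "k < m * n" for k
    using bij_betw_apply[OF e, of k] that by simp
  have sum_split: "(\<Sum>k<m * n. f k) = (\<Sum>k<dimP. f k) + (\<Sum>k\<in>{dimP..<m * n}. f k)" for f :: "nat \<Rightarrow> real"
    using sum.atLeastLessThan_concat[of 0 dimP "m * n" f] dimP_le by (simp add: lessThan_atLeast0)
  have cols: "(\<Sum>i\<in>Idx. u k i * u l i) = (if k = l then 1 else 0)" if kl: "k < m * n" "l < m * n" for k l
  proof -
    consider "k < dimP" "l < dimP" | "k < dimP" "dimP \<le> l" | "dimP \<le> k" "l < dimP" | "dimP \<le> k" "dimP \<le> l"
      by linarith
    then show ?thesis
    proof cases
      case 1
      then show ?thesis using orth by (simp add: u_def)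
    next
      case 2
      then show ?thesis
        using zero_margins_orthogonal[OF b_zero[OF 2(1)] e_mem[OF 2(2) kl(2)]] by (auto simp: u_def)
    next
      case 3
      then show ?thesis
        using zero_margins_orthogonal[OF b_zero[OF 3(2)] e_mem[OF 3(1) kl(1)]] by (auto simp: u_def mult.commute)
    next
      case 4
      have "e k = e l \<longleftrightarrow> k = l" using e 4 kl by (auto simp: bij_betw_def inj_on_def)
      then show ?thesis
        using 4 e_mem[OF 4(1) kl(1)] e_mem[OF 4(2) kl(2)] helmert2_cols[of "e k" m n "e l"] by (simp add: u_def)
    qed
  qed
  have rows: "(\<Sum>k<m * n. u k x * u k y) = (if x = y then 1 else 0)" if x: "x \<in> Idx" and y: "y \<in> Idx" for x y
  proof -
    \<comment> \<open>The projection of the unit matrix at x to the zero-margin matrices. In the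
      frame its coefficients are b k x, so the frame gives the same projection kernel as the Helmert
      products, and completeness carries over from the Helmert basis.\<close>
    define W where "W a = (\<Sum>q\<in>{1..<m} \<times> {1..<n}. helmert2 m n q x * helmert2 m n q a)" for a
    have P1: "{1..<m} \<times> {1..<n} \<subseteq> Idx" by auto
    have W_eq: "W a = (if x = a then 1 else 0) - (\<Sum>q\<in>?P0. helmert2 m n q x * helmert2 m n q a)" if "a \<in> Idx" for a
      using sum.subset_diff[OF P1, of "\<lambda>q. helmert2 m n q x * helmert2 m n q a"] helmert2_rows[OF x that] by (simp add: W_def)
    have "zero_margins m n W"
      unfolding W_def[abs_def] by (rule zero_margins_sum) (auto intro: zero_margins_helmert2)
    then have "margins (\<lambda>a. p a + W a)" by (rule margins_add[OF p_margins])
    then have "margins (\<lambda>a\<in>Idx. p a + W a)" by (subst margins_cong) auto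
    then have "(\<lambda>a\<in>Idx. p a + W a) \<in> flat_point Idx dimP p b ` ({..<dimP} \<rightarrow>\<^sub>E UNIV)"
      unfolding img by simp
    then obtain t where t: "(\<lambda>a\<in>Idx. p a + W a) = flat_point Idx dimP p b t" by blast
    have Wt: "W a = (\<Sum>l<dimP. t l * b l a)" if "a \<in> Idx" for a
      using fun_cong[OF t, of a] that by (simp add: flat_point_def)
    have "t k = b k x" if k: "k < dimP" for k
    proof -
      have "(\<Sum>a\<in>Idx. W a * b k a) = (\<Sum>a\<in>Idx. \<Sum>l<dimP. t l * (b l a * b k a))"
        by (intro sum.cong refl) (simp add: Wt sum_distrib_right mult.assoc)
      also have "\<dots> = (\<Sum>l<dimP. t l * (\<Sum>a\<in>Idx. b l a * b k a))"
        by (subst sum.swap) (simp add: sum_distrib_left)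
      also have "\<dots> = (\<Sum>l<dimP. if l = k then t l else 0)"
        using k by (intro sum.cong refl) (simp add: orth)
      also have "\<dots> = t k" using k by simp
      finally have 1: "(\<Sum>a\<in>Idx. W a * b k a) = t k" .
      have "(\<Sum>a\<in>Idx. W a * b k a) = (\<Sum>a\<in>Idx. ((if x = a then 1 else 0) - (\<Sum>q\<in>?P0. helmert2 m n q x * helmert2 m n q a)) * b k a)"
        by (intro sum.cong refl) (simp only: W_eq)
      also have "\<dots> = (\<Sum>a\<in>Idx. (if x = a then 1 else 0) * b k a) - (\<Sum>a\<in>Idx. \<Sum>q\<in>?P0. helmert2 m n q x * helmert2 m n q a * b k a)"
        unfolding left_diff_distrib sum_subtractf sum_distrib_right ..
      also have "(\<Sum>a\<in>Idx. \<Sum>q\<in>?P0. helmert2 m n q x * helmert2 m n q a * b k a)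
          = (\<Sum>q\<in>?P0. helmert2 m n q x * (\<Sum>a\<in>Idx. b k a * helmert2 m n q a))"
        unfolding sum_distrib_left by (subst sum.swap) (simp only: mult_ac)
      also have "\<dots> = 0" by (intro sum.neutral) (auto simp: zero_margins_orthogonal[OF b_zero[OF k]])
      also have "(\<Sum>a\<in>Idx. (if x = a then 1 else 0) * b k a) = (\<Sum>a\<in>Idx. if x = a then b k a else 0)"
        by (intro sum.cong) auto
      also have "\<dots> = b k x" using x by simp
      finally show ?thesis using 1 by simp
    qed
    then have "W y = (\<Sum>l<dimP. b l x * b l y)" using Wt[OF y] by simp
    moreover have "(\<Sum>k\<in>{dimP..<m * n}. u k x * u k y) = (\<Sum>q\<in>?P0. helmert2 m n q x * helmert2 m n q y)"
      by (subst sum.reindex_bij_betw[OF e, symmetric]) (simp add: u_def)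
    ultimately show ?thesis using W_eq[OF y] by (simp add: sum_split u_def)
  qed
  interpret orthant_section Idx "m * n" dimP u z
    by unfold_locales (use cols rows z_pos dimP_le in auto)
  \<comment> \<open>Basis coordinates of the frame origin. From \<open>dimP\<close> on they agree
    with those of \<open>z\<close>, as p - z has zero margins.\<close>
  define q where "q k = (\<Sum>i\<in>Idx. p i * u k i)" for k
  have q_coord: "q k = coord k" if "dimP \<le> k" "k < m * n" for k
  proof -
    have "zero_margins m n (\<lambda>x. p x - z x)" using z by (intro margins_diff p_margins) (simp add: Pol_iff)
    then have "(\<Sum>x\<in>Idx. (p x - z x) * helmert2 m n (e k) x) = 0"
      by (rule zero_margins_orthogonal) (rule e_mem[OF that])
    then show ?thesis using that by (simp add: q_def coord_def u_def left_diff_distrib sum_subtractf)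
  qed
  have p_expand: "p x = (\<Sum>k<m * n. q k * u k x)" if x: "x \<in> Idx" for x
  proof -
    have "(\<Sum>k<m * n. q k * u k x) = (\<Sum>y\<in>Idx. p y * (\<Sum>k<m * n. u k y * u k x))"
      unfolding q_def sum_distrib_right by (subst sum.swap) (simp add: sum_distrib_left mult.assoc)
    also have "\<dots> = (\<Sum>y\<in>Idx. if y = x then p y else 0)"
      using x by (intro sum.cong refl) (simp add: rows)
    also have "\<dots> = p x" using x by simp
    finally show ?thesis ..
  qed
  define S where "S t = (\<lambda>k. if k < dimP then t k else coord k)" for t
  have shift: "point (S (\<lambda>k\<in>{..<dimP}. q k + t k)) x = flat_point Idx dimP p b t x" if x: "x \<in> Idx" for t x
  proof -
    have "point (S (\<lambda>k\<in>{..<dimP}. q k + t k)) x = (\<Sum>k<dimP. (q k + t k) * u k x) + (\<Sum>k\<in>{dimP..<m * n}. q k * u k x)"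
      unfolding point_def sum_split by (simp add: S_def q_coord)
    also have "\<dots> = (\<Sum>k<m * n. q k * u k x) + (\<Sum>k<dimP. t k * u k x)"
      by (simp add: sum_split distrib_right sum.distrib)
    finally show ?thesis using x by (simp add: p_expand[OF x] flat_point_def u_def)
  qed
  have S: "S \<in> measurable (lborel_Pi {..<dimP}) (PiM UNIV (\<lambda>_. borel))"
  proof (rule measurable_PiM_single')
    show "(\<lambda>t. S t k) \<in> borel_measurable (lborel_Pi {..<dimP})" for k
      unfolding S_def by (cases "k < dimP") auto
  qed auto
  have orthant_S: "(\<lambda>t. orthant (S t)) \<in> borel_measurable (lborel_Pi {..<dimP})"
    by (rule measurable_compose[OF S measurable_orthant])
  let ?V = "{t \<in> {..<dimP} \<rightarrow>\<^sub>E UNIV. flat_point Idx dimP p b t \<in> Pol}"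
  have V_iff: "t \<in> ?V \<longleftrightarrow> t \<in> space (lborel_Pi {..<dimP}) \<and> (\<forall>x\<in>Idx. 0 \<le> p x + (\<Sum>k<dimP. t k * b k x))" for t
    using flat_margins by (auto simp: Pol_iff space_PiM flat_point_def)
  have V_sets: "?V \<in> sets (lborel_Pi {..<dimP})"
  proof -
    have "?V = {t \<in> space (lborel_Pi {..<dimP}). \<forall>x\<in>Idx. 0 \<le> p x + (\<Sum>k<dimP. t k * b k x)}"
      using V_iff by blast
    also have "\<dots> \<in> sets (lborel_Pi {..<dimP})" by measurable
    finally show ?thesis .
  qed
  have "section_volume = (\<integral>\<^sup>+t. orthant (S t) \<partial>lborel_Pi {..<dimP})"
    unfolding section_volume_def partial_integral_def S_def by simp
  also have "\<dots> = (\<integral>\<^sup>+t. orthant (S (\<lambda>k\<in>{..<dimP}. q k + t k)) \<partial>lborel_Pi {..<dimP})"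
    using nn_integral_lborel_Pi_affine[OF _ _ orthant_S, of 1 q] by simp
  also have "\<dots> = (\<integral>\<^sup>+t. indicator ?V t \<partial>lborel_Pi {..<dimP})"
  proof (rule nn_integral_cong)
    fix t assume "t \<in> space (lborel_Pi {..<dimP})"
    then have "t \<in> ?V \<longleftrightarrow> (\<forall>x\<in>Idx. 0 \<le> flat_point Idx dimP p b t x)"
      unfolding V_iff by (simp add: flat_point_def)
    also have "\<dots> \<longleftrightarrow> (\<forall>x\<in>Idx. 0 \<le> point (S (\<lambda>k\<in>{..<dimP}. q k + t k)) x)"
      by (intro ball_cong refl) (simp only: shift)
    finally show "orthant (S (\<lambda>k\<in>{..<dimP}. q k + t k)) = indicator ?V t"
      unfolding orthant_def indicator_def by simp
  qed
  also have "\<dots> = emeasure (lborel_Pi {..<dimP}) ?V" using V_sets by simp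
  finally have vol: "section_volume = emeasure (lborel_Pi {..<dimP}) ?V" .
  show ?thesis
  proof (rule that)
    show "orthant_section Idx (m * n) dimP u z" by unfold_locales
    show "zero_margins m n (u k)" if "k < dimP" for k using b_zero that by (simp add: u_def)
  qed (rule vol[symmetric])
qed

section \<open>The maximiser of the product\<close>

lemma Pol_le_N:
  assumes X: "X \<in> Pol" and x: "x \<in> Idx"
  shows "X x \<le> real N"
proof -
  obtain i j where ij: "x = (i, j)" "i < m" "j < n" using x by auto
  have "X (i, j) \<le> (\<Sum>j<n. X (i, j))"
    using X ij by (intro member_le_sum) (auto simp: Pol_iff)
  also have "\<dots> = real (R i)" using X ij by (simp add: Pol_iff margins_def)
  also have "R i \<le> N" unfolding R_sum[symmetric] using ij by (intro member_le_sum) auto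
  finally show ?thesis using ij by simp
qed

text \<open>Matrices are functions on all pairs, \<open>undefined\<close> outside the index set. The
  ambient box has one-point factors there and is compact by Tychonoff; the margins form one closed
  condition, the vanishing of the total defect \<open>g\<close>.\<close>

lemma compact_Pol: "compact Pol"
proof -
  let ?B = "Pi\<^sub>E UNIV (\<lambda>x. if x \<in> Idx then {0..real N} else {undefined :: real})"
  have "compactin (product_topology (\<lambda>_. euclideanreal) UNIV) ?B"
    unfolding compactin_PiE by (auto simp: compactin_euclidean_iff)
  then have "compact ?B" by (simp add: euclidean_product_topology flip: compactin_euclidean_iff)
  define g where "g X = (\<Sum>i<m. \<bar>(\<Sum>j<n. X (i, j)) - real (R i)\<bar>) + (\<Sum>j<n. \<bar>(\<Sum>i<m. X (i, j)) - real (C j)\<bar>)"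
    for X :: "nat \<times> nat \<Rightarrow> real"
  have coord: "continuous_on UNIV (\<lambda>X :: nat \<times> nat \<Rightarrow> real. X x)" for x
    by (rule continuous_on_product_coordinates)
  have "continuous_on UNIV g"
    unfolding g_def by (intro continuous_intros coord)
  then have "closed {X. g X = 0}" by (intro closed_Collect_eq continuous_on_const)
  moreover have "Pol = ?B \<inter> {X. g X = 0}"
  proof -
    have g0: "g X = 0 \<longleftrightarrow> margins X" for X
      unfolding g_def margins_def
      by (subst add_nonneg_eq_0_iff) (auto simp: sum_nonneg sum_nonneg_eq_0_iff)
    show ?thesis
    proof (intro equalityI subsetI)
      fix X assume X: "X \<in> Pol"
      then have "X x = undefined" if "x \<notin> Idx" for x using that by (intro PiE_arb[of X Idx]) (auto simp: Pol_iff)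
      then have "X x \<in> (if x \<in> Idx then {0..real N} else {undefined})" for x
        using X Pol_le_N[OF X, of x] unfolding Pol_iff by (cases "x \<in> Idx") (simp_all only: if_True if_False atLeastAtMost_iff singletonI, blast)
      then show "X \<in> ?B \<inter> {X. g X = 0}" using X g0 by (simp add: Pol_iff PiE_iff)
    next
      fix X assume X: "X \<in> ?B \<inter> {X. g X = 0}"
      then have mem: "X x \<in> (if x \<in> Idx then {0..real N} else {undefined})" for x
      proof -
        from X have "X \<in> ?B" by blast
        then show ?thesis by (rule PiE_mem) simp
      qed
      have "X \<in> Idx \<rightarrow>\<^sub>E UNIV"
      proof (rule PiE_I)
        show "X x = undefined" if "x \<notin> Idx" for x using mem[of x] unfolding if_not_P[OF that] by simp
      qed simp
      moreover have "0 \<le> X x" if "x \<in> Idx" for x using mem[of x] unfolding if_P[OF that] by simp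
      ultimately show "X \<in> Pol" using X g0 by (auto simp: Pol_iff)
    qed
  qed
  ultimately show ?thesis using \<open>compact ?B\<close> by (simp add: compact_Int_closed)
qed

lemma prod_Idx: "(\<Prod>i<m. \<Prod>j<n. X (i, j)) = (\<Prod>x\<in>Idx. X x)"
  by (simp add: prod.cartesian_product)

lemma maximizer:
  obtains z where "z \<in> Pol" "\<And>x. x \<in> Idx \<Longrightarrow> 0 < z x" "max_product m n R C = (\<Prod>x\<in>Idx. z x)"
    "\<And>X. X \<in> Pol \<Longrightarrow> (\<Prod>x\<in>Idx. X x) \<le> (\<Prod>x\<in>Idx. z x)"
proof -
  have "continuous_on UNIV (\<lambda>X :: nat \<times> nat \<Rightarrow> real. \<Prod>x\<in>Idx. X x)"
    by (intro continuous_on_prod continuous_on_product_coordinates)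
  then have "continuous_on Pol (\<lambda>X. \<Prod>x\<in>Idx. X x)" by (rule continuous_on_subset) simp
  then obtain z where z: "z \<in> Pol" "\<And>X. X \<in> Pol \<Longrightarrow> (\<Prod>x\<in>Idx. X x) \<le> (\<Prod>x\<in>Idx. z x)"
    using continuous_attains_sup[OF compact_Pol] indep_mem by blast
  have "0 < (\<Prod>x\<in>Idx. indep x)"
    using N_ge_2 by (intro prod_pos ballI less_le_trans[OF _ indep_ge]) auto
  then have "(\<Prod>x\<in>Idx. z x) \<noteq> 0" using z(2)[OF indep_mem] by linarith
  then have "z x \<noteq> 0" if "x \<in> Idx" for x using that by (auto simp: prod_zero_iff)
  then have pos: "0 < z x" if "x \<in> Idx" for x using that z(1) by (force simp: Pol_iff order_less_le)
  have "max_product m n R C = (\<Prod>x\<in>Idx. z x)"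
    unfolding max_product_def prod_Idx using z by (intro Greatest_equality) auto
  then show ?thesis using z pos by (intro that) auto
qed

text \<open>First order condition: the sum of logarithms has derivative (sum of X / z) - mn at
  \<open>z\<close> in the direction X - z. Were it positive, a short step towards X would stay in
  the polytope and increase the product.\<close>

lemma maximizer_optimal:
  assumes z: "z \<in> Pol" and z_pos: "\<And>x. x \<in> Idx \<Longrightarrow> 0 < z x"
    and max: "\<And>X. X \<in> Pol \<Longrightarrow> (\<Prod>x\<in>Idx. X x) \<le> (\<Prod>x\<in>Idx. z x)" and X: "X \<in> Pol"
  shows "(\<Sum>x\<in>Idx. X x / z x) \<le> real (m * n)"
proof (rule ccontr)
  assume "\<not> ?thesis"
  then have "0 < (\<Sum>x\<in>Idx. X x / z x) - (\<Sum>x\<in>Idx. 1)" by simp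
  also have "\<dots> = (\<Sum>x\<in>Idx. (X x - z x) / z x)"
    unfolding sum_subtractf[symmetric]
  proof (intro sum.cong refl)
    fix x assume "x \<in> Idx"
    then show "X x / z x - 1 = (X x - z x) / z x" using z_pos[of x] by (simp add: diff_divide_distrib)
  qed
  finally have pos: "0 < (\<Sum>x\<in>Idx. (X x - z x) / z x)" .
  define f where "f t = (\<Sum>x\<in>Idx. ln (z x + t * (X x - z x)))" for t :: real
  have "((\<lambda>t. ln (z x + t * (X x - z x))) has_real_derivative (X x - z x) / z x) (at 0)" if "x \<in> Idx" for x
    using z_pos[OF that] by (auto intro!: derivative_eq_intros)
  then have "(f has_real_derivative (\<Sum>x\<in>Idx. (X x - z x) / z x)) (at 0)"
    unfolding f_def by (intro DERIV_sum)
  then obtain c where c: "0 < c" "\<And>h. 0 < h \<Longrightarrow> h < c \<Longrightarrow> f 0 < f (0 + h)"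
    using DERIV_pos_inc_right[OF _ pos] by blast
  define h where "h = min (c / 2) (1 / 2)"
  have h: "0 < h" "h < 1" "f 0 < f h" using c by (auto simp: h_def)
  define Y where "Y = (\<lambda>x\<in>Idx. z x + h * (X x - z x))"
  have Y_eq: "Y x = (1 - h) * z x + h * X x" if "x \<in> Idx" for x using that by (simp add: Y_def algebra_simps)
  have Y_pos: "0 < Y x" if "x \<in> Idx" for x
    unfolding Y_eq[OF that] using z_pos[OF that] h X that by (intro add_pos_nonneg) (auto simp: Pol_iff)
  have Y_nz: "Y x \<noteq> 0" and z_nz: "z x \<noteq> 0" if "x \<in> Idx" for x
    using Y_pos[OF that] z_pos[OF that] by simp_all
  have "margins Y"
  proof -
    \<comment> \<open>The sum over a one-element set brings a multiple of a zero-margin matrix into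
      the shape of \<open>zero_margins_sum\<close>.\<close>
    have "margins (\<lambda>x. z x + (\<Sum>k\<in>{()}. h * (X x - z x)))"
      using X z by (intro margins_add zero_margins_sum margins_diff) (auto simp: Pol_iff)
    also have "margins (\<lambda>x. z x + (\<Sum>k\<in>{()}. h * (X x - z x))) = margins Y"
      by (rule margins_cong) (simp add: Y_def)
    finally show ?thesis .
  qed
  then have "Y \<in> Pol" using Y_pos by (auto simp: Pol_iff Y_def less_imp_le)
  then have "ln (\<Prod>x\<in>Idx. Y x) \<le> ln (\<Prod>x\<in>Idx. z x)"
    using Y_pos z_pos by (subst ln_le_cancel_iff) (auto intro!: prod_pos max)
  moreover have "ln (\<Prod>x\<in>Idx. Y x) = (\<Sum>x\<in>Idx. ln (Y x))"
    using Y_nz by (intro ln_prod) auto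
  moreover have "ln (\<Prod>x\<in>Idx. z x) = (\<Sum>x\<in>Idx. ln (z x))"
    using z_nz by (intro ln_prod) auto
  moreover have "f h = (\<Sum>x\<in>Idx. ln (Y x))" by (simp add: f_def Y_def)
  moreover have "f 0 = (\<Sum>x\<in>Idx. ln (z x))" by (simp add: f_def)
  ultimately show False using h by simp
qed

text \<open>The first order condition at \<open>indep\<close> bounds each quotient indep / z by mn
  <= N^2, while indep >= 1 / N.\<close>

lemma maximizer_ge:
  assumes z: "z \<in> Pol" and z_pos: "\<And>x. x \<in> Idx \<Longrightarrow> 0 < z x"
    and max: "\<And>X. X \<in> Pol \<Longrightarrow> (\<Prod>x\<in>Idx. X x) \<le> (\<Prod>x\<in>Idx. z x)" and x: "x \<in> Idx"
  shows "1 / real N ^ 3 \<le> z x"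
proof -
  have "indep x / z x \<le> (\<Sum>x\<in>Idx. indep x / z x)"
    using x z_pos indep_ge N_ge_2 indep_mem
    by (intro member_le_sum) (auto simp: Pol_iff intro!: divide_nonneg_pos simp del: mem_Sigma_iff)
  also have "\<dots> \<le> real (m * n)" by (rule maximizer_optimal[OF z z_pos max indep_mem])
  also have "\<dots> \<le> real (N * N)" using m_le_N n_le_N by (simp only: of_nat_le_iff mult_le_mono)
  finally have "indep x \<le> real (N * N) * z x" using z_pos[OF x] by (simp add: pos_divide_le_eq)
  then have "1 / real N \<le> real (N * N) * z x" using indep_ge[OF x] by linarith
  then have "1 / real N / real (N * N) \<le> z x" using N_ge_2 by (simp add: divide_simps mult_ac)
  then show ?thesis by (simp add: power3_eq_cube)
qed

text \<open>Each of the e = m + n - 1 directions across the polytope costs a power of N, and the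
  constants are absorbed since N >= 2. The 6 comes from the upper bound, where \<epsilon> >= N^(-2)
  and 2 * \<eta> = N^(-4).\<close>

theorem polytope_volume_bounds:
  "polytope_volume m n R C \<le> max_product m n R C * exp (real (m * n)) * real N ^ (6 * (m + n))"
  "max_product m n R C * exp (real (m * n)) \<le> polytope_volume m n R C * real N ^ (6 * (m + n))"
proof -
  obtain z where z: "z \<in> Pol" "\<And>x. x \<in> Idx \<Longrightarrow> 0 < z x" "max_product m n R C = (\<Prod>x\<in>Idx. z x)"
    "\<And>X. X \<in> Pol \<Longrightarrow> (\<Prod>x\<in>Idx. X x) \<le> (\<Prod>x\<in>Idx. z x)"
    using maximizer by blast
  obtain p b where pb: "(SOME (p, b). affine_frame Idx dimP Pol p b) = (p, b)" by (metis surj_pair)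
  have frame: "affine_frame Idx dimP Pol p b"
    using someI_ex[of "\<lambda>(p, b). affine_frame Idx dimP Pol p b"] affine_frame_exists pb by auto
  obtain u where sec: "orthant_section Idx (m * n) dimP u z"
    and u: "\<And>k. k < dimP \<Longrightarrow> zero_margins m n (u k)"
    and vol: "emeasure (lborel_Pi {..<dimP}) {t \<in> {..<dimP} \<rightarrow>\<^sub>E UNIV. flat_point Idx dimP p b t \<in> Pol}
      = orthant_section.section_volume Idx (m * n) dimP u z"
    using frame_section[OF frame z(1,2)] by blast
  interpret orthant_section Idx "m * n" dimP u z by (rule sec)
  let ?V = "polytope_volume m n R C" and ?\<beta> = "\<Prod>x\<in>Idx. z x"
  have V: "?V = enn2real section_volume"
    unfolding polytope_volume_def affine_volume_def pb Let_def prod.case measure_def vol ..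
  have \<beta>: "0 < ?\<beta>" using z(2) by (intro prod_pos) auto
  have N: "2 \<le> real N" using N_ge_2 by simp
  define e where "e = m * n - dimP"
  have e: "e + 1 = m + n"
  proof -
    obtain m' n' where "m = Suc m'" "n = Suc n'" using mn by (metis less_imp_Suc_add add_Suc_right)
    then show ?thesis by (simp add: e_def)
  qed
  have mn_le: "real (m * n) \<le> real N ^ 2"
    using m_le_N n_le_N by (simp add: power2_eq_square mult_mono)
  have mn_ge: "4 \<le> m * n" using mult_le_mono[of 2 m 2 n] mn by simp
  have e_le: "real e \<le> 2 * real N"
    using e m_le_N n_le_N by linarith

  \<comment> \<open>With this weight the contraction costs at most exp 2 and the exponent (1 +
    \<epsilon>) * mn exceeds mn by just 1.\<close>
  define \<epsilon> where "\<epsilon> = 1 / real (m * n)"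
  \<comment> \<open>As e <= 2 * N, the product e * \<eta> is at most N^(-3), the lower bound on the
    entries of \<open>z\<close>.\<close>
  define \<eta> where "\<eta> = 1 / (2 * real N ^ 4)"
  have mn4: "4 \<le> real (m * n)" using mn_ge by (simp del: of_nat_mult)
  then have \<epsilon>: "0 < \<epsilon>" "\<epsilon> < 1" using mn by (auto simp: \<epsilon>_def divide_less_eq_1 simp del: of_nat_mult)
  have \<eta>: "0 < \<eta>" using N by (simp add: \<eta>_def)
  have opt: "(\<Sum>i\<in>Idx. point x i / z i) \<le> real (m * n)"
    if x: "\<And>k. dimP \<le> k \<Longrightarrow> x k = coord k" and nonneg: "\<And>i. i \<in> Idx \<Longrightarrow> 0 \<le> point x i" for x
  proof -
    have "margins (\<lambda>i. z i + (\<Sum>k<dimP. (x k - coord k) * u k i))"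
      using z(1) by (intro margins_add zero_margins_sum u) (auto simp: Pol_iff)
    also have "margins (\<lambda>i. z i + (\<Sum>k<dimP. (x k - coord k) * u k i)) = margins (\<lambda>i\<in>Idx. point x i)"
    proof (rule margins_cong)
      fix i assume i: "i \<in> Idx"
      have "(\<Sum>k<dimP. (x k - coord k) * u k i) = (\<Sum>k<m * n. (x k - coord k) * u k i)"
        using d_le by (intro sum.mono_neutral_left) (auto simp: x not_less)
      also have "\<dots> = point x i - point coord i" by (simp add: point_def left_diff_distrib sum_subtractf)
      finally show "z i + (\<Sum>k<dimP. (x k - coord k) * u k i) = (\<lambda>i\<in>Idx. point x i) i"
        using i by (simp add: point_coord)
    qed
    finally have "(\<lambda>i\<in>Idx. point x i) \<in> Pol" using nonneg by (simp add: Pol_iff)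
    then have "(\<Sum>i\<in>Idx. (\<lambda>i\<in>Idx. point x i) i / z i) \<le> real (m * n)"
      by (intro maximizer_optimal[OF z(1,2,4)])
    then show ?thesis by simp
  qed
  have small: "real (m * n - dimP) * \<eta> \<le> z i" if i: "i \<in> Idx" for i
  proof -
    have "real e * \<eta> \<le> 2 * real N * \<eta>" using e_le \<eta> by (intro mult_right_mono) auto
    also have "\<dots> = 1 / real N ^ 3" using N by (simp add: \<eta>_def power3_eq_cube power4_eq_xxxx)
    also have "\<dots> \<le> z i" by (rule maximizer_ge[OF z(1,2,4) i])
    finally show ?thesis by (simp add: e_def)
  qed
  define c where "c = (1 - \<epsilon>) ^ dimP * (2 * \<epsilon> * \<eta>) ^ e * exp (- (1 + \<epsilon>) * real (m * n))"
  have c: "0 < c" using \<epsilon> \<eta> by (simp add: c_def)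
  have vol_c: "section_volume * ennreal c \<le> ennreal ?\<beta>"
    using section_volume_le[OF opt \<epsilon> \<eta> small] by (simp add: c_def e_def)
  have "section_volume \<noteq> top"
  proof
    assume "section_volume = top"
    then have "section_volume * ennreal c = top" using c by (simp add: ennreal_top_mult)
    then show False using vol_c by (simp add: top_unique)
  qed
  then have secV: "section_volume = ennreal ?V" by (metis V ennreal_enn2real less_top)
  have V0: "0 \<le> ?V" by (simp add: V)
  have "?V * c \<le> ?\<beta>"
    using vol_c V0 \<beta> c unfolding secV by (simp add: ennreal_mult[symmetric])
  moreover have "exp (- real (m * n)) / real N ^ (6 * (m + n)) \<le> c"
  proof -
    have "exp (- 2) \<le> (1 - \<epsilon>) ^ (m * n)" unfolding \<epsilon>_def using mn_ge by (intro exp_neg_2_le_power) simp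
    also have "\<dots> \<le> (1 - \<epsilon>) ^ dimP" using \<epsilon> d_le by (intro power_decreasing) auto
    finally have 1: "exp (- 2) \<le> (1 - \<epsilon>) ^ dimP" .
    have "1 / real N ^ 6 = 1 / real N ^ 2 * (1 / real N ^ 4)" using N by (simp flip: power_add)
    also have "\<dots> \<le> \<epsilon> * (1 / real N ^ 4)"
    proof (rule mult_right_mono)
      show "1 / real N ^ 2 \<le> \<epsilon>"
        unfolding \<epsilon>_def by (rule frac_le) (use mn_le mn4 in linarith)+
    qed simp
    also have "\<dots> = 2 * \<epsilon> * \<eta>" by (simp add: \<eta>_def)
    finally have 2: "(1 / real N ^ 6) ^ e \<le> (2 * \<epsilon> * \<eta>) ^ e" by (rule power_mono) simp
    have 3: "exp (- (1 + \<epsilon>) * real (m * n)) = exp (- 1) * exp (- real (m * n))"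
    proof -
      have "real (m * n) \<noteq> 0" using mn4 by linarith
      then have "\<epsilon> * real (m * n) = 1"
        unfolding \<epsilon>_def times_divide_eq_left mult_1_left by (rule divide_self)
      then have "- (1 + \<epsilon>) * real (m * n) = - 1 + - real (m * n)"
        by (simp add: algebra_simps del: of_nat_mult)
      then show ?thesis by (simp only: exp_add)
    qed
    \<comment> \<open>The constants exp (- 2) and exp (- 1) are paid for by one extra factor N^(-6),
      and e + 1 = m + n.\<close>
    have "exp (3::real) = exp 1 ^ 3" by (simp flip: exp_of_nat_mult)
    also have "\<dots> \<le> 3 ^ 3" by (intro power_mono exp_le) simp
    also have "\<dots> \<le> 2 ^ 6" by simp
    also have "\<dots> \<le> real N ^ 6" using N by (intro power_mono) auto
    finally have "1 / real N ^ 6 \<le> exp (- 3)" using N by (simp add: exp_minus field_simps)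
    then have "exp (- real (m * n)) * (1 / real N ^ 6 * (1 / real N ^ 6) ^ e) \<le> exp (- real (m * n)) * (exp (- 3) * (1 / real N ^ 6) ^ e)"
      by (intro mult_left_mono mult_right_mono) auto
    also have "1 / real N ^ 6 * (1 / real N ^ 6) ^ e = 1 / real N ^ (6 * (m + n))"
      by (simp add: e[symmetric] power_one_over power_mult[symmetric] power_add[symmetric] divide_simps)
    also have "exp (- real (m * n)) * (exp (- 3) * (1 / real N ^ 6) ^ e)
      = exp (- 2) * (1 / real N ^ 6) ^ e * (exp (- 1) * exp (- real (m * n)))"
      by (simp add: mult_ac flip: exp_add)
    also have "\<dots> \<le> (1 - \<epsilon>) ^ dimP * (2 * \<epsilon> * \<eta>) ^ e * (exp (- 1) * exp (- real (m * n)))"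
      using 1 2 \<epsilon> by (intro mult_right_mono mult_mono) auto
    also have "\<dots> = c" by (simp only: c_def 3)
    finally show ?thesis by simp
  qed
  ultimately have "?V * (exp (- real (m * n)) / real N ^ (6 * (m + n))) \<le> ?\<beta>"
    using V0 by (meson mult_left_mono order_trans)
  then show "?V \<le> max_product m n R C * exp (real (m * n)) * real N ^ (6 * (m + n))"
    using N unfolding z(3) by (simp add: exp_minus field_simps)

  \<comment> \<open>Entries of \<open>z\<close> are at most N, so the damping leaves a factor of at
    least 1 - 1 / (2 * N^2) per entry, and by Bernoulli at least 1/2 for all mn <= N^2 entries. Its
    price per direction is sqrt (pi / \<delta>) <= 4 * N^2 <= N^4.\<close>
  define \<delta> where "\<delta> = 1 / (4 * real N ^ 4)"
  have \<delta>: "0 < \<delta>" using N by (simp add: \<delta>_def)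
  have z2: "2 * \<delta> * (z i)\<^sup>2 \<le> 1 / (2 * real N ^ 2)" if i: "i \<in> Idx" for i
  proof -
    have "(z i)\<^sup>2 \<le> real N ^ 2"
      using z(2)[OF i] Pol_le_N[OF z(1) i] by (intro power_mono) auto
    then have "2 * \<delta> * (z i)\<^sup>2 \<le> 2 * \<delta> * real N ^ 2" using \<delta> by (intro mult_left_mono) auto
    also have "\<dots> = 1 / (2 * real N ^ 2)" using N by (simp add: \<delta>_def power2_eq_square power4_eq_xxxx)
    finally show ?thesis .
  qed
  have half: "1 / (2 * real N ^ 2) \<le> 1" using N power_mono[of 2 "real N" 2] by (simp add: divide_le_eq)
  have "1 / 2 \<le> 1 - real (m * n) * (1 / (2 * real N ^ 2))" using mn_le N by (simp add: field_simps)
  also have "\<dots> \<le> (1 - 1 / (2 * real N ^ 2)) ^ (m * n)"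
    using Bernoulli_inequality[of "- (1 / (2 * real N ^ 2))" "m * n"] half by simp
  also have "\<dots> = (\<Prod>i\<in>Idx. 1 - 1 / (2 * real N ^ 2))" by simp
  also have "\<dots> \<le> (\<Prod>i\<in>Idx. 1 - 2 * \<delta> * (z i)\<^sup>2)"
    using z2 half by (intro prod_mono) auto
  finally have prod_half: "1 / 2 \<le> (\<Prod>i\<in>Idx. 1 - 2 * \<delta> * (z i)\<^sup>2)" .
  have "sqrt (pi / \<delta>) \<le> sqrt ((4 * real N ^ 2) ^ 2)"
    using N pi_less_4 by (intro real_sqrt_le_mono) (simp add: \<delta>_def power_mult_distrib mult_right_mono)
  also have "\<dots> = 4 * real N ^ 2" by (rule real_sqrt_unique[OF refl]) simp
  also have "\<dots> \<le> real N ^ 2 * real N ^ 2" using N power_mono[of 2 "real N" 2] by (intro mult_right_mono) auto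
  finally have sq: "sqrt (pi / \<delta>) \<le> real N ^ 4" by (simp flip: power_add)
  have "?\<beta> * exp (real (m * n)) * (1 / 2) \<le> ?\<beta> * exp (real (m * n)) * (\<Prod>i\<in>Idx. 1 - 2 * \<delta> * (z i)\<^sup>2)"
    using \<beta> prod_half by (intro mult_left_mono) auto
  also have "\<dots> \<le> ?V * sqrt (pi / \<delta>) ^ e"
    unfolding e_def using secV \<delta> order_trans[OF z2 half] by (intro section_volume_ge) auto
  also have "\<dots> \<le> ?V * (real N ^ 4) ^ e"
    using V0 sq \<delta> by (intro mult_left_mono power_mono) auto
  finally have "?\<beta> * exp (real (m * n)) \<le> ?V * (2 * (real N ^ 4) ^ e)" by simp
  also have "\<dots> \<le> ?V * (real N * (real N ^ 4) ^ e)"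
    using V0 N by (intro mult_left_mono mult_right_mono) auto
  also have "\<dots> = ?V * real N ^ (1 + 4 * e)" by (simp add: power_mult)
  also have "\<dots> \<le> ?V * real N ^ (6 * (m + n))"
    using V0 N e by (intro mult_left_mono power_increasing) auto
  finally show "max_product m n R C * exp (real (m * n)) \<le> ?V * real N ^ (6 * (m + n))"
    unfolding z(3) .
qed

end

theorem theorem1p2:
  shows "\<exists>\<gamma>::real. \<gamma> > 0 \<and>
    (\<forall>(m::nat) (n::nat) (R::nat \<Rightarrow> nat) (C::nat \<Rightarrow> nat) (N::nat).
       m > 1 \<longrightarrow> n > 1 \<longrightarrow>
       (\<forall>i<m. R i > 0) \<longrightarrow> (\<forall>j<n. C j > 0) \<longrightarrow>
       (\<Sum>i<m. R i) = N \<longrightarrow> (\<Sum>j<n. C j) = N \<longrightarrow>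
       max_product m n R C * exp (real (m * n)) * real N powr (\<gamma> * real (m + n))
         \<ge> polytope_volume m n R C \<and>
       polytope_volume m n R C
         \<ge> max_product m n R C * exp (real (m * n)) * real N powr (- (\<gamma> * real (m + n))))"
proof (intro exI[of _ 6] conjI[of "0 < (6::real)"] allI impI)
  fix m n N :: nat and R C :: "nat \<Rightarrow> nat"
  assume "m > 1" "n > 1" "\<forall>i<m. R i > 0" "\<forall>j<n. C j > 0" "(\<Sum>i<m. R i) = N" "(\<Sum>j<n. C j) = N"
  then interpret transportation m n R C N by unfold_locales auto
  have N: "0 < real N" using N_ge_2 by simp
  have "real N powr (6 * real (m + n)) = real N powr real (6 * (m + n))" by simp
  also have "\<dots> = real N ^ (6 * (m + n))" using N by (rule powr_realpow)
  finally have pw: "real N powr (6 * real (m + n)) = real N ^ (6 * (m + n))" .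
  show "polytope_volume m n R C \<le> max_product m n R C * exp (real (m * n)) * real N powr (6 * real (m + n)) \<and>
    max_product m n R C * exp (real (m * n)) * real N powr (- (6 * real (m + n))) \<le> polytope_volume m n R C"
    using polytope_volume_bounds N unfolding powr_minus pw by (simp add: field_simps)
qed simp

end
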